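(* Let $W:\mathbb{R}^d\to\mathbb{R}_+$ be continuous and satisfy the growth condition (G), let $a\in\mathbb{R}$ and $u^\pm\in\mathbb{R}^d_a$ with $W(u^\pm)=0$, and assume $\mathrm{geod}^a_W(u^-,u^+)=\mathrm{geod}_W(u^-,u^+)$. Then every global minimizer $u$ of problem $(\mathcal P)$ is one-dimensional: $u(x)=g(x_1)$ for some $g:\mathbb{R}\to\mathbb{R}^d_a$.
   Context: $d\ge2$, $\mathbb{T}=\mathbb{R}/\mathbb{Z}$, $\Omega=\mathbb{R}\times\mathbb{T}^{d-1}$, $x=(x_1,x')$. $\dot H^1_{div}(\Omega,\mathbb{R}^d)=\{u\in H^1_{loc}:\nabla u\in L^2,\ \nabla\cdot u=0\}$, $E(u)=\int_\Omega\frac12|\nabla u|^2+W(u)dx$, $\overline{u}(x_1)=\int_{\mathbb{T}^{d-1}}u(x_1,x')dx'$. Problem $(\mathcal P)$: minimize $E$ over $u\in\dot H^1_{div}(\Omega,\mathbb{R}^d)$ with $\lim_{x_1\to\pm\infty}\overline{u}(x_1)=u^\pm$; a global minimizer attains the infimum. $\mathbb{R}^d_a=\{z:z_1=a\}$. $\mathrm{geod}^a_W(x,y)=\inf\{\int_{-1}^1\sqrt{2W(\gamma)}|\dot\gamma|:\gamma\in\mathrm{Lip}([-1,1],\mathbb{R}^d_a),\gamma(-1)=x,\gamma(1)=y\}$ and $\mathrm{geod}_W$ is defined the same way with curves in $\mathbb{R}^d$. Growth condition (G): there exist $C,\beta>0$ with $W(z)\le Ce^{\beta|z|^2}$ for all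 $z$ if $d=2$, and $W(z)\le C(1+|z|^{2d/(d-2)})$ for all $z$ if $d\ge3$. *)

theory Defs
  imports "HOL-Analysis.Analysis"
begin

text \<open>Conventions. The dimension d is CARD('n) for a finite index type 'n; the
distinguished "first" coordinate x_1 is the coordinate with index k :: 'n.
Functions on Omega = R x T^(d-1) are represented as functions on R^d which are
1-periodic in every coordinate i different from k.\<close>

definition periodic_off :: "'n::finite \<Rightarrow> (real^'n \<Rightarrow> 'b) \<Rightarrow> bool" where
  "periodic_off k u \<longleftrightarrow> (\<forall>x i. i \<noteq> k \<longrightarrow> u (x + axis i 1) = u x)"

text \<open>Fundamental domain R x [0,1]^(d-1) of Omega.\<close>
definition strip :: "'n::finite \<Rightarrow> (real^'n) set" where
  "strip k = {x. \<forall>i. i \<noteq> k \<longrightarrow> 0 \<le> x$i \<and> x$i \<le> 1}"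

definition L2_loc :: "(real^'n::finite \<Rightarrow> 'b::real_normed_vector) \<Rightarrow> bool" where
  "L2_loc f \<longleftrightarrow> f \<in> borel_measurable lebesgue \<and>
     (\<forall>K. compact K \<longrightarrow> (\<integral>\<^sup>+x\<in>K. ennreal ((norm (f x))\<^sup>2) \<partial>lebesgue) < \<infinity>)"

definition test_fun :: "(real^'n::finite \<Rightarrow> real) \<Rightarrow> (real^'n \<Rightarrow> real^'n) \<Rightarrow> bool" where
  "test_fun \<phi> D \<longleftrightarrow> (\<forall>x. (\<phi> has_derivative (\<lambda>h. D x \<bullet> h)) (at x)) \<and>
     continuous_on UNIV D \<and> (\<exists>R. \<forall>x. norm x > R \<longrightarrow> \<phi> x = 0)"

definition weak_grad :: "(real^'n::finite \<Rightarrow> real^'n) \<Rightarrow> (real^'n \<Rightarrow> real^'n^'n) \<Rightarrow> bool" where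
  "weak_grad u G \<longleftrightarrow> (\<forall>\<phi> D. test_fun \<phi> D \<longrightarrow> (\<forall>i j.
      (\<integral>x. u x $ i * D x $ j \<partial>lebesgue) = - (\<integral>x. G x $ i $ j * \<phi> x \<partial>lebesgue)))"

definition H1div :: "'n::finite \<Rightarrow> (real^'n \<Rightarrow> real^'n) \<Rightarrow> (real^'n \<Rightarrow> real^'n^'n) \<Rightarrow> bool" where
  "H1div k u G \<longleftrightarrow> periodic_off k u \<and> L2_loc u \<and> L2_loc G \<and> weak_grad u G \<and>
     (\<integral>\<^sup>+x\<in>strip k. ennreal ((norm (G x))\<^sup>2) \<partial>lebesgue) < \<infinity> \<and>
     (AE x in lebesgue. (\<Sum>i\<in>UNIV. G x $ i $ i) = 0)"

text \<open>Average over the torus: ubar(t) = int_{T^(d-1)} u(t,x') dx'. The k-th coordinate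
of y is ignored; integrating it over [0,1] contributes a factor 1.\<close>
definition ubar :: "'n::finite \<Rightarrow> (real^'n \<Rightarrow> real^'n) \<Rightarrow> real \<Rightarrow> real^'n" where
  "ubar k u t = (\<integral>y. u (\<chi> i. if i = k then t else y $ i) \<partial>(lebesgue_on (cbox 0 1)))"

text \<open>Limit at +infinity / -infinity, up to null sets in t (representative-independent).\<close>
definition ess_lim_top :: "(real \<Rightarrow> 'b::metric_space) \<Rightarrow> 'b \<Rightarrow> bool" where
  "ess_lim_top f l \<longleftrightarrow> (\<forall>e>0. \<exists>R. AE t in lborel. t \<ge> R \<longrightarrow> dist (f t) l < e)"

definition ess_lim_bot :: "(real \<Rightarrow> 'b::metric_space) \<Rightarrow> 'b \<Rightarrow> bool" where
  "ess_lim_bot f l \<longleftrightarrow> (\<forall>e>0. \<exists>R. AE t in lborel. t \<le> R \<longrightarrow> dist (f t) l < e)"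

definition admissible :: "'n::finite \<Rightarrow> real^'n \<Rightarrow> real^'n \<Rightarrow> (real^'n \<Rightarrow> real^'n) \<Rightarrow> (real^'n \<Rightarrow> real^'n^'n) \<Rightarrow> bool" where
  "admissible k um up u G \<longleftrightarrow> H1div k u G \<and>
     ess_lim_bot (ubar k u) um \<and> ess_lim_top (ubar k u) up"

definition energy :: "'n::finite \<Rightarrow> (real^'n \<Rightarrow> real) \<Rightarrow> (real^'n \<Rightarrow> real^'n) \<Rightarrow> (real^'n \<Rightarrow> real^'n^'n) \<Rightarrow> ennreal" where
  "energy k W u G = (\<integral>\<^sup>+x\<in>strip k. ennreal ((norm (G x))\<^sup>2 / 2 + W (u x)) \<partial>lebesgue)"

definition global_minimizer :: "'n::finite \<Rightarrow> (real^'n \<Rightarrow> real) \<Rightarrow> real^'n \<Rightarrow> real^'n \<Rightarrow> (real^'n \<Rightarrow> real^'n) \<Rightarrow> bool" where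
  "global_minimizer k W um up u \<longleftrightarrow> (\<exists>G. admissible k um up u G \<and>
     (\<forall>v H. admissible k um up v H \<longrightarrow> energy k W u G \<le> energy k W v H))"

definition wlength :: "(real^'n::finite \<Rightarrow> real) \<Rightarrow> (real \<Rightarrow> real^'n) \<Rightarrow> ennreal" where
  "wlength W \<gamma> = (\<integral>\<^sup>+t\<in>{-1..1}. ennreal (sqrt (2 * W (\<gamma> t)) * norm (vector_derivative \<gamma> (at t))) \<partial>lborel)"

definition geodW :: "(real^'n::finite \<Rightarrow> real) \<Rightarrow> real^'n \<Rightarrow> real^'n \<Rightarrow> ennreal" where
  "geodW W x y = (INF \<gamma>\<in>{\<gamma>. (\<exists>L. L-lipschitz_on {-1..1} \<gamma>) \<and> \<gamma> (-1) = x \<and> \<gamma> 1 = y}. wlength W \<gamma>)"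

definition geodW_a :: "'n::finite \<Rightarrow> real \<Rightarrow> (real^'n \<Rightarrow> real) \<Rightarrow> real^'n \<Rightarrow> real^'n \<Rightarrow> ennreal" where
  "geodW_a k a W x y = (INF \<gamma>\<in>{\<gamma>. (\<exists>L. L-lipschitz_on {-1..1} \<gamma>) \<and> (\<forall>t\<in>{-1..1}. \<gamma> t $ k = a) \<and>
       \<gamma> (-1) = x \<and> \<gamma> 1 = y}. wlength W \<gamma>)"

definition growth_G :: "(real^'n::finite \<Rightarrow> real) \<Rightarrow> bool" where
  "growth_G W \<longleftrightarrow> (\<exists>C \<beta>. C > 0 \<and> \<beta> > 0 \<and>
     (if CARD('n) = 2 then (\<forall>z. W z \<le> C * exp (\<beta> * (norm z)\<^sup>2))
      else (\<forall>z. W z \<le> C * (1 + norm z powr (2 * real CARD('n) / (real CARD('n) - 2))))))"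

end

theory Submission
  imports Defs
begin

text \<open>
  On almost every line in direction \<open>k\<close> the minimizer \<open>u\<close> is absolutely continuous and comes arbitrarily
  close to \<open>um\<close> and \<open>up\<close>, because by a Poincare inequality \<open>u - ubar\<close> is square integrable.
  Hence \<open>sqrt (2 W) |\<partial>\<^sub>k u| \<le> |\<partial>\<^sub>k u|\<^sup>2 / 2 + W\<close> bounds the energy of each line from below by \<open>geodW\<close>.
  Conversely, one-dimensional competitors that follow polygonal curves in the hyperplane \<open>z\<^sub>k = a\<close>, which are
  divergence free, show that the energy of \<open>u\<close> is at most \<open>geodW_a = geodW\<close>.  Integrating over all lines
  leaves no room for the derivatives transversal to \<open>k\<close>, so they vanish.  Then \<open>div u = 0\<close> makes the \<open>k\<close>-th
  component constant.

  Polygons mediate between Lipschitz curves, absolutely continuous lines and admissible competitors: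
  the costs of all of these are compared with the cost of a polygon whose segments carry an upper bound
  of \<open>sqrt (2 W)\<close>.
\<close>

section \<open>Differentiability of Lipschitz functions of one variable\<close>

text \<open>The constraint \<open>div u = 0\<close> confines competitors that depend on
  \<open>x $ k\<close> alone to the hyperplane \<open>z $ k = a\<close>, whereas single lines of
  \<open>u\<close> may leave it; the equality of the two geodesic distances bridges exactly this
  gap. The final cancellation happens in \<open>ennreal\<close> and therefore needs a finite minimal
  energy, supplied by a competitor along the straight segment from \<open>um\<close> to
  \<open>up\<close>. The integrand of \<open>wlength\<close> contains
  \<open>vector_derivative\<close>, which says something only at points of differentiability. Hence
  Lipschitz curves must first be shown to be differentiable almost everywhere and to be integrals of
  their derivatives. For \<open>u\<close>, in contrast, no pointwise derivative is taken: the weak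
  gradient is converted into a formula for \<open>u (x + y) - u x\<close> as an integral over the
  segment, valid for each fixed \<open>y\<close> and almost every \<open>x\<close>. Taking
  \<open>y\<close> along \<open>k\<close> yields absolute continuity on lines, taking
  \<open>y\<close> transversal to \<open>k\<close> yields the Poincare inequality.\<close>

lemma emeasure_UN_ball:
  fixes M :: "real measure" and a r :: "'i \<Rightarrow> real"
  assumes "sets M = sets borel" "countable C"
    and disj: "pairwise (\<lambda>i j. disjnt (cball (a i) (r i)) (cball (a j) (r j))) C"
  shows "emeasure M (\<Union>i\<in>C. ball (a i) (r i)) = (\<integral>\<^sup>+i. emeasure M (ball (a i) (r i)) \<partial>count_space C)"
proof (rule emeasure_UN_countable)
  show "disjoint_family_on (\<lambda>i. ball (a i) (r i)) C"
    using disj ball_subset_cball unfolding disjoint_family_on_def pairwise_def disjnt_def by blast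
qed (use assms in auto)

lemma negligible_imp_small_open_cover:
  fixes N :: "'a::euclidean_space set"
  assumes "negligible N" "\<eta> > 0"
  obtains T where "open T" "N \<subseteq> T" "emeasure lborel T < ennreal \<eta>"
proof -
  have "N \<in> null_sets lebesgue" using assms by (simp add: negligible_iff_null_sets)
  then obtain T where T: "open T" "N \<subseteq> T" "T - N \<in> lmeasurable" "emeasure lebesgue (T - N) < ennreal \<eta>"
    using sets_lebesgue_outer_open[of N \<eta>] assms by (metis null_setsD2)
  have "emeasure lborel T = emeasure lebesgue T" using T(1) by simp
  also have "\<dots> = emeasure lebesgue (T - N)"
    using emeasure_Diff_null_set[OF \<open>N \<in> null_sets lebesgue\<close>, of T] T(1) by auto
  finally show ?thesis using T that by auto
qed

text \<open>The classical two-coverings argument: on a set where difference quotients below \<open>p\<close> and above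
  \<open>q > p\<close> occur at all scales, Vitali coverings force \<open>q m \<le> p m\<close> for its outer measure \<open>m\<close>.\<close>

lemma negligible_oscillating_slopes:
  fixes F :: "real \<Rightarrow> real"
  assumes mono: "mono F" and cont: "continuous_on UNIV F" and pq: "0 < p" "p < q"
    and bnd: "S \<subseteq> {-B<..<B}"
    and low: "\<And>x d. x \<in> S \<Longrightarrow> d > 0 \<Longrightarrow> \<exists>c e. c \<le> x \<and> x \<le> e \<and> c < e \<and> e - c < d \<and> F e - F c < p * (e - c)"
    and up: "\<And>x d. x \<in> S \<Longrightarrow> d > 0 \<Longrightarrow> \<exists>c e. c \<le> x \<and> x \<le> e \<and> c < e \<and> e - c < d \<and> F e - F c > q * (e - c)"
  shows "negligible S"
proof -
  \<comment> \<open>The Stieltjes measure of \<open>F\<close> turns slopes into a comparison of two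
    measures: slope below \<open>p\<close> on an interval means that \<open>mu\<close> is at most
    \<open>p\<close> times its length.\<close>
  define mu where "mu = interval_measure F"
  have setsmu: "sets mu = sets borel" unfolding mu_def by simp
  have mono': "\<And>x y. x \<le> y \<Longrightarrow> F x \<le> F y" using mono by (auto simp: mono_def)
  have Icc: "emeasure mu {c..e} = ennreal (F e - F c)" if "c \<le> e" for c e
    unfolding mu_def using emeasure_interval_measure_Icc[of c e F] that mono' cont by auto
  have pt: "emeasure mu {c} = 0" for c using Icc[of c c] by simp
  have ballmu: "emeasure mu (ball c r) = ennreal (F (c + r) - F (c - r))" if "r > 0" for c r
  proof -
    have "emeasure mu (ball c r \<union> {c-r,c+r}) = emeasure mu (ball c r)"
    proof (rule emeasure_Un_null_set)
      show "{c - r, c + r} \<in> null_sets mu"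
        using null_sets.Un[of "{c-r}" mu "{c+r}"] pt setsmu by (simp add: null_setsI insert_commute)
    qed (use setsmu in auto)
    moreover have "ball c r \<union> {c-r,c+r} = {c-r..c+r}" using that by (auto simp: ball_eq_greaterThanLessThan)
    ultimately show ?thesis using Icc[of "c-r" "c+r"] that by simp
  qed
  have balllb: "emeasure lborel (ball c r) = ennreal (2 * r)" if "r > 0" for c r :: real
    using that by (simp add: ball_eq_greaterThanLessThan)
  \<comment> \<open>\<open>S\<close> is not known to be measurable, so the argument runs with its
    outer measure \<open>m\<close>.\<close>
  define M where "M = {emeasure lborel U |U. open U \<and> S \<subseteq> U}"
  define m where "m = Inf M"
  have "emeasure lborel {-B<..<B} \<in> M" unfolding M_def using bnd by auto
  then have "m \<le> emeasure lborel {-B<..<B}" unfolding m_def by (rule Inf_lower)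
  also have "\<dots> < \<infinity>" by (cases "-B \<le> B") auto
  finally have mfin: "m < \<infinity>" .
  \<comment> \<open>Vitali's theorem extracts disjoint closed intervals with property
    \<open>Q\<close> inside \<open>U\<close> that cover \<open>S'\<close> up to a null set; dropping
    their end points makes the union open and loses only countably many points. \<open>P\<close>
    stands for the estimate that the union inherits from its intervals.\<close>
  have cover: "\<exists>V. open V \<and> V \<subseteq> U \<and> negligible (S' - V) \<and> P V"
    if U: "open U" "S' \<subseteq> U" and S': "\<And>x d. x \<in> S' \<Longrightarrow> d > 0 \<Longrightarrow> \<exists>c e. c \<le> x \<and> x \<le> e \<and> c < e \<and> e - c < d \<and> Q c e"
    and P: "\<And>C. C \<subseteq> {(c,r). 0 < r \<and> Q (c - r) (c + r)} \<Longrightarrow> countable C \<Longrightarrow>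
          pairwise (\<lambda>i j. disjnt (cball (fst i) (snd i)) (cball (fst j) (snd j))) C \<Longrightarrow>
          P (\<Union>i\<in>C. ball (fst i) (snd i))"
    for U S' Q P
  proof -
    define K where "K = {(c,r). 0 < r \<and> cball c r \<subseteq> U \<and> Q (c - r) (c + r)}"
    have 1: "\<And>i. i \<in> K \<Longrightarrow> 0 < snd i" by (auto simp: K_def)
    have 2: "\<exists>i. i \<in> K \<and> x \<in> cball (fst i) (snd i) \<and> snd i < d" if x: "x \<in> S'" "0 < d" for x d
    proof -
      obtain k where k: "k > 0" "ball x k \<subseteq> U" using U x open_contains_ball by (metis subsetD)
      obtain c e where ce: "c \<le> x" "x \<le> e" "c < e" "e - c < min d k" "Q c e"
        using S'[OF x(1), of "min d k"] k x by auto
      show ?thesis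
      proof (intro exI[of _ "((c+e)/2, (e-c)/2)"] conjI)
        have s: "(c+e)/2 - (e-c)/2 = c" "(c+e)/2 + (e-c)/2 = e" by (auto simp: field_simps)
        have cb: "cball ((c+e)/2) ((e-c)/2) = {c..e}" unfolding cball_eq_atLeastAtMost s ..
        have "{c..e} \<subseteq> ball x k" using ce by (auto simp: dist_real_def)
        then show "((c+e)/2, (e-c)/2) \<in> K" unfolding K_def using cb k s ce by auto
        show "x \<in> cball (fst ((c+e)/2, (e-c)/2)) (snd ((c+e)/2, (e-c)/2))"
          using cb ce by simp
      qed (use ce in auto)
    qed
    obtain C where C: "countable C" "C \<subseteq> K"
     "pairwise (\<lambda>i j. disjnt (cball (fst i) (snd i)) (cball (fst j) (snd j))) C"
     "negligible(S' - (\<Union>i \<in> C. cball (fst i) (snd i)))"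
      using Vitali_covering_theorem_cballs[of K snd S' fst, OF 1 2] by blast
    let ?V = "\<Union>i\<in>C. ball (fst i) (snd i)"
    have "negligible (\<Union>i\<in>C. sphere (fst i) (snd i))"
      by (auto intro: negligible_sphere C(1))
    then have "negligible (S' - (\<Union>i \<in> C. cball(fst i)(snd i)) \<union> (\<Union>i \<in> C. sphere (fst i) (snd i)))"
      by (rule negligible_Un [OF C(4)])
    then have "negligible (S' - ?V)"
      by (rule negligible_subset) force
    moreover have "?V \<subseteq> U" using C(2) ball_subset_cball unfolding K_def by fastforce
    moreover have "P ?V" using C by (intro P) (auto simp: K_def)
    ultimately show ?thesis by (intro exI[of _ ?V]) auto
  qed
  \<comment> \<open>The chain is \<open>q m \<le> q |V'| \<le> mu V' \<le> mu V \<le> p |V| \<le> p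
    (m + \<epsilon>)\<close>: small slopes select \<open>V\<close> inside a nearly optimal
    \<open>U\<close>, and large slopes select \<open>V'\<close> inside \<open>V\<close>.\<close>
  have key: "ennreal q * m \<le> ennreal p * (m + ennreal \<epsilon>)" if "\<epsilon> > 0" for \<epsilon>
  proof -
    have "m < m + ennreal \<epsilon>" using mfin that by (simp add: less_top ennreal_add_left_cancel_less[of m 0 "ennreal \<epsilon>", simplified])
    then obtain U where U: "open U" "S \<subseteq> U" "emeasure lborel U < m + ennreal \<epsilon>"
      unfolding m_def M_def by (auto simp: Inf_less_iff)
    have "\<exists>V. open V \<and> V \<subseteq> U \<and> negligible (S - V) \<and> emeasure mu V \<le> ennreal p * emeasure lborel V"
    proof (rule cover[where Q="\<lambda>c e. F e - F c < p * (e - c)", OF U(1,2) low])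
      fix C assume C: "C \<subseteq> {(c,r). 0 < r \<and> F (c + r) - F (c - r) < p * ((c + r) - (c - r))}" "countable C"
        "pairwise (\<lambda>i j. disjnt (cball (fst i) (snd i)) (cball (fst j) (snd j))) C"
      have "(\<integral>\<^sup>+i. emeasure mu (ball (fst i) (snd i)) \<partial>count_space C)
         \<le> (\<integral>\<^sup>+i. ennreal p * emeasure lborel (ball (fst i) (snd i)) \<partial>count_space C)"
      proof (rule nn_integral_mono)
        fix i assume i: "i \<in> space (count_space C)"
        then have *: "0 < snd i" "F (fst i + snd i) - F (fst i - snd i) < p * (2 * snd i)" using C(1) by auto
        show "emeasure mu (ball (fst i) (snd i)) \<le> ennreal p * emeasure lborel (ball (fst i) (snd i))"
          unfolding ballmu[OF *(1)] balllb[OF *(1)] using * pq by (auto simp flip: ennreal_mult intro!: ennreal_leI)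
      qed
      then show "emeasure mu (\<Union>i\<in>C. ball (fst i) (snd i)) \<le> ennreal p * emeasure lborel (\<Union>i\<in>C. ball (fst i) (snd i))"
        using emeasure_UN_ball[OF setsmu C(2,3)] emeasure_UN_ball[OF sets_lborel C(2,3)]
        by (simp add: nn_integral_cmult)
    qed
    then obtain V where V: "open V" "V \<subseteq> U" "negligible (S - V)" "emeasure mu V \<le> ennreal p * emeasure lborel V" by blast
    have "\<exists>V'. open V' \<and> V' \<subseteq> V \<and> negligible (S \<inter> V - V') \<and> ennreal q * emeasure lborel V' \<le> emeasure mu V'"
    proof (rule cover[where Q="\<lambda>c e. F e - F c > q * (e - c)", OF V(1)])
      fix C assume C: "C \<subseteq> {(c,r). 0 < r \<and> F (c + r) - F (c - r) > q * ((c + r) - (c - r))}" "countable C"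
        "pairwise (\<lambda>i j. disjnt (cball (fst i) (snd i)) (cball (fst j) (snd j))) C"
      have "(\<integral>\<^sup>+i. ennreal q * emeasure lborel (ball (fst i) (snd i)) \<partial>count_space C)
         \<le> (\<integral>\<^sup>+i. emeasure mu (ball (fst i) (snd i)) \<partial>count_space C)"
      proof (rule nn_integral_mono)
        fix i assume i: "i \<in> space (count_space C)"
        then have *: "0 < snd i" "F (fst i + snd i) - F (fst i - snd i) > q * (2 * snd i)" using C(1) by auto
        show "ennreal q * emeasure lborel (ball (fst i) (snd i)) \<le> emeasure mu (ball (fst i) (snd i))"
          unfolding ballmu[OF *(1)] balllb[OF *(1)] using * pq by (auto simp flip: ennreal_mult intro!: ennreal_leI)
      qed
      then show "ennreal q * emeasure lborel (\<Union>i\<in>C. ball (fst i) (snd i)) \<le> emeasure mu (\<Union>i\<in>C. ball (fst i) (snd i))"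
        using emeasure_UN_ball[OF setsmu C(2,3)] emeasure_UN_ball[OF sets_lborel C(2,3)]
        by (simp add: nn_integral_cmult)
    next
      show "\<exists>c e. c \<le> x \<and> x \<le> e \<and> c < e \<and> e - c < d \<and> F e - F c > q * (e - c)" if "x \<in> S \<inter> V" "d > 0" for x d
        using up[of x d] that by blast
    qed auto
    then obtain V' where V': "open V'" "V' \<subseteq> V" "negligible (S \<inter> V - V')" "ennreal q * emeasure lborel V' \<le> emeasure mu V'" by blast
    have neg: "negligible (S - V')"
      by (rule negligible_subset[OF negligible_Un[OF V(3) V'(3)]]) auto
    \<comment> \<open>\<open>V'\<close> misses a null part of \<open>S\<close>, so an open set of
      measure below \<eta> is added before comparing with the infimum.\<close>
    have "m \<le> emeasure lborel V'"
    proof (rule ennreal_le_epsilon)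
      fix \<eta> :: real assume "\<eta> > 0"
      then obtain T where T: "open T" "S - V' \<subseteq> T" "emeasure lborel T < ennreal \<eta>"
        using negligible_imp_small_open_cover[OF neg] by metis
      have "emeasure lborel (V' \<union> T) \<in> M" unfolding M_def using T V' by blast
      then have "m \<le> emeasure lborel (V' \<union> T)" unfolding m_def by (rule Inf_lower)
      also have "\<dots> \<le> emeasure lborel V' + emeasure lborel T"
        by (rule emeasure_subadditive) (use T V' in auto)
      also have "\<dots> \<le> emeasure lborel V' + ennreal \<eta>" using T by (intro add_left_mono) auto
      finally show "m \<le> emeasure lborel V' + ennreal \<eta>" .
    qed
    then have "ennreal q * m \<le> ennreal q * emeasure lborel V'" by (rule mult_left_mono) auto
    also have "\<dots> \<le> emeasure mu V'" by fact
    also have "\<dots> \<le> emeasure mu V" by (rule emeasure_mono) (use V V' setsmu in auto)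
    also have "\<dots> \<le> ennreal p * emeasure lborel V" by fact
    also have "\<dots> \<le> ennreal p * emeasure lborel U" 
      by (rule mult_left_mono[OF emeasure_mono]) (use V U in auto)
    also have "\<dots> \<le> ennreal p * (m + ennreal \<epsilon>)" by (rule mult_left_mono) (use U in auto)
    finally show ?thesis .
  qed
  obtain m' where m': "m = ennreal m'" "m' \<ge> 0" using mfin by (cases m) auto
  have key': "(q - p) * m' \<le> p * \<epsilon>" if "\<epsilon> > 0" for \<epsilon>
    using key[OF that] m' pq that by (simp add: ennreal_plus[symmetric] ennreal_mult[symmetric] algebra_simps del: ennreal_plus)
  have "(q - p) * m' \<le> 0"
  proof (rule field_le_epsilon)
    fix e :: real assume "e > 0"
    then show "(q - p) * m' \<le> 0 + e" using key'[of "e / p"] pq by simp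
  qed
  then have "m' \<le> 0" using pq by (simp add: mult_le_0_iff)
  then have m0: "m = 0" using m' by simp
  show ?thesis
    unfolding negligible_outer_le
  proof (intro allI impI)
    fix e :: real assume "e > 0"
    then have "Inf M < ennreal e" using m0 m_def by simp
    then obtain U where U: "open U" "S \<subseteq> U" "emeasure lborel U < ennreal e" unfolding M_def by (auto simp: Inf_less_iff)
    have "U \<in> lmeasurable" by (rule fmeasurableI) (use U in \<open>auto simp: less_top intro: order_less_trans\<close>)
    moreover have "measure lebesgue U \<le> e" 
      using U(3) \<open>e > 0\<close> U(1) by (simp add: measure_def enn2real_leI less_imp_le)
    ultimately show "\<exists>T. S \<subseteq> T \<and> T \<in> lmeasurable \<and> measure lebesgue T \<le> e" using U by blast
  qed
qed

text \<open>Failure of convergence means that lower and upper limit differ, which leaves room for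
  two rationals between them. Rationality keeps the number of exceptional sets in Lebesgue's
  differentiation theorem countable.\<close>

lemma slopes_converge_or_oscillate:
  fixes s :: "real \<Rightarrow> real"
  assumes bnd: "\<And>h. h \<noteq> 0 \<Longrightarrow> 0 \<le> s h" "\<And>h. h \<noteq> 0 \<Longrightarrow> s h \<le> B"
  shows "(\<exists>l. (s \<longlongrightarrow> l) (at 0)) \<or>
    (\<exists>p\<in>\<rat>. \<exists>q\<in>\<rat>. 0 < p \<and> p < q \<and> (\<forall>d>0. \<exists>h. h \<noteq> 0 \<and> \<bar>h\<bar> < d \<and> s h < p) \<and> (\<forall>d>0. \<exists>h. h \<noteq> 0 \<and> \<bar>h\<bar> < d \<and> s h > q))"
proof -
  define l where "l = Liminf (at 0) (\<lambda>h. ereal (s h))"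
  define u where "u = Limsup (at 0) (\<lambda>h. ereal (s h))"
  have ev: "eventually (\<lambda>h::real. h \<noteq> 0) (at 0)" by (simp add: eventually_at_filter)
  have l0: "0 \<le> l" unfolding l_def
    by (rule Liminf_bounded, rule eventually_mono[OF ev]) (use bnd in auto)
  have uB: "u \<le> ereal B" unfolding u_def
    by (rule Limsup_bounded, rule eventually_mono[OF ev]) (use bnd in auto)
  have lu: "l \<le> u" unfolding l_def u_def by (rule Liminf_le_Limsup) simp
  show ?thesis
  proof (cases "l = u")
    case True
    obtain r where r: "l = ereal r" using l0 uB True by (cases l) auto
    have "((\<lambda>h. ereal (s h)) \<longlongrightarrow> ereal r) (at 0)"
      using True r tendsto_iff_Liminf_eq_Limsup[of "at 0" "\<lambda>h. ereal (s h)" "ereal r"] unfolding l_def u_def by simp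
    then show ?thesis by auto
  next
    case False
    then have "l < u" using lu by simp
    obtain r2 where r2: "l < ereal r2" "ereal r2 < u" using ereal_dense2[OF \<open>l < u\<close>] by blast
    \<comment> \<open>\<open>p\<close> is chosen above a real \<open>r1 > l \<ge> 0\<close>, which
      makes it strictly positive.\<close>
    obtain r1 where r1: "l < ereal r1" "ereal r1 < ereal r2" using ereal_dense2[OF r2(1)] by blast
    obtain p where p: "p \<in> \<rat>" "r1 < p" "p < r2" using Rats_dense_in_real[of r1 r2] r1 by auto
    obtain q where q: "q \<in> \<rat>" "p < q" "q < r2" using Rats_dense_in_real[of p r2] p by auto
    have "0 \<le> r1" using l0 r1 by (metis ereal_less_eq(5) less_imp_le order_trans)
    have np: "\<not> eventually (\<lambda>h. p \<le> s h) (at 0)"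
    proof
      assume "eventually (\<lambda>h. p \<le> s h) (at 0)"
      then have "ereal p \<le> l" unfolding l_def by (intro Liminf_bounded) auto
      then show False using r1 p by (metis ereal_less_eq(3) less_le_not_le order_less_le_trans)
    qed
    have nq: "\<not> eventually (\<lambda>h. s h \<le> q) (at 0)"
    proof
      assume "eventually (\<lambda>h. s h \<le> q) (at 0)"
      then have "u \<le> ereal q" unfolding u_def by (intro Limsup_bounded) auto
      then show False using r2 q by (metis ereal_less_eq(3) less_le_not_le order_less_le_trans)
    qed
    have "\<forall>d>0. \<exists>h. h \<noteq> 0 \<and> \<bar>h\<bar> < d \<and> s h < p" using np unfolding eventually_at by (auto simp: dist_real_def not_le)
    moreover have "\<forall>d>0. \<exists>h. h \<noteq> 0 \<and> \<bar>h\<bar> < d \<and> s h > q" using nq unfolding eventually_at by (auto simp: dist_real_def not_le)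
    ultimately show ?thesis using p q \<open>0 \<le> r1\<close> by (intro disjI2 bexI[of _ p] bexI[of _ q]) auto
  qed
qed

lemma lipschitz_AE_differentiable_real:
  fixes f :: "real \<Rightarrow> real"
  assumes L: "L-lipschitz_on UNIV f"
  shows "AE x in lebesgue. f differentiable (at x)"
proof -
  \<comment> \<open>The summand \<open>L * x\<close> makes \<open>f\<close> increasing and confines
    all slopes to the interval from \<open>0\<close> to \<open>2 * L\<close>, without changing where
    it is differentiable.\<close>
  define F where "F x = f x + L * x" for x
  have fd: "\<bar>f x - f y\<bar> \<le> L * \<bar>x - y\<bar>" for x y using lipschitz_onD[OF L, of x y] by (simp add: dist_real_def)
  have mono: "mono F"
  proof (rule monoI)
    fix x y :: real assume "x \<le> y"
    then show "F x \<le> F y" using fd[of x y] unfolding F_def by (simp add: algebra_simps abs_le_iff)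
  qed
  have cont: "continuous_on UNIV F" unfolding F_def
    by (intro continuous_intros lipschitz_on_continuous_on[OF L])
  define osc where "osc p x \<longleftrightarrow> (\<forall>d>0. \<exists>h. h \<noteq> 0 \<and> \<bar>h\<bar> < d \<and> (F (x + h) - F x) / h < p)" for p x
  define osc' where "osc' q x \<longleftrightarrow> (\<forall>d>0. \<exists>h. h \<noteq> 0 \<and> \<bar>h\<bar> < d \<and> (F (x + h) - F x) / h > q)" for q x
  \<comment> \<open>The bound \<open>n\<close> makes each exceptional set bounded, hence of finite
    outer measure.\<close>
  define S where "S = (\<lambda>(p,q,n). {x \<in> {-real n<..<real n}. 0 < p \<and> p < q \<and> osc p x \<and> osc' q x})"
  have neg: "negligible (S (p,q,n))" for p q n
  proof (cases "0 < p \<and> p < q")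
    case True
    show ?thesis
    proof (rule negligible_oscillating_slopes[OF mono cont, of p q _ "real n"])
      fix x d :: real assume x: "x \<in> S (p,q,n)" "d > 0"
      then obtain h where h: "h \<noteq> 0" "\<bar>h\<bar> < d" "(F (x + h) - F x) / h < p" unfolding S_def osc_def by auto
      show "\<exists>c e. c \<le> x \<and> x \<le> e \<and> c < e \<and> e - c < d \<and> F e - F c < p * (e - c)"
      proof (cases "h > 0")
        case True
        then show ?thesis using h by (intro exI[of _ x] exI[of _ "x + h"]) (auto simp: field_simps)
      next
        case False
        then show ?thesis using h by (intro exI[of _ "x + h"] exI[of _ x]) (auto simp: field_simps)
      qed
      obtain h where h: "h \<noteq> 0" "\<bar>h\<bar> < d" "(F (x + h) - F x) / h > q" using x unfolding S_def osc'_def by auto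
      show "\<exists>c e. c \<le> x \<and> x \<le> e \<and> c < e \<and> e - c < d \<and> F e - F c > q * (e - c)"
      proof (cases "h > 0")
        case True
        then show ?thesis using h by (intro exI[of _ x] exI[of _ "x + h"]) (auto simp: field_simps)
      next
        case False
        then show ?thesis using h by (intro exI[of _ "x + h"] exI[of _ x]) (auto simp: field_simps)
      qed
    next
      show "S (p,q,n) \<subseteq> {-real n<..<real n}" unfolding S_def by auto
    qed (use True in simp_all)
  qed (auto simp: S_def)
  define N where "N = (\<Union>i\<in>\<rat>\<times>\<rat>\<times>UNIV. S i)"
  have "negligible N" unfolding N_def
  proof (rule negligible_countable_Union)
    show "countable (S ` (\<rat>\<times>\<rat>\<times>UNIV))" by (intro countable_image countable_SIGMA countable_rat) auto
  next
    fix T assume "T \<in> S ` (\<rat>\<times>\<rat>\<times>UNIV)"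
    then obtain p q n where "T = S (p, q, n)" by blast
    then show "negligible T" using neg by simp
  qed
  moreover have "f differentiable (at x)" if "x \<notin> N" for x
  proof -
    have sl: "0 \<le> (F (x + h) - F x) / h" "(F (x + h) - F x) / h \<le> 2 * L" if "h \<noteq> 0" for h
    proof -
      have "\<bar>(f (x + h) - f x) / h\<bar> \<le> L" using fd[of "x+h" x] that by (simp add: abs_divide divide_le_eq)
      moreover have "(F (x + h) - F x) / h = (f (x + h) - f x) / h + L" using that unfolding F_def by (simp add: field_simps)
      ultimately show "0 \<le> (F (x + h) - F x) / h" "(F (x + h) - F x) / h \<le> 2 * L" by linarith+
    qed
    have "\<not> (\<exists>p\<in>\<rat>. \<exists>q\<in>\<rat>. 0 < p \<and> p < q \<and> osc p x \<and> osc' q x)"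
    proof
      assume "\<exists>p\<in>\<rat>. \<exists>q\<in>\<rat>. 0 < p \<and> p < q \<and> osc p x \<and> osc' q x"
      then obtain p q where pq: "p \<in> \<rat>" "q \<in> \<rat>" "0 < p" "p < q" "osc p x" "osc' q x" by blast
      obtain n :: nat where "\<bar>x\<bar> < real n" using reals_Archimedean2 by blast
      then have "x \<in> S (p, q, n)" unfolding S_def using pq by auto
      then show False using that pq unfolding N_def by blast
    qed
    then obtain l where "((\<lambda>h. (F (x + h) - F x) / h) \<longlongrightarrow> l) (at 0)"
      using slopes_converge_or_oscillate[of "\<lambda>h. (F (x + h) - F x) / h" "2 * L", OF sl] unfolding osc_def osc'_def by blast
    then have "DERIV F x :> l" by (simp add: DERIV_def)
    then have "DERIV (\<lambda>x. F x - L * x) x :> l - L" by (auto intro!: derivative_eq_intros)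
    moreover have "(\<lambda>x. F x - L * x) = f" by (auto simp: F_def)
    ultimately show ?thesis by (metis real_differentiable_def)
  qed
  ultimately show ?thesis
    by (intro AE_I'[of N]) (auto simp: negligible_iff_null_sets)
qed

text \<open>Difference quotients are bounded by \<open>L\<close>, and their integral over an
  interval is the difference of two short averages of \<gamma> taken at its ends. Dominated
  convergence passes to the limit in both readings.\<close>

lemma lipschitz_fundamental_theorem:
  fixes \<gamma> :: "real \<Rightarrow> 'a::euclidean_space"
  assumes L: "L-lipschitz_on UNIV \<gamma>"
  obtains D where "D \<in> borel_measurable borel" "\<And>t. norm (D t) \<le> L"
    "AE t in lebesgue. (\<gamma> has_vector_derivative D t) (at t)"
    "\<And>s t. s \<le> t \<Longrightarrow> (LINT x|lborel. indicator {s..t} x *\<^sub>R D x) = \<gamma> t - \<gamma> s"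
proof -
  have L0: "L \<ge> 0" using L by (rule lipschitz_on_nonneg)
  have cont: "continuous_on UNIV \<gamma>" by (rule lipschitz_on_continuous_on[OF L])
  then have meas[measurable]: "\<gamma> \<in> borel_measurable borel" by (rule borel_measurable_continuous_onI)
  define h where "h = (\<lambda>n. 1 / real (Suc n))"
  have h0: "h n > 0" "h n \<le> 1" for n by (auto simp: h_def)
  have hlim: "h \<longlonglongrightarrow> 0" unfolding h_def by (rule LIMSEQ_Suc[OF lim_1_over_n])
  have hat: "filterlim h (at 0) sequentially"
    using hlim h0 by (simp add: filterlim_at less_imp_neq[symmetric] eventually_sequentially)
  define Q where "Q n t = (1 / h n) *\<^sub>R (\<gamma> (t + h n) - \<gamma> t)" for n t
  have Qm[measurable]: "Q n \<in> borel_measurable borel" for n unfolding Q_def by measurable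
  have Qb: "norm (Q n t) \<le> L" for n t
  proof -
    have "norm (\<gamma> (t + h n) - \<gamma> t) \<le> L * h n"
      using lipschitz_onD[OF L, of "t + h n" t] h0[of n] by (simp add: dist_norm)
    then show ?thesis using h0[of n] by (simp add: Q_def divide_le_eq)
  qed
  define D0 where "D0 t = lim (\<lambda>n. Q n t)" for t
  have D0m[measurable]: "D0 \<in> borel_measurable borel" unfolding D0_def by measurable
  \<comment> \<open>\<open>D0\<close> is arbitrary where the quotients diverge; cutting it off makes
    the bound by \<open>L\<close> hold everywhere, not merely almost everywhere.\<close>
  define D where "D t = (if norm (D0 t) \<le> L then D0 t else 0)" for t
  have Dm[measurable]: "D \<in> borel_measurable borel" unfolding D_def by measurable
  have conv: "(\<lambda>n. Q n t) \<longlonglongrightarrow> v" if "(\<gamma> has_vector_derivative v) (at t)" for t v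
    unfolding tendsto_componentwise_iff[of "\<lambda>n. Q n t"]
  proof
    fix i :: 'a assume "i \<in> Basis"
    have "((\<lambda>x. \<gamma> x \<bullet> i) has_vector_derivative v \<bullet> i) (at t)"
      by (rule bounded_linear.has_vector_derivative[OF bounded_linear_inner_left that])
    then have "DERIV (\<lambda>x. \<gamma> x \<bullet> i) t :> v \<bullet> i" by (simp add: has_real_derivative_iff_has_vector_derivative)
    then have "((\<lambda>h. (\<gamma> (t + h) \<bullet> i - \<gamma> t \<bullet> i) / h) \<longlongrightarrow> v \<bullet> i) (at 0)" by (simp add: DERIV_def)
    from filterlim_compose[OF this hat]
    show "(\<lambda>n. Q n t \<bullet> i) \<longlonglongrightarrow> v \<bullet> i" by (simp add: Q_def inner_diff_left)
  qed
  have "AE t in lebesgue. \<forall>i\<in>Basis. (\<lambda>x. \<gamma> x \<bullet> i) differentiable (at t)"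
  proof (rule AE_finite_allI)
    fix i :: 'a assume i: "i \<in> Basis"
    have "L-lipschitz_on UNIV (\<lambda>x. \<gamma> x \<bullet> i)"
    proof (rule lipschitz_onI)
      fix x y
      have "dist (\<gamma> x \<bullet> i) (\<gamma> y \<bullet> i) \<le> norm (\<gamma> x - \<gamma> y)"
        using Basis_le_norm[OF i, of "\<gamma> x - \<gamma> y"] by (simp add: dist_real_def inner_diff_left)
      also have "\<dots> \<le> L * dist x y" using lipschitz_onD[OF L, of x y] by (simp add: dist_norm)
      finally show "dist (\<gamma> x \<bullet> i) (\<gamma> y \<bullet> i) \<le> L * dist x y" .
    qed (rule L0)
    then show "AE t in lebesgue. (\<lambda>x. \<gamma> x \<bullet> i) differentiable (at t)" by (rule lipschitz_AE_differentiable_real)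
  qed simp
  then have diff: "AE t in lebesgue. \<gamma> differentiable (at t)"
  proof eventually_elim
    fix t assume "\<forall>i\<in>Basis. (\<lambda>x. \<gamma> x \<bullet> i) differentiable (at t)"
    then show "\<gamma> differentiable (at t)" by (rule iffD2[OF differentiable_componentwise_within])
  qed
  have DD: "(\<lambda>n. Q n t) \<longlonglongrightarrow> D t \<and> (\<gamma> has_vector_derivative D t) (at t)" if d: "\<gamma> differentiable (at t)" for t
  proof -
    obtain v where v: "(\<gamma> has_vector_derivative v) (at t)" using vector_derivative_works[THEN iffD1, OF d] ..
    have c: "(\<lambda>n. Q n t) \<longlonglongrightarrow> v" by (rule conv[OF v])
    then have "D0 t = v" unfolding D0_def by (rule limI)
    moreover have "norm v \<le> L" by (rule Lim_norm_ubound[OF _ c]) (use Qb in auto)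
    ultimately show ?thesis using v c by (simp add: D_def)
  qed
  have AEc: "AE t in lebesgue. (\<lambda>n. Q n t) \<longlonglongrightarrow> D t" using diff by (rule AE_mp) (intro AE_I2 impI, use DD in blast)
  \<comment> \<open>The set of convergence is Borel, so the statement descends from the completion
    to \<open>lborel\<close>.\<close>
  have "Measurable.pred lborel (\<lambda>t. (\<lambda>n. norm (Q n t - D t)) \<longlonglongrightarrow> 0)" by measurable
  then have "Measurable.pred lborel (\<lambda>t. (\<lambda>n. Q n t) \<longlonglongrightarrow> D t)"
    by (simp only: tendsto_norm_zero_iff LIM_zero_iff)
  then have AEc': "AE t in lborel. (\<lambda>n. Q n t) \<longlonglongrightarrow> D t"
    using AEc by (simp add: AE_completion_iff pred_def)
  show ?thesis
  proof (rule that[of D])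
    show "AE t in lebesgue. (\<gamma> has_vector_derivative D t) (at t)" using diff by (rule AE_mp) (intro AE_I2 impI, use DD in blast)
    show "norm (D t) \<le> L" for t using L0 by (simp add: D_def)
    fix s t :: real assume st: "s \<le> t"
    \<comment> \<open>The margins around the interval leave room for the steps
      \<open>h n \<le> 1\<close> and turn derivatives within the interval into two-sided
      ones.\<close>
    obtain \<Gamma> where \<Gamma>: "\<And>x. x \<in> {s-1..t+2} \<Longrightarrow> (\<Gamma> has_vector_derivative \<gamma> x) (at x within {s-1..t+2})"
      by (rule antiderivative_continuous[OF continuous_on_subset[OF cont subset_UNIV], of "s-1" "t+2"]) blast
    have \<Gamma>': "(\<Gamma> has_vector_derivative \<gamma> x) (at x)" if "x \<in> {s..t+1}" for x
      using \<Gamma>[of x] that at_within_interior[of x "{s-1..t+2}"] by (simp add: interior_atLeastAtMost_real)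
    have I: "(LINT x|lborel. indicator {s..t} x *\<^sub>R Q n x) = (1 / h n) *\<^sub>R (\<Gamma> (t + h n) - \<Gamma> t) - (1 / h n) *\<^sub>R (\<Gamma> (s + h n) - \<Gamma> s)" for n
    proof -
      have "(LINT x|lborel. indicator {s..t} x *\<^sub>R Q n x) = (1 / h n) *\<^sub>R (\<Gamma> (t + h n) - \<Gamma> t) - (1 / h n) *\<^sub>R (\<Gamma> (s + h n) - \<Gamma> s)"
      proof (rule integral_FTC_atLeastAtMost[OF st])
        fix x assume x: "s \<le> x" "x \<le> t"
        have "((\<lambda>x. \<Gamma> (x + h n)) has_vector_derivative 1 *\<^sub>R \<gamma> (x + h n)) (at x)"
          using vector_diff_chain_at[of "\<lambda>x. x + h n" 1 x \<Gamma> "\<gamma> (x + h n)"] \<Gamma>'[of "x + h n"] x h0[of n]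
            has_vector_derivative_add[OF has_vector_derivative_id[of "at x"] has_vector_derivative_const[of "h n" "at x"]]
          by (simp add: o_def)
        then have "((\<lambda>x. (1 / h n) *\<^sub>R (\<Gamma> (x + h n) - \<Gamma> x)) has_vector_derivative Q n x) (at x)"
          unfolding Q_def using \<Gamma>'[of x] x
          by (intro bounded_linear.has_vector_derivative[OF bounded_linear_scaleR_right] has_vector_derivative_diff) auto
        then show "((\<lambda>x. (1 / h n) *\<^sub>R (\<Gamma> (x + h n) - \<Gamma> x)) has_vector_derivative Q n x) (at x within {s..t})"
          by (rule has_vector_derivative_at_within)
      next
        show "continuous_on {s..t} (Q n)" unfolding Q_def
          by (intro continuous_intros continuous_on_compose2[OF cont] continuous_on_subset[OF cont]) auto
      qed
      then show ?thesis .
    qed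
    have G: "(\<lambda>n. (1 / h n) *\<^sub>R (\<Gamma> (x + h n) - \<Gamma> x)) \<longlonglongrightarrow> \<gamma> x" if x: "x \<in> {s..t}" for x
      unfolding tendsto_componentwise_iff[of "\<lambda>n. (1 / h n) *\<^sub>R (\<Gamma> (x + h n) - \<Gamma> x)"]
    proof
      fix i :: 'a assume "i \<in> Basis"
      have "((\<lambda>x. \<Gamma> x \<bullet> i) has_vector_derivative \<gamma> x \<bullet> i) (at x)"
        by (rule bounded_linear.has_vector_derivative[OF bounded_linear_inner_left \<Gamma>']) (use x in auto)
      then have "DERIV (\<lambda>x. \<Gamma> x \<bullet> i) x :> \<gamma> x \<bullet> i" by (simp add: has_real_derivative_iff_has_vector_derivative)
      then have "((\<lambda>h. (\<Gamma> (x + h) \<bullet> i - \<Gamma> x \<bullet> i) / h) \<longlongrightarrow> \<gamma> x \<bullet> i) (at 0)" by (simp add: DERIV_def)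
      from filterlim_compose[OF this hat]
      show "(\<lambda>n. ((1 / h n) *\<^sub>R (\<Gamma> (x + h n) - \<Gamma> x)) \<bullet> i) \<longlonglongrightarrow> \<gamma> x \<bullet> i" by (simp add: inner_diff_left)
    qed
    have "(\<lambda>n. LINT x|lborel. indicator {s..t} x *\<^sub>R Q n x) \<longlonglongrightarrow> (LINT x|lborel. indicator {s..t} x *\<^sub>R D x)"
    proof (rule integral_dominated_convergence[where w="\<lambda>x. indicator {s..t} x *\<^sub>R L"])
      show "integrable lborel (\<lambda>x. indicator {s..t} x *\<^sub>R L)" by (intro integrable_scaleR_left integrable_real_indicator) (use st in auto)
      show "AE x in lborel. (\<lambda>n. indicator {s..t} x *\<^sub>R Q n x) \<longlonglongrightarrow> indicator {s..t} x *\<^sub>R D x"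
        using AEc' by (rule AE_mp) (intro AE_I2 impI tendsto_scaleR tendsto_const)
      show "AE x in lborel. norm (indicator {s..t} x *\<^sub>R Q n x) \<le> indicator {s..t} x *\<^sub>R L" for n
        using Qb L0 by (intro AE_I2) (simp add: indicator_def)
    qed measurable
    moreover have "(\<lambda>n. LINT x|lborel. indicator {s..t} x *\<^sub>R Q n x) \<longlonglongrightarrow> \<gamma> t - \<gamma> s"
      unfolding I by (intro tendsto_diff G) (use st in auto)
    ultimately show "(LINT x|lborel. indicator {s..t} x *\<^sub>R D x) = \<gamma> t - \<gamma> s" using LIMSEQ_unique by blast
  qed (rule Dm)
qed


section \<open>Polygons and geodesic distance\<close>

text \<open>A relation instead of a function because the bound \<open>M\<close> on each segment is
  free: any constant above \<open>sqrt (2 * W)\<close> there is a legitimate price per length. No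
  integral or parametrization occurs, which makes the cost easy to pass between curves of different
  regularity. Only the vertices are required to lie in \<open>A\<close>; for convex \<open>A\<close>
  the segments follow.\<close>

inductive polygonal_cost :: "('a::euclidean_space \<Rightarrow> real) \<Rightarrow> 'a set \<Rightarrow> 'a \<Rightarrow> 'a \<Rightarrow> real \<Rightarrow> bool"
  for W A x where
  start: "x \<in> A \<Longrightarrow> polygonal_cost W A x x 0"
| extend: "polygonal_cost W A x y c \<Longrightarrow> z \<in> A \<Longrightarrow> 0 \<le> M \<Longrightarrow>
    (\<And>w. w \<in> closed_segment y z \<Longrightarrow> sqrt (2 * W w) \<le> M) \<Longrightarrow> polygonal_cost W A x z (c + M * dist y z)"

lemma polygonal_cost_nonneg: "polygonal_cost W A x y c \<Longrightarrow> 0 \<le> c"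
  by (induction rule: polygonal_cost.induct) auto

lemma polygonal_cost_end: "polygonal_cost W A x y c \<Longrightarrow> y \<in> A"
  by (induction rule: polygonal_cost.induct) auto

lemma nn_integral_Icc_combine:
  fixes f :: "real \<Rightarrow> ennreal"
  assumes [measurable]: "f \<in> borel_measurable borel" and "p \<le> q" "q \<le> r"
  shows "(\<integral>\<^sup>+x\<in>{p..q}. f x \<partial>lborel) + (\<integral>\<^sup>+x\<in>{q..r}. f x \<partial>lborel) = (\<integral>\<^sup>+x\<in>{p..r}. f x \<partial>lborel)"
proof -
  have "(\<integral>\<^sup>+x\<in>{p..q}. f x \<partial>lborel) + (\<integral>\<^sup>+x\<in>{q..r}. f x \<partial>lborel) =
      (\<integral>\<^sup>+x. f x * indicator {p..q} x + f x * indicator {q..r} x \<partial>lborel)"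
    by (rule nn_integral_add[symmetric]) measurable
  also have "\<dots> = (\<integral>\<^sup>+x\<in>{p..r}. f x \<partial>lborel)"
  proof (rule nn_integral_cong_AE)
    show "AE x in lborel. f x * indicator {p..q} x + f x * indicator {q..r} x = f x * indicator {p..r} x"
      using AE_lborel_singleton[of q] by eventually_elim (use assms(2,3) in \<open>auto simp: indicator_def\<close>)
  qed
  finally show ?thesis .
qed

text \<open>Inscribed polygons on a fine partition: uniform continuity keeps the maximum of
  \<open>sqrt (2 * W)\<close> on each segment within \<epsilon> of its values along the
  corresponding arc. About the curve only a bound of its increments by \<open>g\<close> is needed,
  which fits Lipschitz curves as well as primitives of integrable functions; the given polygon up to
  \<open>v s\<close> allows concatenation.\<close>

lemma polygonal_cost_along_curve:
  fixes v :: "real \<Rightarrow> 'a::euclidean_space" and g :: "real \<Rightarrow> real"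
  assumes W: "continuous_on UNIV W" "\<And>z. 0 \<le> W z"
    and v: "continuous_on UNIV v" and st: "s \<le> t" and A: "\<And>r. r \<in> {s..t} \<Longrightarrow> v r \<in> A"
    and g[measurable]: "g \<in> borel_measurable borel" and g0: "\<And>r. 0 \<le> g r"
    and vg: "\<And>p q. s \<le> p \<Longrightarrow> p \<le> q \<Longrightarrow> q \<le> t \<Longrightarrow> ennreal (dist (v p) (v q)) \<le> (\<integral>\<^sup>+r\<in>{p..q}. ennreal (g r) \<partial>lborel)"
    and pc: "polygonal_cost W A x (v s) c0" and e: "\<epsilon> > 0"
  obtains c where "polygonal_cost W A x (v t) c"
    "ennreal c \<le> ennreal c0 + (\<integral>\<^sup>+r\<in>{s..t}. ennreal ((sqrt (2 * W (v r)) + \<epsilon>) * g r) \<partial>lborel)"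
proof -
  define om where "om z = sqrt (2 * W z)" for z
  have om_cont: "continuous_on UNIV om" unfolding om_def by (intro continuous_intros W)
  have om0: "0 \<le> om z" for z unfolding om_def using W by simp
  have [measurable]: "v \<in> borel_measurable borel" "om \<in> borel_measurable borel"
    using v om_cont by (auto intro: borel_measurable_continuous_onI)
  define f where "f r = ennreal ((om (v r) + \<epsilon>) * g r)" for r
  have fm[measurable]: "f \<in> borel_measurable borel" unfolding f_def by measurable
  have "compact (v ` {s..t})" by (intro compact_continuous_image continuous_on_subset[OF v]) auto
  then obtain R where R: "\<And>r. r \<in> {s..t} \<Longrightarrow> norm (v r) \<le> R"
    using compact_imp_bounded bounded_iff by (metis imageI)
  \<comment> \<open>Uniform continuity is needed on a full ball and not just on the curve, since the
    segments leave the curve.\<close>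
  have "uniformly_continuous_on (cball 0 R) om"
    by (intro compact_uniformly_continuous continuous_on_subset[OF om_cont]) auto
  then obtain d where d: "d > 0" "\<And>z z'. z \<in> cball 0 R \<Longrightarrow> z' \<in> cball 0 R \<Longrightarrow> dist z' z < d \<Longrightarrow> dist (om z') (om z) < \<epsilon>"
    using e unfolding uniformly_continuous_on_def by meson
  have "uniformly_continuous_on {s..t} v"
    by (intro compact_uniformly_continuous continuous_on_subset[OF v]) auto
  then obtain h where h: "h > 0" "\<And>p q. p \<in> {s..t} \<Longrightarrow> q \<in> {s..t} \<Longrightarrow> dist q p < h \<Longrightarrow> dist (v q) (v p) < d"
    using d(1) unfolding uniformly_continuous_on_def by meson
  obtain N :: nat where N: "(t - s) / h < real N" using reals_Archimedean2 by blast
  have N0: "N > 0"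
  proof (rule ccontr)
    assume "\<not> N > 0"
    then have "(t - s) / h < 0" using N by simp
    then show False using st h(1) by (simp add: divide_less_0_iff)
  qed
  define T where "T i = s + real i * ((t - s) / real N)" for i
  define k where "k = (t - s) / real N"
  have k: "0 \<le> k" "k < h" using N N0 h(1) st by (auto simp: k_def field_simps)
  have Tk: "T (Suc i) = T i + k" for i using N0 by (simp add: T_def k_def field_simps)
  have Tle: "T i \<le> t" if "i \<le> N" for i
  proof -
    have "real i * (t - s) \<le> real N * (t - s)" using that st by (intro mult_right_mono) auto
    then show ?thesis using N0 by (simp add: T_def field_simps)
  qed
  have Tge: "s \<le> T i" for i using st N0 by (simp add: T_def)
  have "\<exists>c. polygonal_cost W A x (v (T i)) c \<and> ennreal c \<le> ennreal c0 + (\<integral>\<^sup>+r\<in>{s..T i}. f r \<partial>lborel)" if "i \<le> N" for i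
    using that
  proof (induction i)
    case 0
    then show ?case using pc by (intro exI[of _ c0]) (auto simp: T_def)
  next
    case (Suc i)
    then obtain c where c: "polygonal_cost W A x (v (T i)) c" "ennreal c \<le> ennreal c0 + (\<integral>\<^sup>+r\<in>{s..T i}. f r \<partial>lborel)" by auto
    let ?p = "T i" and ?q = "T (Suc i)"
    have pq: "s \<le> ?p" "?p \<le> ?q" "?q \<le> t" "?q - ?p < h" using Tge Tle[OF Suc.prems] Tk[of i] k by auto
    have "\<exists>w\<in>closed_segment (v ?p) (v ?q). \<forall>z\<in>closed_segment (v ?p) (v ?q). om z \<le> om w"
      by (rule continuous_attains_sup) (auto intro: continuous_on_subset[OF om_cont])
    then obtain w where w: "w \<in> closed_segment (v ?p) (v ?q)" "\<And>z. z \<in> closed_segment (v ?p) (v ?q) \<Longrightarrow> om z \<le> om w" by blast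
    \<comment> \<open>Both vertices lie in the convex ball of radius \<open>d\<close> around
      \<open>v r\<close>, hence so does the maximum point \<open>w\<close> of the segment.\<close>
    have wle: "om w \<le> om (v r) + \<epsilon>" if r: "r \<in> {?p..?q}" for r
    proof -
      have r': "r \<in> {s..t}" using r pq by auto
      have "v ?p \<in> ball (v r) d" "v ?q \<in> ball (v r) d"
        using h(2)[of ?p r] h(2)[of ?q r] r pq by (auto simp: dist_real_def)
      then have "closed_segment (v ?p) (v ?q) \<subseteq> ball (v r) d" by (intro closed_segment_subset convex_ball)
      moreover have "closed_segment (v ?p) (v ?q) \<subseteq> cball 0 R"
        using R[of ?p] R[of ?q] pq by (intro closed_segment_subset convex_cball) auto
      ultimately have "dist (om w) (om (v r)) < \<epsilon>"
        using w(1) R[OF r'] by (intro d(2)) (auto simp: dist_commute)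
      then show ?thesis by (auto simp: dist_real_def)
    qed
    have "polygonal_cost W A x (v ?q) (c + om w * dist (v ?p) (v ?q))"
      using w(2) by (intro polygonal_cost.extend[OF c(1)] A om0) (use pq in \<open>auto simp: om_def\<close>)
    moreover have "ennreal (c + om w * dist (v ?p) (v ?q)) \<le> ennreal c0 + (\<integral>\<^sup>+r\<in>{s..?q}. f r \<partial>lborel)"
    proof -
      have "ennreal (om w * dist (v ?p) (v ?q)) = ennreal (om w) * ennreal (dist (v ?p) (v ?q))"
        by (rule ennreal_mult) (use om0 in auto)
      also have "\<dots> \<le> ennreal (om w) * (\<integral>\<^sup>+r\<in>{?p..?q}. ennreal (g r) \<partial>lborel)"
        by (intro mult_left_mono vg pq) auto
      also have "\<dots> = (\<integral>\<^sup>+r. ennreal (om w) * (ennreal (g r) * indicator {?p..?q} r) \<partial>lborel)"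
        by (rule nn_integral_cmult[symmetric]) measurable
      also have "\<dots> \<le> (\<integral>\<^sup>+r\<in>{?p..?q}. f r \<partial>lborel)"
      proof (rule nn_integral_mono)
        fix r
        show "ennreal (om w) * (ennreal (g r) * indicator {?p..?q} r) \<le> f r * indicator {?p..?q} r"
        proof (cases "r \<in> {?p..?q}")
          case True
          have "om w * g r \<le> (om (v r) + \<epsilon>) * g r" using wle[OF True] g0 by (rule mult_right_mono)
          then show ?thesis using True om0 g0 by (simp add: f_def ennreal_mult[symmetric] ennreal_leI)
        qed auto
      qed
      finally have 1: "ennreal (om w * dist (v ?p) (v ?q)) \<le> (\<integral>\<^sup>+r\<in>{?p..?q}. f r \<partial>lborel)" .
      have "ennreal (c + om w * dist (v ?p) (v ?q)) = ennreal c + ennreal (om w * dist (v ?p) (v ?q))"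
        by (rule ennreal_plus) (use polygonal_cost_nonneg[OF c(1)] om0 in auto)
      also have "\<dots> \<le> (ennreal c0 + (\<integral>\<^sup>+r\<in>{s..?p}. f r \<partial>lborel)) + (\<integral>\<^sup>+r\<in>{?p..?q}. f r \<partial>lborel)"
        by (intro add_mono c(2) 1)
      also have "\<dots> = ennreal c0 + (\<integral>\<^sup>+r\<in>{s..?q}. f r \<partial>lborel)"
        using nn_integral_Icc_combine[OF fm pq(1,2)] by (simp add: add.assoc)
      finally show ?thesis .
    qed
    ultimately show ?case by blast
  qed
  from this[of N] have "\<exists>c. polygonal_cost W A x (v t) c \<and> ennreal c \<le> ennreal c0 + (\<integral>\<^sup>+r\<in>{s..t}. f r \<partial>lborel)"
    using N0 by (simp add: T_def)
  then show ?thesis using that unfolding f_def om_def by blast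
qed

text \<open>A segment of length \<open>\<ell>\<close> on which \<open>sqrt (2 W) \<le> M\<close> is traversed with speed slightly above \<open>M\<close>:
  then \<open>1/2 |\<gamma>'|\<^sup>2\<close> and \<open>W\<close> both contribute about \<open>\<ell> M / 2\<close>.\<close>

lemma polygonal_curve:
  fixes W :: "'a::euclidean_space \<Rightarrow> real"
  assumes "polygonal_cost W A x y c" and "convex A" and W: "continuous_on UNIV W" "\<And>z. 0 \<le> W z" and "\<epsilon> > 0"
  shows "\<exists>b \<gamma> D F L. 0 \<le> b \<and> finite F \<and> L-lipschitz_on UNIV \<gamma> \<and> (\<forall>t\<le>0. \<gamma> t = x) \<and> (\<forall>t\<ge>b. \<gamma> t = y) \<and>
    D \<in> borel_measurable borel \<and> (\<forall>t. t \<notin> F \<longrightarrow> (\<gamma> has_vector_derivative D t) (at t)) \<and>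
    (\<forall>t. t \<notin> {0..b} \<longrightarrow> D t = 0) \<and> (\<forall>t. norm (D t) \<le> L) \<and> (\<forall>t. \<gamma> t \<in> A) \<and>
    (\<integral>\<^sup>+t\<in>{0..b}. ennreal ((norm (D t))\<^sup>2 / 2 + W (\<gamma> t)) \<partial>lborel) \<le> ennreal (c + \<epsilon>)"
  using assms(1,5)
proof (induction arbitrary: \<epsilon> rule: polygonal_cost.induct)
  case start
  have "(\<integral>\<^sup>+t\<in>{0..0::real}. ennreal ((norm (0::'a))\<^sup>2 / 2 + W x) \<partial>lborel) = 0"
    by (simp add: nn_integral_cmult)
  then show ?case using start
    by (intro exI[of _ 0] exI[of _ "\<lambda>_. x"] exI[of _ "\<lambda>_. 0"] exI[of _ "{}"]) (auto intro: lipschitz_on_constant)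
next
  case (extend y c z M)
  show ?case
  \<comment> \<open>A degenerate segment is skipped: it adds no cost, and the speed chosen below
    divides by its length.\<close>
  proof (cases "y = z")
    case True
    with extend.IH[OF extend.prems] show ?thesis by simp
  next
    case False
    define l where "l = dist y z"
    have l: "l > 0" using False by (simp add: l_def)
    from extend.IH[of "\<epsilon> / 2"] extend.prems obtain b \<gamma> D F L where
      b: "0 \<le> b" and F: "finite F" and Lip: "L-lipschitz_on UNIV \<gamma>" and x: "\<And>t. t \<le> 0 \<Longrightarrow> \<gamma> t = x" and y: "\<And>t. t \<ge> b \<Longrightarrow> \<gamma> t = y"
      and Dm[measurable]: "D \<in> borel_measurable borel" and D: "\<And>t. t \<notin> F \<Longrightarrow> (\<gamma> has_vector_derivative D t) (at t)"
      and D0: "\<And>t. t \<notin> {0..b} \<Longrightarrow> D t = 0" and DL: "\<And>t. norm (D t) \<le> L" and \<gamma>A: "\<And>t. \<gamma> t \<in> A"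
      and E: "(\<integral>\<^sup>+t\<in>{0..b}. ennreal ((norm (D t))\<^sup>2 / 2 + W (\<gamma> t)) \<partial>lborel) \<le> ennreal (c + \<epsilon> / 2)"
      by auto
    \<comment> \<open>The excess \<open>\<epsilon> / (2 * l)\<close> makes the speed positive even
      if \<open>M = 0\<close> and costs exactly \<open>\<epsilon> / 2\<close> over the length
      \<open>l\<close>.\<close>
    define M' where "M' = M + \<epsilon> / (2 * l)"
    have M': "M' > 0" "M \<le> M'" using extend.hyps(3) extend.prems l by (auto simp: M'_def intro: add_nonneg_pos)
    define \<tau> where "\<tau> = l / M'"
    have \<tau>: "\<tau> > 0" using l M' by (simp add: \<tau>_def)
    \<comment> \<open>The ramp \<open>cl\<close> rises from 0 to 1 during the time \<tau> in which
      the segment is run through and is constant before and after. Since the old curve rests at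
      \<open>y\<close> from time \<open>b\<close> on, adding a multiple of \<open>z - y\<close>
      prolongs it.\<close>
    define cl where "cl t = max 0 (min 1 ((t - b) / \<tau>))" for t :: real
    define \<gamma>2 where "\<gamma>2 t = \<gamma> t + cl t *\<^sub>R (z - y)" for t
    define D2 where "D2 t = D t + (if b < t \<and> t < b + \<tau> then (1 / \<tau>) *\<^sub>R (z - y) else 0)" for t
    have [measurable]: "D2 \<in> borel_measurable borel" unfolding D2_def by measurable
    have cl0: "cl t = 0" if "t \<le> b" for t using that \<tau> divide_nonpos_pos[of "t - b" \<tau>] by (simp add: cl_def)
    have cl1: "cl t = 1" if "t \<ge> b + \<tau>" for t using that \<tau> by (auto simp: cl_def max_def min_def field_simps)
    have clm: "cl t = (t - b) / \<tau>" if "b < t" "t < b + \<tau>" for t using that \<tau> by (auto simp: cl_def max_def min_def field_simps)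
    have cl01: "0 \<le> cl t" "cl t \<le> 1" for t by (auto simp: cl_def)
    have clL: "(1 / \<tau>)-lipschitz_on UNIV cl"
    proof (rule lipschitz_onI)
      fix s t
      have "dist (cl s) (cl t) \<le> \<bar>(s - b) / \<tau> - (t - b) / \<tau>\<bar>" unfolding cl_def dist_real_def by linarith
      also have "\<dots> = 1 / \<tau> * dist s t" using \<tau> by (simp add: dist_real_def diff_divide_distrib[symmetric] abs_divide)
      finally show "dist (cl s) (cl t) \<le> 1 / \<tau> * dist s t" .
    qed (use \<tau> in auto)
    have L2: "(norm (z - y) / \<tau>)-lipschitz_on UNIV (\<lambda>t. cl t *\<^sub>R (z - y))"
    proof (rule lipschitz_onI)
      fix s t
      have "dist (cl s *\<^sub>R (z - y)) (cl t *\<^sub>R (z - y)) = dist (cl s) (cl t) * norm (z - y)"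
        by (simp add: dist_norm scaleR_diff_left[symmetric] del: scaleR_diff_left)
      also have "\<dots> \<le> (1 / \<tau> * dist s t) * norm (z - y)"
        by (intro mult_right_mono lipschitz_onD[OF clL]) auto
      finally show "dist (cl s *\<^sub>R (z - y)) (cl t *\<^sub>R (z - y)) \<le> norm (z - y) / \<tau> * dist s t" by (simp add: mult_ac)
    qed (use \<tau> in auto)
    have Lip2: "(L + norm (z - y) / \<tau>)-lipschitz_on UNIV \<gamma>2" unfolding \<gamma>2_def
      by (rule lipschitz_on_add[OF Lip L2])
    then have "continuous_on UNIV \<gamma>2" by (rule lipschitz_on_continuous_on)
    then have [measurable]: "\<gamma>2 \<in> borel_measurable borel" by (rule borel_measurable_continuous_onI)
    have [measurable]: "W \<in> borel_measurable borel" using W(1) by (rule borel_measurable_continuous_onI)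
    have der: "(\<gamma>2 has_vector_derivative D2 t) (at t)" if t: "t \<notin> insert b (insert (b + \<tau>) F)" for t
    proof -
      have clD: "((\<lambda>t. cl t *\<^sub>R (z - y)) has_vector_derivative (if b < t \<and> t < b + \<tau> then (1 / \<tau>) *\<^sub>R (z - y) else 0)) (at t)"
      proof -
        consider "t < b" | "b < t" "t < b + \<tau>" | "b + \<tau> < t" using t by fastforce
        then show ?thesis
        proof cases
          case 1
          have "((\<lambda>t. cl t *\<^sub>R (z - y)) has_vector_derivative 0) (at t)"
            by (rule has_vector_derivative_transform_within_open[of "\<lambda>_. 0" _ _ "{..<b}"]) (use 1 cl0 in auto)
          then show ?thesis using 1 by simp
        next
          case 2
          have "((\<lambda>t. ((t - b) / \<tau>) *\<^sub>R (z - y)) has_vector_derivative (1 / \<tau>) *\<^sub>R (z - y)) (at t)"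
          proof -
            have "((\<lambda>t. (t - b) / \<tau>) has_real_derivative 1 / \<tau>) (at t)" using \<tau> by (auto intro!: derivative_eq_intros)
            from has_vector_derivative_scaleR[OF this has_vector_derivative_const[of "z - y"]]
            show ?thesis by simp
          qed
          then have "((\<lambda>t. cl t *\<^sub>R (z - y)) has_vector_derivative (1 / \<tau>) *\<^sub>R (z - y)) (at t)"
            by (rule has_vector_derivative_transform_within_open[where S="{b<..<b+\<tau>}"]) (use 2 clm in auto)
          then show ?thesis using 2 by simp
        next
          case 3
          have "((\<lambda>t. cl t *\<^sub>R (z - y)) has_vector_derivative 0) (at t)"
            by (rule has_vector_derivative_transform_within_open[of "\<lambda>_. z - y" _ _ "{b+\<tau><..}"]) (use 3 cl1 in auto)
          then show ?thesis using 3 by simp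
        qed
      qed
      show ?thesis unfolding \<gamma>2_def D2_def by (rule has_vector_derivative_add[OF D clD]) (use t in auto)
    qed
    have seg: "y + cl t *\<^sub>R (z - y) \<in> closed_segment y z" for t
      using cl01[of t] by (auto simp: closed_segment_def algebra_simps intro!: exI[of _ "cl t"])
    have yA: "y \<in> A" using polygonal_cost_end[OF extend.hyps(1)] .
    have \<gamma>2A: "\<gamma>2 t \<in> A" for t
    proof (cases "t \<le> b")
      case True then show ?thesis using \<gamma>A cl0 by (simp add: \<gamma>2_def)
    next
      case False
      then have "\<gamma>2 t \<in> closed_segment y z" using seg y by (simp add: \<gamma>2_def)
      then show ?thesis using closed_segment_subset[OF yA extend.hyps(2) assms(2)] by blast
    qed
    have speed: "norm ((1 / \<tau>) *\<^sub>R (z - y)) = M'" 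
      using \<tau> l M' by (simp add: \<tau>_def l_def dist_norm norm_minus_commute)
    define f where "f t = ennreal ((norm (D2 t))\<^sup>2 / 2 + W (\<gamma>2 t))" for t
    have fm: "f \<in> borel_measurable borel" unfolding f_def by measurable
    have E1: "(\<integral>\<^sup>+t\<in>{0..b}. f t \<partial>lborel) \<le> ennreal (c + \<epsilon> / 2)"
    proof -
      have "(\<integral>\<^sup>+t\<in>{0..b}. f t \<partial>lborel) = (\<integral>\<^sup>+t\<in>{0..b}. ennreal ((norm (D t))\<^sup>2 / 2 + W (\<gamma> t)) \<partial>lborel)"
        by (rule nn_integral_cong) (auto simp: f_def D2_def \<gamma>2_def cl0 indicator_def)
      then show ?thesis using E by simp
    qed
    have E2: "(\<integral>\<^sup>+t\<in>{b..b+\<tau>}. f t \<partial>lborel) \<le> ennreal (M * l + \<epsilon> / 2)"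
    proof -
      have "(\<integral>\<^sup>+t\<in>{b..b+\<tau>}. f t \<partial>lborel) \<le> (\<integral>\<^sup>+t. ennreal (M'\<^sup>2) * indicator {b..b+\<tau>} t \<partial>lborel)"
      proof (rule nn_integral_mono_AE)
        show "AE t in lborel. f t * indicator {b..b+\<tau>} t \<le> ennreal (M'\<^sup>2) * indicator {b..b+\<tau>} t"
          using AE_lborel_singleton[of b] AE_lborel_singleton[of "b+\<tau>"]
        proof eventually_elim
          fix t assume t: "t \<noteq> b" "t \<noteq> b + \<tau>"
          show "f t * indicator {b..b+\<tau>} t \<le> ennreal (M'\<^sup>2) * indicator {b..b+\<tau>} t"
          proof (cases "t \<in> {b..b+\<tau>}")
            case True
            then have t': "b < t" "t < b + \<tau>" using t by auto
            have nD: "norm (D2 t) = M'" using t' D0[of t] speed by (simp add: D2_def)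
            have "\<gamma>2 t \<in> closed_segment y z" using seg y t' by (simp add: \<gamma>2_def)
            then have "sqrt (2 * W (\<gamma>2 t)) \<le> M'" using extend.hyps(4) M' by fastforce
            then have "2 * W (\<gamma>2 t) \<le> M'\<^sup>2" using sqrt_le_D by blast
            then have "f t \<le> ennreal (M'\<^sup>2)" unfolding f_def nD by (intro ennreal_leI) simp
            then show ?thesis using True by simp
          qed simp
        qed
      qed
      also have "\<dots> = ennreal (M'\<^sup>2) * ennreal \<tau>" using \<tau> by (subst nn_integral_cmult_indicator) auto
      also have "\<dots> = ennreal (M'\<^sup>2 * \<tau>)" using \<tau> by (simp add: ennreal_mult)
      also have "M'\<^sup>2 * \<tau> = M * l + \<epsilon> / 2"
      proof -
        have "M'\<^sup>2 * \<tau> = M' * l" using M' by (simp add: \<tau>_def power2_eq_square)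
        also have "\<dots> = M * l + \<epsilon> / 2" using l by (simp add: M'_def field_simps)
        finally show ?thesis .
      qed
      finally show ?thesis .
    qed
    have "(\<integral>\<^sup>+t\<in>{0..b+\<tau>}. f t \<partial>lborel) \<le> ennreal (c + \<epsilon> / 2) + ennreal (M * l + \<epsilon> / 2)"
      using nn_integral_Icc_combine[OF fm b, of "b + \<tau>"] \<tau> add_mono[OF E1 E2] by simp
    also have "\<dots> = ennreal (c + M * dist y z + \<epsilon>)"
      using polygonal_cost_nonneg[OF extend.hyps(1)] extend.hyps(3) extend.prems l
      by (subst ennreal_plus[symmetric]) (auto simp: l_def algebra_simps)
    finally have E3: "(\<integral>\<^sup>+t\<in>{0..b+\<tau>}. f t \<partial>lborel) \<le> ennreal (c + M * dist y z + \<epsilon>)" .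
    show ?thesis
    proof (rule exI[of _ "b + \<tau>"], rule exI[of _ \<gamma>2], rule exI[of _ D2], rule exI[of _ "insert b (insert (b + \<tau>) F)"],
        rule exI[of _ "L + norm (z - y) / \<tau>"], intro conjI allI impI)
      show "\<gamma>2 t = x" if "t \<le> 0" for t using that b x cl0 by (simp add: \<gamma>2_def)
      show "\<gamma>2 t = z" if "b + \<tau> \<le> t" for t using that \<tau> y cl1 by (simp add: \<gamma>2_def)
      show "D2 t = 0" if "t \<notin> {0..b + \<tau>}" for t using that \<tau> D0[of t] b by (auto simp: D2_def)
      show "norm (D2 t) \<le> L + norm (z - y) / \<tau>" for t
      proof -
        have "norm (D2 t) \<le> norm (D t) + norm (if b < t \<and> t < b + \<tau> then (1 / \<tau>) *\<^sub>R (z - y) else 0)"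
          unfolding D2_def by (rule norm_triangle_ineq)
        also have "\<dots> \<le> L + norm (z - y) / \<tau>" using DL[of t] \<tau> by (intro add_mono) auto
        finally show ?thesis .
      qed
      show "(\<integral>\<^sup>+t\<in>{0..b+\<tau>}. ennreal ((norm (D2 t))\<^sup>2 / 2 + W (\<gamma>2 t)) \<partial>lborel) \<le> ennreal (c + M * dist y z + \<epsilon>)"
        using E3 by (simp add: f_def)
    qed (use b \<tau> F Lip2 der \<gamma>2A in auto)
  qed
qed

text \<open>Young's inequality, the step of Modica and Mortola from energy to weighted
  length.\<close>

lemma sqrt_mult_le_energy: "0 \<le> w \<Longrightarrow> sqrt (2 * w) * n \<le> n\<^sup>2 / 2 + w" for w n :: real
proof -
  assume w: "0 \<le> w"
  have "0 \<le> (sqrt (2 * w) - n)\<^sup>2" by simp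
  also have "\<dots> = 2 * w - 2 * (sqrt (2 * w) * n) + n\<^sup>2" using w by (simp add: power2_diff)
  finally show ?thesis by simp
qed

text \<open>The curve that realizes the cost as an energy also has at most this weighted length, by
  Young's inequality; an affine change of parameter brings it to the interval of
  \<open>geodW\<close>.\<close>

lemma geodW_le_polygonal_cost:
  fixes W :: "real^'n::finite \<Rightarrow> real"
  assumes pc: "polygonal_cost W UNIV x y c" and W: "continuous_on UNIV W" "\<And>z. 0 \<le> W z"
  shows "geodW W x y \<le> ennreal c"
proof (rule ennreal_le_epsilon)
  fix \<epsilon> :: real assume e: "\<epsilon> > 0"
  obtain b \<gamma> D F L where
      b: "0 \<le> b" and F: "finite F" and Lip: "L-lipschitz_on UNIV \<gamma>" and x: "\<And>t. t \<le> 0 \<Longrightarrow> \<gamma> t = x" and y: "\<And>t. t \<ge> b \<Longrightarrow> \<gamma> t = y"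
      and Dm[measurable]: "D \<in> borel_measurable borel" and D: "\<And>t. t \<notin> F \<Longrightarrow> (\<gamma> has_vector_derivative D t) (at t)"
      and D0: "\<And>t. t \<notin> {0..b} \<Longrightarrow> D t = 0"
      and E: "(\<integral>\<^sup>+t\<in>{0..b}. ennreal ((norm (D t))\<^sup>2 / 2 + W (\<gamma> t)) \<partial>lborel) \<le> ennreal (c + \<epsilon>)"
    using polygonal_curve[OF pc convex_UNIV W e] by auto
  have c0: "c \<ge> 0" by (rule polygonal_cost_nonneg[OF pc])
  have [measurable]: "\<gamma> \<in> borel_measurable borel" by (rule borel_measurable_continuous_onI[OF lipschitz_on_continuous_on[OF Lip]])
  have [measurable]: "W \<in> borel_measurable borel" using W(1) by (rule borel_measurable_continuous_onI)
  \<comment> \<open>Length \<open>b + 1\<close> instead of \<open>b\<close> keeps the change of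
    parameter invertible when \<open>b = 0\<close>; the curve rests on the added unit
    interval.\<close>
  define \<beta> where "\<beta> = (b + 1) / 2"
  have \<beta>: "\<beta> > 0" using b by (simp add: \<beta>_def)
  define \<gamma>' where "\<gamma>' t = \<gamma> (\<beta> + \<beta> * t)" for t
  have lip': "(L * \<beta>)-lipschitz_on {-1..1} \<gamma>'"
  proof (rule lipschitz_onI)
    fix s t :: real
    have "dist (\<gamma>' s) (\<gamma>' t) \<le> L * dist (\<beta> + \<beta> * s) (\<beta> + \<beta> * t)" unfolding \<gamma>'_def by (rule lipschitz_onD[OF Lip]) auto
    also have "dist (\<beta> + \<beta> * s) (\<beta> + \<beta> * t) = \<beta> * dist s t"
      using \<beta> by (simp add: dist_real_def right_diff_distrib[symmetric] abs_mult)
    finally show "dist (\<gamma>' s) (\<gamma>' t) \<le> L * \<beta> * dist s t" by (simp add: mult.assoc)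
  qed (use \<beta> lipschitz_on_nonneg[OF Lip] in auto)
  have der: "vector_derivative \<gamma>' (at t) = \<beta> *\<^sub>R D (\<beta> + \<beta> * t)" if "\<beta> + \<beta> * t \<notin> F" for t
  proof (rule vector_derivative_at)
    have "((\<lambda>t. \<beta> + \<beta> * t) has_vector_derivative \<beta>) (at t)"
      unfolding has_real_derivative_iff_has_vector_derivative[symmetric] by (auto intro!: derivative_eq_intros)
    from vector_diff_chain_at[OF this D[OF that]]
    show "(\<gamma>' has_vector_derivative \<beta> *\<^sub>R D (\<beta> + \<beta> * t)) (at t)" by (simp add: o_def \<gamma>'_def[abs_def])
  qed
  define f where "f s = ennreal (sqrt (2 * W (\<gamma> s)) * norm (D s)) * indicator {0..b+1} s" for s
  have fm: "f \<in> borel_measurable borel" unfolding f_def by measurable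
  have fin: "finite ((\<lambda>s. (s - \<beta>) / \<beta>) ` F)" using F by simp
  have "wlength W \<gamma>' = (\<integral>\<^sup>+t. ennreal \<beta> * f (\<beta> + \<beta> * t) \<partial>lborel)"
    unfolding wlength_def
  proof (rule nn_integral_cong_AE)
    have "AE t in lborel. t \<notin> (\<lambda>s. (s - \<beta>) / \<beta>) ` F"
      using finite_imp_null_set_lborel[OF fin] by (rule AE_not_in)
    then show "AE t in lborel. ennreal (sqrt (2 * W (\<gamma>' t)) * norm (vector_derivative \<gamma>' (at t))) * indicator {-1..1} t = ennreal \<beta> * f (\<beta> + \<beta> * t)"
    proof eventually_elim
      fix t assume t: "t \<notin> (\<lambda>s. (s - \<beta>) / \<beta>) ` F"
      have nF: "\<beta> + \<beta> * t \<notin> F"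
      proof
        assume "\<beta> + \<beta> * t \<in> F"
        then have "((\<beta> + \<beta> * t) - \<beta>) / \<beta> \<in> (\<lambda>s. (s - \<beta>) / \<beta>) ` F" by (rule imageI)
        then show False using t \<beta> by simp
      qed
      have "\<beta> + \<beta> * t = \<beta> * (1 + t)" "b + 1 = \<beta> * 2" by (auto simp: \<beta>_def field_simps)
      then have ind: "(\<beta> + \<beta> * t \<in> {0..b+1}) = (t \<in> {-1..1})" using \<beta> by (auto simp: zero_le_mult_iff)
      then have "indicator {0..b+1} (\<beta> + \<beta> * t) = (indicator {-1..1} t :: ennreal)" by (simp only: indicator_def)
      moreover have "ennreal (sqrt (2 * W (\<gamma>' t)) * norm (vector_derivative \<gamma>' (at t))) =
        ennreal \<beta> * ennreal (sqrt (2 * W (\<gamma> (\<beta> + \<beta> * t))) * norm (D (\<beta> + \<beta> * t)))"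
        unfolding der[OF nF] using \<beta> W(2) by (simp add: \<gamma>'_def ennreal_mult[symmetric] mult_ac)
      ultimately show "ennreal (sqrt (2 * W (\<gamma>' t)) * norm (vector_derivative \<gamma>' (at t))) * indicator {-1..1} t = ennreal \<beta> * f (\<beta> + \<beta> * t)"
        unfolding f_def by (simp add: mult.assoc)
    qed
  qed
  also have "\<dots> = ennreal \<beta> * (\<integral>\<^sup>+t. f (\<beta> + \<beta> * t) \<partial>lborel)"
    by (rule nn_integral_cmult) (use fm in measurable)
  also have "\<dots> = (\<integral>\<^sup>+s. f s \<partial>lborel)"
    using nn_integral_real_affine[OF fm, of \<beta> \<beta>] \<beta> by simp
  also have "\<dots> \<le> (\<integral>\<^sup>+t\<in>{0..b}. ennreal ((norm (D t))\<^sup>2 / 2 + W (\<gamma> t)) \<partial>lborel)"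
  proof (rule nn_integral_mono)
    fix t
    show "f t \<le> ennreal ((norm (D t))\<^sup>2 / 2 + W (\<gamma> t)) * indicator {0..b} t"
    proof (cases "t \<in> {0..b}")
      case True
      then show ?thesis using sqrt_mult_le_energy[OF W(2)[of "\<gamma> t"], of "norm (D t)"] by (simp add: f_def ennreal_leI)
    next
      case False
      then show ?thesis using D0[OF False] by (simp add: f_def)
    qed
  qed
  also have "\<dots> \<le> ennreal (c + \<epsilon>)" by (rule E)
  also have "\<dots> = ennreal c + ennreal \<epsilon>" using c0 e by (intro ennreal_plus) auto
  finally have wl: "wlength W \<gamma>' \<le> ennreal c + ennreal \<epsilon>" .
  have "geodW W x y \<le> wlength W \<gamma>'" unfolding geodW_def
  proof (rule INF_lower)
    have "\<gamma>' (-1) = x" "\<gamma>' 1 = y" using x y b by (auto simp: \<gamma>'_def \<beta>_def field_simps)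
    then show "\<gamma>' \<in> {\<gamma>. (\<exists>L. L-lipschitz_on {-1..1} \<gamma>) \<and> \<gamma> (-1) = x \<and> \<gamma> 1 = y}" using lip' by auto
  qed
  then show "geodW W x y \<le> ennreal c + ennreal \<epsilon>" using wl by (rule order_trans)
qed

text \<open>A Lipschitz curve is the integral of its derivative, so inscribed polygons cost at most
  the weighted length up to an error proportional to the Lipschitz constant. Their vertices lie on
  the curve and therefore in \<open>A\<close>.\<close>

lemma polygonal_cost_le_wlength:
  fixes W :: "real^'n::finite \<Rightarrow> real"
  assumes W: "continuous_on UNIV W" "\<And>z. 0 \<le> W z"
    and lip: "L-lipschitz_on {-1..1} \<gamma>" and A: "\<And>t. t \<in> {-1..1} \<Longrightarrow> \<gamma> t \<in> A" and e: "\<epsilon> > 0"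
  obtains c where "polygonal_cost W A (\<gamma> (-1)) (\<gamma> 1) c" "ennreal c \<le> wlength W \<gamma> + ennreal \<epsilon>"
proof -
  \<comment> \<open>Freezing the curve outside the interval makes it Lipschitz on the whole line
    without affecting the derivative inside.\<close>
  define cl where "cl t = max (-1) (min 1 t)" for t :: real
  define v where "v t = \<gamma> (cl t)" for t
  have L0: "L \<ge> 0" by (rule lipschitz_on_nonneg[OF lip])
  have vL: "L-lipschitz_on UNIV v"
  proof (rule lipschitz_onI)
    fix s t :: real
    have "dist (v s) (v t) \<le> L * dist (cl s) (cl t)" unfolding v_def by (rule lipschitz_onD[OF lip]) (auto simp: cl_def)
    also have "\<dots> \<le> L * dist s t" by (rule mult_left_mono) (use L0 in \<open>auto simp: cl_def dist_real_def\<close>)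
    finally show "dist (v s) (v t) \<le> L * dist s t" .
  qed (rule L0)
  have vg: "v t = \<gamma> t" if "t \<in> {-1..1}" for t using that by (simp add: v_def cl_def)
  have vcont: "continuous_on UNIV v" by (rule lipschitz_on_continuous_on[OF vL])
  have [measurable]: "v \<in> borel_measurable borel" by (rule borel_measurable_continuous_onI[OF vcont])
  have [measurable]: "W \<in> borel_measurable borel" using W(1) by (rule borel_measurable_continuous_onI)
  obtain D where Dm[measurable]: "D \<in> borel_measurable borel" and DL: "\<And>t. norm (D t) \<le> L"
    and Dd: "AE t in lebesgue. (v has_vector_derivative D t) (at t)"
    and DI: "\<And>s t. s \<le> t \<Longrightarrow> (LINT x|lborel. indicator {s..t} x *\<^sub>R D x) = v t - v s"
    using lipschitz_fundamental_theorem[OF vL] by blast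
  have dist_le: "ennreal (dist (v p) (v q)) \<le> (\<integral>\<^sup>+r\<in>{p..q}. ennreal (norm (D r)) \<partial>lborel)" if "p \<le> q" for p q
  proof -
    have int: "integrable lborel (\<lambda>x. indicator {p..q} x *\<^sub>R D x)"
    proof (rule Bochner_Integration.integrable_bound[where f="\<lambda>x. indicator {p..q} x *\<^sub>R L"])
      show "integrable lborel (\<lambda>x. indicator {p..q} x *\<^sub>R L)"
        by (intro integrable_scaleR_left integrable_real_indicator) (use that in auto)
      show "AE x in lborel. norm (indicator {p..q} x *\<^sub>R D x) \<le> norm (indicator {p..q} x *\<^sub>R L)"
        using DL L0 by (intro AE_I2) (simp add: indicator_def)
    qed measurable
    have "ennreal (dist (v p) (v q)) = ennreal (norm (LINT x|lborel. indicator {p..q} x *\<^sub>R D x))"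
      unfolding DI[OF that] by (simp add: dist_norm norm_minus_commute)
    also have "\<dots> \<le> (\<integral>\<^sup>+x. ennreal (norm (indicator {p..q} x *\<^sub>R D x)) \<partial>lborel)"
      by (rule integral_norm_bound_ennreal[OF int])
    also have "\<dots> = (\<integral>\<^sup>+r\<in>{p..q}. ennreal (norm (D r)) \<partial>lborel)"
      by (rule nn_integral_cong) (auto simp: indicator_def)
    finally show ?thesis .
  qed
  \<comment> \<open>\<open>|D| \<le> L\<close> on an interval of length 2 turns the excess \<delta>
    into at most \<open>2 * L * \<delta>\<close>; the added 1 covers \<open>L = 0\<close>.\<close>
  define \<delta> where "\<delta> = \<epsilon> / (2 * L + 1)"
  have \<delta>: "\<delta> > 0" "\<delta> * (2 * L) \<le> \<epsilon>" using e L0 by (auto simp: \<delta>_def field_simps)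
  have p0: "polygonal_cost W A (v (-1)) (v (-1)) 0" by (rule polygonal_cost.start) (use A[of "-1"] vg in auto)
  obtain c where c: "polygonal_cost W A (v (-1)) (v 1) c"
    "ennreal c \<le> ennreal 0 + (\<integral>\<^sup>+r\<in>{-1..1}. ennreal ((sqrt (2 * W (v r)) + \<delta>) * norm (D r)) \<partial>lborel)"
  proof (rule polygonal_cost_along_curve[OF W vcont, where s="-1" and t=1 and g="\<lambda>r. norm (D r)" and A=A and x="v (-1)" and \<epsilon>=\<delta> and ?c0.0=0])
    show "v r \<in> A" if "r \<in> {-1..1}" for r using A vg that by simp
    show "ennreal (dist (v p) (v q)) \<le> (\<integral>\<^sup>+r\<in>{p..q}. ennreal (norm (D r)) \<partial>lborel)" if "p \<le> q" for p q
      using dist_le[OF that] .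
    show "thesis" if "\<And>c. polygonal_cost W A (v (-1)) (v 1) c \<Longrightarrow> ennreal c \<le> ennreal 0 + (\<integral>\<^sup>+r\<in>{-1..1}. ennreal ((sqrt (2 * W (v r)) + \<delta>) * norm (D r)) \<partial>lborel) \<Longrightarrow> thesis"
      "polygonal_cost W A (v (-1)) (v 1) c" "ennreal c \<le> ennreal 0 + (\<integral>\<^sup>+r\<in>{-1..1}. ennreal ((sqrt (2 * W (v r)) + \<delta>) * norm (D r)) \<partial>lborel)" for c thesis
      using that by blast
  qed (use p0 \<delta> in auto)
  have "(\<integral>\<^sup>+r\<in>{-1..1}. ennreal ((sqrt (2 * W (v r)) + \<delta>) * norm (D r)) \<partial>lborel)
     \<le> (\<integral>\<^sup>+r. ennreal (sqrt (2 * W (v r)) * norm (D r)) * indicator {-1..1} r + ennreal (\<delta> * L) * indicator {-1..1} r \<partial>lborel)"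
  proof (rule nn_integral_mono)
    fix r
    have "(sqrt (2 * W (v r)) + \<delta>) * norm (D r) \<le> sqrt (2 * W (v r)) * norm (D r) + \<delta> * L"
      using DL[of r] \<delta> by (simp add: distrib_right)
    then have "ennreal ((sqrt (2 * W (v r)) + \<delta>) * norm (D r)) \<le> ennreal (sqrt (2 * W (v r)) * norm (D r) + \<delta> * L)"
      by (rule ennreal_leI)
    also have "\<dots> = ennreal (sqrt (2 * W (v r)) * norm (D r)) + ennreal (\<delta> * L)"
      using W(2) \<delta> L0 by (intro ennreal_plus) auto
    finally show "ennreal ((sqrt (2 * W (v r)) + \<delta>) * norm (D r)) * indicator {-1..1} r \<le>
       ennreal (sqrt (2 * W (v r)) * norm (D r)) * indicator {-1..1} r + ennreal (\<delta> * L) * indicator {-1..1} r"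
      by (auto simp: indicator_def)
  qed
  also have "\<dots> = (\<integral>\<^sup>+r. ennreal (sqrt (2 * W (v r)) * norm (D r)) * indicator {-1..1} r \<partial>lborel) + (\<integral>\<^sup>+r. ennreal (\<delta> * L) * indicator {-1..1::real} r \<partial>lborel)"
    by (rule nn_integral_add) measurable
  also have "(\<integral>\<^sup>+r. ennreal (\<delta> * L) * indicator {-1..1::real} r \<partial>lborel) = ennreal (\<delta> * L) * 2"
    by (subst nn_integral_cmult_indicator) auto
  also have "\<dots> = ennreal (\<delta> * (2 * L))" using \<delta>(1) L0 by (simp add: ennreal_mult'' mult_ac flip: ennreal_numeral)
  also have "\<dots> \<le> ennreal \<epsilon>" using \<delta> by (intro ennreal_leI) auto
  also have "(\<integral>\<^sup>+r. ennreal (sqrt (2 * W (v r)) * norm (D r)) * indicator {-1..1} r \<partial>lborel) = wlength W \<gamma>"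
  proof -
    have "wlength W \<gamma> = (\<integral>\<^sup>+r. ennreal (sqrt (2 * W (\<gamma> r)) * norm (vector_derivative \<gamma> (at r))) * indicator {-1..1} r \<partial>lebesgue)"
      unfolding wlength_def by (rule nn_integral_completion[symmetric])
    also have "\<dots> = (\<integral>\<^sup>+r. ennreal (sqrt (2 * W (v r)) * norm (D r)) * indicator {-1..1} r \<partial>lebesgue)"
    proof (rule nn_integral_cong_AE)
      show "AE r in lebesgue. ennreal (sqrt (2 * W (\<gamma> r)) * norm (vector_derivative \<gamma> (at r))) * indicator {-1..1} r =
          ennreal (sqrt (2 * W (v r)) * norm (D r)) * indicator {-1..1} r"
        using Dd AE_completion[OF AE_lborel_singleton[of "-1"]] AE_completion[OF AE_lborel_singleton[of "1"]]
      proof eventually_elim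
        fix r assume r: "(v has_vector_derivative D r) (at r)" "r \<noteq> -1" "r \<noteq> (1::real)"
        show "ennreal (sqrt (2 * W (\<gamma> r)) * norm (vector_derivative \<gamma> (at r))) * indicator {-1..1} r =
          ennreal (sqrt (2 * W (v r)) * norm (D r)) * indicator {-1..1} r"
        proof (cases "r \<in> {-1<..<1}")
          case True
          have "(\<gamma> has_vector_derivative D r) (at r)"
            by (rule has_vector_derivative_transform_within_open[OF r(1) open_greaterThanLessThan[of "-1" 1] True]) (use vg in auto)
          then have "vector_derivative \<gamma> (at r) = D r" by (rule vector_derivative_at)
          then show ?thesis using vg[of r] True by simp
        next
          case False
          then have "r \<notin> {-1..1}" using r by auto
          then show ?thesis by simp
        qed
      qed
    qed
    also have "\<dots> = (\<integral>\<^sup>+r. ennreal (sqrt (2 * W (v r)) * norm (D r)) * indicator {-1..1} r \<partial>lborel)"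
      by (rule nn_integral_completion)
    finally show ?thesis by simp
  qed
  finally have "ennreal c \<le> wlength W \<gamma> + ennreal \<epsilon>" using c(2) by (simp add: add_left_mono order_trans)
  then show ?thesis using that c(1) vg by simp
qed


section \<open>One-dimensional competitors\<close>

lemma nn_integral_lborel_translate:
  fixes f :: "'a::euclidean_space \<Rightarrow> ennreal"
  assumes "f \<in> borel_measurable borel"
  shows "(\<integral>\<^sup>+x. f (x + c) \<partial>lborel) = (\<integral>\<^sup>+x. f x \<partial>lborel)"
proof -
  have "(\<integral>\<^sup>+x. f x \<partial>lborel) = (\<integral>\<^sup>+x. f x \<partial>(distr lborel borel ((+) c)))" by (simp add: lborel_distr_plus)
  also have "\<dots> = (\<integral>\<^sup>+x. f (c + x) \<partial>lborel)" using assms by (intro nn_integral_distr) auto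
  finally show ?thesis by (simp add: add.commute)
qed

lemma integral_lborel_translate:
  fixes f :: "'a::euclidean_space \<Rightarrow> 'b::{banach, second_countable_topology}"
  assumes "f \<in> borel_measurable borel"
  shows "(\<integral>x. f (x + c) \<partial>lborel) = (\<integral>x. f x \<partial>lborel)"
proof -
  have "(\<integral>x. f x \<partial>lborel) = (\<integral>x. f x \<partial>(distr lborel borel ((+) c)))" by (simp add: lborel_distr_plus)
  also have "\<dots> = (\<integral>x. f (c + x) \<partial>lborel)" using assms by (intro integral_distr) auto
  finally show ?thesis by (simp add: add.commute)
qed

lemma integrable_lborel_translate:
  fixes f :: "'a::euclidean_space \<Rightarrow> 'b::{banach, second_countable_topology}"
  assumes "integrable lborel f"
  shows "integrable lborel (\<lambda>x. f (x + c))"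
proof -
  have "integrable (distr lborel borel ((+) c)) f" using assms by (simp add: lborel_distr_plus)
  then have "integrable lborel (\<lambda>x. f (c + x))" by (rule integrable_distr[rotated]) auto
  then show ?thesis by (simp add: add.commute)
qed

lemma AE_lborel_translate:
  fixes c :: "'a::euclidean_space"
  assumes "AE x in lborel. P x"
  shows "AE x in lborel. P (x + c)"
proof -
  have "AE x in distr lborel borel ((+) c). P x" unfolding lborel_distr_plus by (rule assms)
  then have "AE x in lborel. P (c + x)" by (rule AE_distrD[rotated]) auto
  then show ?thesis by (simp add: add.commute)
qed

lemma borel_measurable_vec_nth [measurable]: "(\<lambda>x::('b::euclidean_space)^'n::finite. x $ i) \<in> borel_measurable borel"
  by (intro borel_measurable_continuous_onI continuous_intros)

lemma emeasure_unit_cbox: "emeasure lborel (cbox 0 (1::real^'n::finite)) = 1"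
proof -
  have one: "(1::real^'n) \<bullet> b = 1" if "b \<in> Basis" for b
    using that by (auto simp: Basis_vec_def inner_axis)
  show ?thesis by (simp add: emeasure_lborel_cbox_eq one)
qed

lemma strip_borel [measurable]: "strip k \<in> sets borel"
proof -
  have "strip k = (\<Inter>i\<in>-{k}. {x. 0 \<le> x$i} \<inter> {x. x$i \<le> 1})" by (auto simp: strip_def)
  also have "closed \<dots>" by (intro closed_INT ballI closed_Int closed_Collect_le continuous_intros)
  finally show ?thesis by simp
qed

text \<open>Averaging over the \<open>k\<close>-th coordinate of the unit cube replaces splitting off that coordinate,
  so that Tonelli's theorem on \<open>real^'n \<times> real\<close> suffices.\<close>

lemma nn_integral_strip:
  fixes f :: "real^'n::finite \<Rightarrow> ennreal"
  assumes [measurable]: "f \<in> borel_measurable borel"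
  shows "(\<integral>\<^sup>+x\<in>strip k. f x \<partial>lborel) = (\<integral>\<^sup>+x\<in>cbox 0 1. (\<integral>\<^sup>+s. f (x + s *\<^sub>R axis k 1) \<partial>lborel) \<partial>lborel)"
proof -
  let ?e = "axis k (1::real) :: real^'n" and ?Q = "cbox 0 1 :: (real^'n) set"
  have Qm: "?Q \<in> sets borel" by simp
  have "(\<integral>\<^sup>+x\<in>?Q. (\<integral>\<^sup>+s. f (x + s *\<^sub>R ?e) \<partial>lborel) \<partial>lborel)
      = (\<integral>\<^sup>+x. (\<integral>\<^sup>+s. f (x + s *\<^sub>R ?e) * indicator ?Q x \<partial>lborel) \<partial>lborel)"
    by (intro nn_integral_cong nn_integral_multc[symmetric]) measurable
  also have "\<dots> = (\<integral>\<^sup>+s. (\<integral>\<^sup>+x. f (x + s *\<^sub>R ?e) * indicator ?Q x \<partial>lborel) \<partial>lborel)"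
    by (rule lborel_pair.Fubini'[symmetric]) measurable
  also have "\<dots> = (\<integral>\<^sup>+s. (\<integral>\<^sup>+y. f y * indicator ?Q (y - s *\<^sub>R ?e) \<partial>lborel) \<partial>lborel)"
  proof (rule nn_integral_cong)
    fix s
    show "(\<integral>\<^sup>+x. f (x + s *\<^sub>R ?e) * indicator ?Q x \<partial>lborel) = (\<integral>\<^sup>+y. f y * indicator ?Q (y - s *\<^sub>R ?e) \<partial>lborel)"
      using nn_integral_lborel_translate[of "\<lambda>y. f y * indicator ?Q (y - s *\<^sub>R ?e)" "s *\<^sub>R ?e"] by simp
  qed
  also have "\<dots> = (\<integral>\<^sup>+y. (\<integral>\<^sup>+s. f y * indicator ?Q (y - s *\<^sub>R ?e) \<partial>lborel) \<partial>lborel)"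
    by (rule lborel_pair.Fubini'[symmetric]) measurable
  also have "\<dots> = (\<integral>\<^sup>+x\<in>strip k. f x \<partial>lborel)"
  proof (rule nn_integral_cong)
    fix y :: "real^'n"
    \<comment> \<open>For fixed \<open>y\<close> in the strip the admissible \<open>s\<close> fill
      an interval of length one, so the surplus coordinate of the cube integrates to 1.\<close>
    have "(y - s *\<^sub>R ?e \<in> ?Q) = (y \<in> strip k \<and> s \<in> {y$k - 1..y$k})" for s
      unfolding mem_box_cart strip_def axis_def by (auto split: if_splits)
    then have ind: "indicator ?Q (y - s *\<^sub>R ?e) = (indicator (strip k) y * indicator {y$k-1..y$k} s :: ennreal)" for s
      by (simp add: indicator_def)
    have "(\<integral>\<^sup>+s. f y * indicator ?Q (y - s *\<^sub>R ?e) \<partial>lborel) = (\<integral>\<^sup>+s. (f y * indicator (strip k) y) * indicator {y$k-1..y$k} s \<partial>lborel)"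
      unfolding ind by (simp add: mult.assoc)
    also have "\<dots> = f y * indicator (strip k) y" by (subst nn_integral_cmult_indicator) auto
    finally show "(\<integral>\<^sup>+s. f y * indicator ?Q (y - s *\<^sub>R ?e) \<partial>lborel) = f y * indicator (strip k) y" .
  qed
  finally show ?thesis by simp
qed

lemma nn_integral_strip_one_dim:
  fixes f :: "real \<Rightarrow> ennreal" and k :: "'n::finite"
  assumes [measurable]: "f \<in> borel_measurable borel"
  shows "(\<integral>\<^sup>+x\<in>strip k. f (x$k) \<partial>lborel) = (\<integral>\<^sup>+s. f s \<partial>lborel)"
proof -
  have *: "(\<integral>\<^sup>+s. f (x $ k + s) \<partial>lborel) = (\<integral>\<^sup>+s. f s \<partial>lborel)" for x :: "real^'n"
    using nn_integral_lborel_translate[OF assms, of "x$k"] by (simp add: add.commute)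
  have "(\<integral>\<^sup>+x\<in>strip k. f (x$k) \<partial>lborel) = (\<integral>\<^sup>+x\<in>(cbox 0 1::(real^'n) set). (\<integral>\<^sup>+s. f s \<partial>lborel) \<partial>lborel)"
    by (subst nn_integral_strip) (simp_all add: * axis_def)
  also have "\<dots> = (\<integral>\<^sup>+s. f s \<partial>lborel)"
    by (subst nn_integral_cmult_indicator) (auto simp: emeasure_unit_cbox)
  finally show ?thesis .
qed

lemma norm_matrix_power2: "(norm A)\<^sup>2 = (\<Sum>i\<in>UNIV. \<Sum>j\<in>UNIV. (A $ i $ j)\<^sup>2)" for A :: "real^'m::finite^'n::finite"
  unfolding power2_norm_eq_inner inner_vec_def by (simp add: power2_eq_square)

lemma AE_coord_notin_finite:
  assumes "finite F"
  shows "AE x in lborel. (x::real^'n::finite) $ k \<notin> F"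
proof -
  have "AE x in lborel. \<forall>c\<in>F. (x::real^'n) $ k \<noteq> c"
  proof (rule AE_finite_allI[OF assms])
    fix c
    have "negligible {x::real^'n. x \<bullet> axis k 1 = c}" by (rule negligible_standard_hyperplane) simp
    then have "AE x in lebesgue. (x::real^'n) \<notin> {x. x \<bullet> axis k 1 = c}"
      by (intro AE_not_in) (simp add: negligible_iff_null_sets)
    then have "AE x in lebesgue. (x::real^'n) $ k \<noteq> c" by (simp add: inner_axis)
    then show "AE x in lborel. (x::real^'n) $ k \<noteq> c" by (subst (asm) AE_completion_iff) auto
  qed
  then show ?thesis by eventually_elim auto
qed

section \<open>Test functions and weak gradients of one-dimensional fields\<close>

lemma test_funE:
  assumes "test_fun \<phi> D"
  obtains R C where "0 \<le> C" "\<And>x. R < norm x \<Longrightarrow> \<phi> x = 0" "\<And>x. R < norm x \<Longrightarrow> D x = 0" "\<And>x. \<bar>\<phi> x\<bar> \<le> C" "\<And>x. norm (D x) \<le> C"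
    "\<And>x y. \<bar>\<phi> x - \<phi> y\<bar> \<le> C * norm (x - y)"
    "continuous_on UNIV \<phi>" "continuous_on UNIV D" "\<phi> \<in> borel_measurable borel" "D \<in> borel_measurable borel"
proof -
  from assms obtain R where der: "\<And>x. (\<phi> has_derivative (\<lambda>h. D x \<bullet> h)) (at x)" and Dc: "continuous_on UNIV D"
    and R: "\<And>x. R < norm x \<Longrightarrow> \<phi> x = 0" unfolding test_fun_def by blast
  have pc: "continuous_on UNIV \<phi>"
    by (intro continuous_at_imp_continuous_on ballI has_derivative_continuous[OF der])
  have D0: "D x = 0" if "R < norm x" for x
  proof -
    have "open {x. R < norm x}" by (intro open_Collect_less continuous_intros)
    then have "((\<lambda>_. 0) has_derivative (\<lambda>h. D x \<bullet> h)) (at x)"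
      using der[of x] has_derivative_transform_within_open[of \<phi> "\<lambda>h. D x \<bullet> h" x UNIV "{x. R < norm x}" "\<lambda>_. 0"] that R by auto
    then have "(\<lambda>h. D x \<bullet> h) = (\<lambda>h. 0)" using has_derivative_unique[OF _ has_derivative_const] by blast
    then have "D x \<bullet> D x = 0" by meson
    then show ?thesis by simp
  qed
  have "bounded (\<phi> ` cball 0 R)" by (intro compact_imp_bounded compact_continuous_image continuous_on_subset[OF pc]) auto
  then obtain C1 where C1: "\<And>x. x \<in> cball 0 R \<Longrightarrow> norm (\<phi> x) \<le> C1" unfolding bounded_iff by (metis imageI)
  have "bounded (D ` cball 0 R)" by (intro compact_imp_bounded compact_continuous_image continuous_on_subset[OF Dc]) auto
  then obtain C2 where C2: "\<And>x. x \<in> cball 0 R \<Longrightarrow> norm (D x) \<le> C2" unfolding bounded_iff by (metis imageI)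
  define C where "C = max 0 (max C1 C2)"
  have C: "0 \<le> C" "C1 \<le> C" "C2 \<le> C" by (auto simp: C_def)
  have b1: "\<bar>\<phi> x\<bar> \<le> C" for x using C1[of x] R[of x] C by (cases "norm x \<le> R") force+
  have b2: "norm (D x) \<le> C" for x using C2[of x] D0[of x] C by (cases "norm x \<le> R") force+
  have lip: "\<bar>\<phi> x - \<phi> y\<bar> \<le> C * norm (x - y)" for x y
  proof -
    have "norm (\<phi> x - \<phi> y) \<le> C * norm (x - y)"
    proof (rule differentiable_bound[of UNIV \<phi> "\<lambda>x h. D x \<bullet> h"])
      show "onorm (\<lambda>h. D x \<bullet> h) \<le> C" for x
      proof (rule onorm_bound[OF C(1)])
        fix h
        have "norm (D x \<bullet> h) \<le> norm (D x) * norm h" by (simp add: Cauchy_Schwarz_ineq2)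
        also have "\<dots> \<le> C * norm h" by (rule mult_right_mono[OF b2]) simp
        finally show "norm (D x \<bullet> h) \<le> C * norm h" .
      qed
    qed (use der in auto)
    then show ?thesis by simp
  qed
  show ?thesis
    by (rule that[OF C(1) R D0 b1 b2 lip pc Dc]) (auto intro: borel_measurable_continuous_onI pc Dc)
qed

lemma integrable_bounded_support:
  fixes f :: "'a::euclidean_space \<Rightarrow> real"
  assumes [measurable]: "f \<in> borel_measurable borel" and "\<And>x. \<bar>f x\<bar> \<le> B" "\<And>x. R < norm x \<Longrightarrow> f x = 0"
  shows "integrable lborel f"
proof (rule Bochner_Integration.integrable_bound[where f="\<lambda>x. indicator (cball 0 R) x *\<^sub>R B"])
  show "integrable lborel (\<lambda>x::'a. indicator (cball 0 R) x *\<^sub>R B)"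
    by (intro integrable_scaleR_left integrable_real_indicator) (use emeasure_bounded_finite[OF bounded_cball] in auto)
  show "AE x in lborel. norm (f x) \<le> norm (indicator (cball 0 R) x *\<^sub>R B)"
  proof (rule AE_I2)
    fix x show "norm (f x) \<le> norm (indicator (cball 0 R) x *\<^sub>R B)"
      using assms(2)[of x] assms(3)[of x] by (cases "norm x \<le> R") auto
  qed
qed measurable

text \<open>The product of the field with a test function is Lipschitz with bounded support. Its
  difference quotients integrate to zero by translation invariance, and dominated convergence turns
  this into integration by parts; no integration over single lines is involved.\<close>

lemma one_dim_weak_grad:
  fixes \<gamma> :: "real \<Rightarrow> real^'n::finite" and k :: 'n
  assumes Lip: "L-lipschitz_on UNIV \<gamma>" and B: "\<And>t. norm (\<gamma> t) \<le> B" and F: "finite F"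
    and der: "\<And>t. t \<notin> F \<Longrightarrow> (\<gamma> has_vector_derivative D t) (at t)"
    and Dm[measurable]: "D \<in> borel_measurable borel" and DL: "\<And>t. norm (D t) \<le> L"
  shows "weak_grad (\<lambda>x. \<gamma> (x$k)) (\<lambda>x. \<chi> i j. if j = k then D (x$k) $ i else 0)"
  unfolding weak_grad_def
proof (intro allI impI)
  fix \<phi> :: "real^'n \<Rightarrow> real" and E i j
  assume tf: "test_fun \<phi> E"
  obtain R C where C: "0 \<le> C" and R: "\<And>x. R < norm x \<Longrightarrow> \<phi> x = 0" "\<And>x. R < norm x \<Longrightarrow> E x = 0"
    and bb: "\<And>x. \<bar>\<phi> x\<bar> \<le> C" "\<And>x. norm (E x) \<le> C" and lip: "\<And>x y. \<bar>\<phi> x - \<phi> y\<bar> \<le> C * norm (x - y)"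
    and cc: "continuous_on UNIV \<phi>" "continuous_on UNIV E"
    and mm[measurable]: "\<phi> \<in> borel_measurable borel" "E \<in> borel_measurable borel"
    by (rule test_funE[OF tf]) (rule that)
  have pd: "(\<phi> has_derivative (\<lambda>h. E x \<bullet> h)) (at x)" for x using tf by (auto simp: test_fun_def)
  have [measurable]: "\<gamma> \<in> borel_measurable borel" by (rule borel_measurable_continuous_onI[OF lipschitz_on_continuous_on[OF Lip]])
  have L0: "L \<ge> 0" by (rule lipschitz_on_nonneg[OF Lip])
  have B0: "B \<ge> 0" using B[of 0] norm_ge_zero order_trans by blast
  define e where "e = (axis j (1::real) :: real^'n)"
  have ne: "norm e = 1" by (simp add: e_def)
  define v where "v x = \<gamma> (x$k) $ i" for x :: "real^'n"
  define H where "H x = (if j = k then D (x$k) $ i else 0)" for x :: "real^'n"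
  define \<Phi> where "\<Phi> x = v x * \<phi> x" for x
  have vB: "\<bar>v x\<bar> \<le> B" for x using B[of "x$k"] component_le_norm_cart[of "\<gamma> (x$k)" i] unfolding v_def by linarith
  have HL: "\<bar>H x\<bar> \<le> L" for x using DL[of "x$k"] component_le_norm_cart[of "D (x$k)" i] L0 unfolding H_def by auto
  have vL: "\<bar>v x - v y\<bar> \<le> L * norm (x - y)" for x y
  proof -
    have "\<bar>v x - v y\<bar> \<le> norm (\<gamma> (x$k) - \<gamma> (y$k))" using component_le_norm_cart[of "\<gamma> (x$k) - \<gamma> (y$k)" i] by (simp add: v_def)
    also have "\<dots> \<le> L * \<bar>x$k - y$k\<bar>" using lipschitz_onD[OF Lip, of "x$k" "y$k"] by (simp add: dist_norm)
    also have "\<dots> \<le> L * norm (x - y)" using component_le_norm_cart[of "x - y" k] by (intro mult_left_mono L0) simp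
    finally show ?thesis .
  qed
  have vm[measurable]: "v \<in> borel_measurable borel" unfolding v_def by measurable
  have Hm[measurable]: "H \<in> borel_measurable borel" unfolding H_def by measurable
  have [measurable]: "\<Phi> \<in> borel_measurable borel" unfolding \<Phi>_def by measurable
  have \<Phi>0: "\<Phi> x = 0" if "R < norm x" for x using R that by (simp add: \<Phi>_def)
  have \<Phi>i: "integrable lborel \<Phi>"
  proof (rule integrable_bounded_support[of _ "B * C" R])
    show "\<bar>\<Phi> x\<bar> \<le> B * C" for x unfolding \<Phi>_def abs_mult by (intro mult_mono vB bb) (use B0 in auto)
  qed (use \<Phi>0 in auto)
  have \<Phi>L: "\<bar>\<Phi> x - \<Phi> y\<bar> \<le> (L * C + B * C) * norm (x - y)" for x y
  proof -
    have "\<bar>\<Phi> x - \<Phi> y\<bar> = \<bar>(v x - v y) * \<phi> x + v y * (\<phi> x - \<phi> y)\<bar>" by (simp add: \<Phi>_def algebra_simps)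
    also have "\<dots> \<le> \<bar>v x - v y\<bar> * \<bar>\<phi> x\<bar> + \<bar>v y\<bar> * \<bar>\<phi> x - \<phi> y\<bar>" by (metis abs_mult abs_triangle_ineq)
    also have "\<dots> \<le> (L * norm (x - y)) * C + B * (C * norm (x - y))"
      by (intro add_mono mult_mono vL bb vB lip) (use L0 B0 C in auto)
    finally show ?thesis by (simp add: algebra_simps)
  qed
  define h where "h = (\<lambda>n. 1 / real (Suc n))"
  have h0: "h n > 0" "h n \<le> 1" for n by (auto simp: h_def)
  have hlim: "h \<longlonglongrightarrow> 0" unfolding h_def by (rule LIMSEQ_Suc[OF lim_1_over_n])
  have hat: "filterlim h (at 0) sequentially"
    using hlim h0 by (simp add: filterlim_at less_imp_neq[symmetric] eventually_sequentially)
  define q where "q n x = (\<Phi> (x + h n *\<^sub>R e) - \<Phi> x) / h n" for n x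
  have qm[measurable]: "q n \<in> borel_measurable borel" for n unfolding q_def by measurable
  have q0: "(\<integral>x. q n x \<partial>lborel) = 0" for n
  proof -
    have "(\<integral>x. q n x \<partial>lborel) = ((\<integral>x. \<Phi> (x + h n *\<^sub>R e) \<partial>lborel) - (\<integral>x. \<Phi> x \<partial>lborel)) / h n"
      unfolding q_def using \<Phi>i integrable_lborel_translate[OF \<Phi>i, of "h n *\<^sub>R e"] by simp
    also have "\<dots> = 0" by (subst integral_lborel_translate) auto
    finally show ?thesis .
  qed
  \<comment> \<open>Since \<open>h n \<le> 1\<close>, enlarging the radius by 1 contains the support
    of every quotient.\<close>
  have qb: "\<bar>q n x\<bar> \<le> indicator (cball 0 (R + 1)) x *\<^sub>R (L * C + B * C)" for n x
  proof (cases "norm x \<le> R + 1")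
    case True
    have "\<bar>\<Phi> (x + h n *\<^sub>R e) - \<Phi> x\<bar> \<le> (L * C + B * C) * h n"
      using \<Phi>L[of "x + h n *\<^sub>R e" x] ne h0[of n] by simp
    then show ?thesis using True h0[of n] by (simp add: q_def divide_le_eq)
  next
    case False
    have "norm x - norm (h n *\<^sub>R e) \<le> norm (x + h n *\<^sub>R e)" by (rule norm_diff_ineq)
    then have "norm (x + h n *\<^sub>R e) > R" using False ne h0[of n] by simp
    then show ?thesis using False \<Phi>0[of x] \<Phi>0[of "x + h n *\<^sub>R e"] by (simp add: q_def)
  qed
  \<comment> \<open>Corners of the curve matter only on finitely many hyperplanes, which are
    null.\<close>
  have qlim: "AE x in lborel. (\<lambda>n. q n x) \<longlonglongrightarrow> v x * E x $ j + H x * \<phi> x"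
    using AE_coord_notin_finite[OF F, of k]
  proof eventually_elim
    fix x :: "real^'n" assume x: "x $ k \<notin> F"
    have dphi: "((\<lambda>t. \<phi> (x + t *\<^sub>R e)) has_real_derivative E x $ j) (at 0)"
    proof -
      have "((\<lambda>t. x + t *\<^sub>R e) has_derivative (\<lambda>t. t *\<^sub>R e)) (at 0)" by (auto intro!: derivative_eq_intros)
      from has_derivative_compose[OF this, of \<phi> "\<lambda>h. E x \<bullet> h"] pd[of x]
      have "((\<lambda>t. \<phi> (x + t *\<^sub>R e)) has_derivative (\<lambda>t. E x \<bullet> (t *\<^sub>R e))) (at 0)" by simp
      moreover have "(\<lambda>t. E x \<bullet> (t *\<^sub>R e)) = (*) (E x $ j)" by (auto simp: e_def inner_axis mult.commute)
      ultimately show ?thesis by (simp add: has_field_derivative_def)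
    qed
    have dv: "((\<lambda>t. v (x + t *\<^sub>R e)) has_real_derivative H x) (at 0)"
    proof (cases "j = k")
      case True
      have "((\<lambda>t. \<gamma> t $ i) has_vector_derivative D (x$k) $ i) (at (x$k))"
        using bounded_linear.has_vector_derivative[OF bounded_linear_vec_nth[of i] der[OF x]] .
      then have "((\<lambda>t. \<gamma> t $ i) has_real_derivative D (x$k) $ i) (at (x$k + 0))" by (simp add: has_real_derivative_iff_has_vector_derivative)
      then have "((\<lambda>t. \<gamma> (x$k + t) $ i) has_real_derivative D (x$k) $ i) (at 0)"
        using DERIV_shift[of "\<lambda>t. \<gamma> t $ i" "D (x$k) $ i" 0 "x$k"] by (simp add: add.commute)
      moreover have "v (x + t *\<^sub>R e) = \<gamma> (x$k + t) $ i" for t using True by (simp add: v_def e_def axis_def)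
      ultimately show ?thesis using True by (simp add: H_def)
    next
      case False
      then have "v (x + t *\<^sub>R e) = v x" for t by (simp add: v_def e_def axis_def)
      then show ?thesis using False by (simp add: H_def)
    qed
    have "((\<lambda>t. \<Phi> (x + t *\<^sub>R e)) has_real_derivative v x * E x $ j + H x * \<phi> x) (at 0)"
      using DERIV_mult[OF dv dphi] unfolding \<Phi>_def by (simp add: algebra_simps)
    then have "((\<lambda>t. (\<Phi> (x + t *\<^sub>R e) - \<Phi> x) / t) \<longlongrightarrow> v x * E x $ j + H x * \<phi> x) (at 0)"
      by (simp add: DERIV_def)
    from filterlim_compose[OF this hat] show "(\<lambda>n. q n x) \<longlonglongrightarrow> v x * E x $ j + H x * \<phi> x"
      by (simp add: q_def)
  qed
  have "(\<lambda>n. \<integral>x. q n x \<partial>lborel) \<longlonglongrightarrow> (\<integral>x. v x * E x $ j + H x * \<phi> x \<partial>lborel)"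
  proof (rule integral_dominated_convergence[where w="\<lambda>x. indicator (cball 0 (R + 1)) x *\<^sub>R (L * C + B * C)"])
    show "integrable lborel (\<lambda>x::real^'n. indicator (cball 0 (R + 1)) x *\<^sub>R (L * C + B * C))"
      by (intro integrable_scaleR_left integrable_real_indicator) (use emeasure_bounded_finite[OF bounded_cball] in auto)
    show "AE x in lborel. norm (q n x) \<le> indicator (cball 0 (R + 1)) x *\<^sub>R (L * C + B * C)" for n
      using qb by (intro AE_I2) simp
  qed (use qlim in measurable)
  then have zero: "(\<integral>x. v x * E x $ j + H x * \<phi> x \<partial>lborel) = 0" unfolding q0 by (simp add: LIMSEQ_const_iff)
  have i1: "integrable lborel (\<lambda>x. v x * E x $ j)"
  proof (rule integrable_bounded_support[of _ "B * C" R])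
    show "\<bar>v x * E x $ j\<bar> \<le> B * C" for x unfolding abs_mult
      by (intro mult_mono vB order_trans[OF component_le_norm_cart bb(2)]) (use B0 in auto)
  qed (use R in auto)
  have i2: "integrable lborel (\<lambda>x. H x * \<phi> x)"
  proof (rule integrable_bounded_support[of _ "L * C" R])
    show "\<bar>H x * \<phi> x\<bar> \<le> L * C" for x unfolding abs_mult
      by (intro mult_mono HL bb) (use L0 in auto)
  qed (use R in auto)
  have "(\<integral>x. v x * E x $ j \<partial>lborel) = - (\<integral>x. H x * \<phi> x \<partial>lborel)"
    using zero i1 i2 by simp
  moreover have "(\<integral>x. v x * E x $ j \<partial>lebesgue) = (\<integral>x. v x * E x $ j \<partial>lborel)" by (rule integral_completion) measurable
  moreover have "(\<integral>x. H x * \<phi> x \<partial>lebesgue) = (\<integral>x. H x * \<phi> x \<partial>lborel)" by (rule integral_completion) measurable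
  ultimately show "(\<integral>x. \<gamma> (x$k) $ i * E x $ j \<partial>lebesgue) = - (\<integral>x. (\<chi> i j. if j = k then D (x$k) $ i else 0) $ i $ j * \<phi> x \<partial>lebesgue)"
    by (simp add: v_def H_def)
qed

lemma L2_loc_bounded:
  fixes f :: "real^'n::finite \<Rightarrow> 'b::euclidean_space"
  assumes "f \<in> borel_measurable borel" "\<And>x. norm (f x) \<le> B"
  shows "L2_loc f"
  unfolding L2_loc_def
proof (intro conjI allI impI)
  show "f \<in> borel_measurable lebesgue" using assms(1) by (simp add: measurable_completion)
  fix K :: "(real^'n) set" assume K: "compact K"
  have "(\<integral>\<^sup>+x\<in>K. ennreal ((norm (f x))\<^sup>2) \<partial>lebesgue) \<le> (\<integral>\<^sup>+x. ennreal (B\<^sup>2) * indicator K x \<partial>lebesgue)"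
    by (intro nn_integral_mono mult_right_mono ennreal_leI power_mono assms(2)) auto
  also have "\<dots> = ennreal (B\<^sup>2) * emeasure lebesgue K"
    by (rule nn_integral_cmult_indicator) (use K in \<open>simp add: borel_compact sets_completionI_sets\<close>)
  also have "\<dots> < \<infinity>"
  proof -
    have "emeasure lebesgue K < top"
      using lmeasurable_compact[OF K] by (simp only: fmeasurable_def mem_Collect_eq infinity_ennreal_def)
    then show ?thesis
      using ennreal_less_top[of "B\<^sup>2"] unfolding infinity_ennreal_def ennreal_mult_less_top by blast
  qed
  finally show "(\<integral>\<^sup>+x\<in>K. ennreal ((norm (f x))\<^sup>2) \<partial>lebesgue) < \<infinity>" .
qed

text \<open>A curve of small energy along the polygon is extended constantly in the transversal
  directions. It stays in the hyperplane, so its \<open>k\<close>-th component is constant and the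
  divergence vanishes. Outside a bounded interval it rests at zeros of \<open>W\<close>, which keeps
  the energy finite and makes the limits exact.\<close>

lemma one_dim_competitor:
  fixes W :: "real^'n::finite \<Rightarrow> real"
  assumes pc: "polygonal_cost W {z. z $ k = a} um up c" and W: "continuous_on UNIV W" "\<And>z. 0 \<le> W z"
    and W0: "W um = 0" "W up = 0" and e: "\<epsilon> > 0"
  obtains v H where "admissible k um up v H" "energy k W v H \<le> ennreal (c + \<epsilon>)"
proof -
  have "convex {z::real^'n. z $ k = a}"
    using convex_hyperplane[of "axis k 1 :: real^'n" a] by (simp add: inner_axis' inner_real_def)
  from polygonal_curve[OF pc this W e] obtain b \<gamma> D F L where
      b: "0 \<le> b" and F: "finite F" and Lip: "L-lipschitz_on UNIV \<gamma>" and x: "\<And>t. t \<le> 0 \<Longrightarrow> \<gamma> t = um" and y: "\<And>t. t \<ge> b \<Longrightarrow> \<gamma> t = up"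
      and Dm[measurable]: "D \<in> borel_measurable borel" and D: "\<And>t. t \<notin> F \<Longrightarrow> (\<gamma> has_vector_derivative D t) (at t)"
      and D0: "\<And>t. t \<notin> {0..b} \<Longrightarrow> D t = 0" and DL: "\<And>t. norm (D t) \<le> L" and \<gamma>A: "\<And>t. \<gamma> t $ k = a"
      and E: "(\<integral>\<^sup>+t\<in>{0..b}. ennreal ((norm (D t))\<^sup>2 / 2 + W (\<gamma> t)) \<partial>lborel) \<le> ennreal (c + \<epsilon>)"
    by auto
  have \<gamma>c: "continuous_on UNIV \<gamma>" by (rule lipschitz_on_continuous_on[OF Lip])
  have [measurable]: "\<gamma> \<in> borel_measurable borel" by (rule borel_measurable_continuous_onI[OF \<gamma>c])
  have Wm[measurable]: "W \<in> borel_measurable borel" using W(1) by (rule borel_measurable_continuous_onI)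
  have "bounded (\<gamma> ` {0..b})" by (intro compact_imp_bounded compact_continuous_image continuous_on_subset[OF \<gamma>c]) auto
  then obtain B1 where B1: "\<And>t. t \<in> {0..b} \<Longrightarrow> norm (\<gamma> t) \<le> B1" unfolding bounded_iff by (metis imageI)
  have B: "norm (\<gamma> t) \<le> B1" for t
  proof -
    consider "t < 0" | "t \<in> {0..b}" | "t > b" by fastforce
    then show ?thesis using B1[of 0] B1[of b] B1[of t] x[of t] x[of 0] y[of t] y[of b] b by cases auto
  qed
  define v where "v x = \<gamma> (x$k)" for x :: "real^'n"
  define H where "H x = (\<chi> i j. if j = k then D (x$k) $ i else 0)" for x :: "real^'n"
  have nH: "(norm (H x))\<^sup>2 = (norm (D (x$k)))\<^sup>2" for x
  proof -
    have "(norm (H x))\<^sup>2 = (\<Sum>i\<in>UNIV. \<Sum>j\<in>UNIV. if j = k then (D (x$k) $ i)\<^sup>2 else 0)"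
      unfolding norm_matrix_power2 by (intro sum.cong refl) (simp add: H_def)
    also have "\<dots> = (norm (D (x$k)))\<^sup>2" unfolding power2_norm_eq_inner inner_vec_def by (simp add: power2_eq_square)
    finally show ?thesis .
  qed
  then have nH': "norm (H x) = norm (D (x$k))" for x by simp
  have Hm: "H \<in> borel_measurable borel"
  proof -
    have "(\<lambda>z::real^'n. \<chi> i j. if j = k then z $ i else 0) \<in> borel_measurable borel"
      by (intro borel_measurable_continuous_onI continuous_on_vec_lambda, rename_tac i j, case_tac "j = k") (auto intro!: continuous_intros)
    moreover have "(\<lambda>x::real^'n. D (x $ k)) \<in> borel_measurable borel" by measurable
    ultimately have "(\<lambda>x. (\<lambda>z. \<chi> i j. if j = k then z $ i else 0) (D (x $ k))) \<in> borel_measurable borel"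
      by (rule measurable_compose[rotated])
    then show ?thesis by (simp add: H_def[abs_def])
  qed
  have vm: "v \<in> borel_measurable borel" unfolding v_def by measurable
  have en: "(\<integral>\<^sup>+x\<in>strip k. f (x$k) \<partial>lebesgue) = (\<integral>\<^sup>+t. f t \<partial>lborel)" if [measurable]: "f \<in> borel_measurable borel" for f :: "real \<Rightarrow> ennreal"
    unfolding nn_integral_completion by (rule nn_integral_strip_one_dim[OF that])
  have "energy k W v H = (\<integral>\<^sup>+x\<in>strip k. (\<lambda>t. ennreal ((norm (D t))\<^sup>2 / 2 + W (\<gamma> t))) (x$k) \<partial>lebesgue)"
    unfolding energy_def nH by (simp add: v_def)
  also have "\<dots> = (\<integral>\<^sup>+t. ennreal ((norm (D t))\<^sup>2 / 2 + W (\<gamma> t)) \<partial>lborel)" by (rule en) measurable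
  also have "\<dots> = (\<integral>\<^sup>+t\<in>{0..b}. ennreal ((norm (D t))\<^sup>2 / 2 + W (\<gamma> t)) \<partial>lborel)"
  proof (rule nn_integral_cong)
    fix t
    show "ennreal ((norm (D t))\<^sup>2 / 2 + W (\<gamma> t)) = ennreal ((norm (D t))\<^sup>2 / 2 + W (\<gamma> t)) * indicator {0..b} t"
    proof (cases "t \<in> {0..b}")
      case False
      then have "W (\<gamma> t) = 0" using x[of t] y[of t] W0 by (cases "t < 0") auto
      then show ?thesis using D0[OF False] False by simp
    qed simp
  qed
  also have "\<dots> \<le> ennreal (c + \<epsilon>)" by (rule E)
  finally have E': "energy k W v H \<le> ennreal (c + \<epsilon>)" .
  have fin: "(\<integral>\<^sup>+x\<in>strip k. ennreal ((norm (H x))\<^sup>2) \<partial>lebesgue) < \<infinity>"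
  proof -
    have "(\<integral>\<^sup>+x\<in>strip k. ennreal ((norm (H x))\<^sup>2) \<partial>lebesgue) = (\<integral>\<^sup>+t. ennreal ((norm (D t))\<^sup>2) \<partial>lborel)"
      unfolding nH using en[of "\<lambda>t. ennreal ((norm (D t))\<^sup>2)"] by simp
    also have "\<dots> \<le> (\<integral>\<^sup>+t. ennreal (L\<^sup>2) * indicator {0..b} t \<partial>lborel)"
    proof (rule nn_integral_mono)
      fix t show "ennreal ((norm (D t))\<^sup>2) \<le> ennreal (L\<^sup>2) * indicator {0..b} t"
        using D0[of t] DL[of t] by (cases "t \<in> {0..b}") (auto intro!: ennreal_leI power_mono)
    qed
    also have "\<dots> = ennreal (L\<^sup>2) * ennreal b" using b by (subst nn_integral_cmult_indicator) auto
    also have "\<dots> < \<infinity>" by (simp add: ennreal_mult_less_top)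
    finally show ?thesis .
  qed
  have div: "AE x in lebesgue. (\<Sum>i\<in>UNIV. H x $ i $ i) = 0"
    using AE_completion[OF AE_coord_notin_finite[OF F, of k]]
  proof eventually_elim
    fix x :: "real^'n" assume xF: "x $ k \<notin> F"
    have "((\<lambda>t. \<gamma> t $ k) has_vector_derivative D (x$k) $ k) (at (x$k))"
      using bounded_linear.has_vector_derivative[OF bounded_linear_vec_nth[of k] D[OF xF]] .
    then have "((\<lambda>t. a) has_vector_derivative D (x$k) $ k) (at (x$k))" by (simp add: \<gamma>A)
    then have "D (x$k) $ k = 0" using vector_derivative_unique_at[OF _ has_vector_derivative_const] by blast
    moreover have "(\<Sum>i\<in>UNIV. H x $ i $ i) = (\<Sum>i\<in>UNIV. if i = k then D (x$k) $ i else 0)" by (simp add: H_def)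
    ultimately show "(\<Sum>i\<in>UNIV. H x $ i $ i) = 0" by simp
  qed
  have ub: "ubar k v t = \<gamma> t" for t
  proof -
    have "ubar k v t = (\<integral>y. \<gamma> t \<partial>(lebesgue_on (cbox 0 (1::real^'n))))" by (simp add: ubar_def v_def)
    also have "\<dots> = measure lebesgue (cbox 0 (1::real^'n)) *\<^sub>R \<gamma> t"
      by (simp add: measure_restrict_space)
    also have "measure lebesgue (cbox 0 (1::real^'n)) = 1" using emeasure_unit_cbox[where 'n='n] by (simp add: measure_def)
    finally show ?thesis by simp
  qed
  have "H1div k v H" unfolding H1div_def
  proof (intro conjI fin div)
    show "periodic_off k v" unfolding periodic_off_def v_def by (simp add: axis_def)
    show "L2_loc v" by (rule L2_loc_bounded[OF vm, of B1]) (simp add: v_def B)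
    show "L2_loc H" by (rule L2_loc_bounded[OF Hm, of L]) (simp add: nH' DL)
    show "weak_grad v H" unfolding v_def H_def by (rule one_dim_weak_grad[OF Lip B F D Dm DL])
  qed
  moreover have "ess_lim_top (ubar k v) up" unfolding ess_lim_top_def
  proof (intro allI impI exI[of _ b])
    fix e :: real assume "e > 0"
    then show "AE t in lborel. b \<le> t \<longrightarrow> dist (ubar k v t) up < e" using y by (intro AE_I2) (simp add: ub)
  qed
  moreover have "ess_lim_bot (ubar k v) um" unfolding ess_lim_bot_def
  proof (intro allI impI exI[of _ 0])
    fix e :: real assume "e > 0"
    then show "AE t in lborel. t \<le> 0 \<longrightarrow> dist (ubar k v t) um < e" using x by (intro AE_I2) (simp add: ub)
  qed
  ultimately show ?thesis using that[of v H] E' by (simp add: admissible_def)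
qed


section \<open>Weak gradients and translations\<close>

text \<open>Borel instead of Lebesgue measurability: compositions such as
  \<open>f (x + s *\<^sub>R y)\<close> then remain measurable on the product of \<open>x\<close> and
  \<open>s\<close>, as Fubini's theorem requires.\<close>

definition loc_integrable :: "('a::euclidean_space \<Rightarrow> real) \<Rightarrow> bool" where
  "loc_integrable f \<longleftrightarrow> f \<in> borel_measurable borel \<and> (\<forall>R. integrable lborel (\<lambda>x. indicator (cball 0 R) x * f x))"

lemma loc_integrableD:
  assumes "loc_integrable f"
  shows "f \<in> borel_measurable borel" "integrable lborel (\<lambda>x. indicator (cball 0 R) x * f x)"
  using assms by (auto simp: loc_integrable_def)

lemma integrable_loc_mult:
  fixes f :: "'a::euclidean_space \<Rightarrow> real"
  assumes f: "loc_integrable f" and [measurable]: "g \<in> borel_measurable borel" and g: "\<And>x. \<bar>g x\<bar> \<le> C" "\<And>x. R < norm x \<Longrightarrow> g x = 0"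
  shows "integrable lborel (\<lambda>x. f x * g x)"
proof (rule Bochner_Integration.integrable_bound[where f="\<lambda>x. C * (indicator (cball 0 R) x * f x)"])
  have [measurable]: "f \<in> borel_measurable borel" using f by (rule loc_integrableD)
  show "integrable lborel (\<lambda>x. C * (indicator (cball 0 R) x * f x))" by (intro integrable_mult_right loc_integrableD f)
  show "(\<lambda>x. f x * g x) \<in> borel_measurable lborel" by measurable
  show "AE x in lborel. norm (f x * g x) \<le> norm (C * (indicator (cball 0 R) x * f x))"
  proof (rule AE_I2)
    fix x
    have C: "0 \<le> C" using g(1)[of x] abs_ge_zero order_trans by blast
    show "norm (f x * g x) \<le> norm (C * (indicator (cball 0 R) x * f x))"
    proof (cases "norm x \<le> R")
      case True
      have "\<bar>f x\<bar> * \<bar>g x\<bar> \<le> \<bar>f x\<bar> * C" by (intro mult_left_mono g) auto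
      then show ?thesis using True C by (simp add: abs_mult mult.commute)
    next
      case False then show ?thesis using g(2) by simp
    qed
  qed
qed

lemma loc_integrable_diff: "loc_integrable f \<Longrightarrow> loc_integrable g \<Longrightarrow> loc_integrable (\<lambda>x. f x - g x)"
  unfolding loc_integrable_def by (auto simp: right_diff_distrib)

lemma loc_integrable_sum: "(\<And>i. i \<in> I \<Longrightarrow> loc_integrable (f i)) \<Longrightarrow> loc_integrable (\<lambda>x. \<Sum>i\<in>I. f i x)"
  unfolding loc_integrable_def by (auto simp: sum_distrib_left intro!: borel_measurable_sum)

lemma loc_integrable_mult_const: "loc_integrable f \<Longrightarrow> loc_integrable (\<lambda>x. f x * c)"
  unfolding loc_integrable_def by (auto simp: mult.assoc[symmetric])

lemma loc_integrable_translate: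
  assumes f: "loc_integrable f"
  shows "loc_integrable (\<lambda>x. f (x + c))"
  unfolding loc_integrable_def
proof (intro conjI allI)
  have [measurable]: "f \<in> borel_measurable borel" using f by (rule loc_integrableD)
  show "(\<lambda>x. f (x + c)) \<in> borel_measurable borel" by measurable
  fix R
  have "integrable lborel (\<lambda>x. f x * indicator (cball 0 R) (x - c))"
  proof (rule integrable_loc_mult[OF f, of _ 1 "R + norm c"])
    show "indicator (cball 0 R) (x - c) = (0::real)" if "R + norm c < norm x" for x
      using norm_triangle_sub[of x c] that by (auto simp: indicator_def)
  qed (auto simp: indicator_def)
  from integrable_lborel_translate[OF this, of c]
  show "integrable lborel (\<lambda>x. indicator (cball 0 R) x * f (x + c))" by (simp add: mult.commute)
qed

section \<open>Operations on test functions and the fundamental lemma of the calculus of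
  variations\<close>

lemma test_fun_mult:
  assumes "test_fun \<phi> D" "test_fun \<psi> E"
  shows "test_fun (\<lambda>x. \<phi> x * \<psi> x) (\<lambda>x. \<phi> x *\<^sub>R E x + \<psi> x *\<^sub>R D x)"
proof -
  have d: "(\<phi> has_derivative (\<lambda>h. D x \<bullet> h)) (at x)" "(\<psi> has_derivative (\<lambda>h. E x \<bullet> h)) (at x)" for x
    using assms by (auto simp: test_fun_def)
  have c: "continuous_on UNIV \<phi>" "continuous_on UNIV \<psi>"
    using d by (auto intro!: continuous_at_imp_continuous_on has_derivative_continuous)
  have cD: "continuous_on UNIV D" "continuous_on UNIV E" using assms by (auto simp: test_fun_def)
  obtain R where R: "\<And>x. norm x > R \<Longrightarrow> \<phi> x = 0" using assms by (auto simp: test_fun_def)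
  show ?thesis unfolding test_fun_def
  proof (intro conjI allI exI[of _ R] impI)
    show "((\<lambda>x. \<phi> x * \<psi> x) has_derivative (\<lambda>h. (\<phi> x *\<^sub>R E x + \<psi> x *\<^sub>R D x) \<bullet> h)) (at x)" for x
      by (rule has_derivative_eq_rhs[OF has_derivative_mult[OF d]]) (auto simp: inner_add_left algebra_simps)
  qed (use R c cD in \<open>auto intro!: continuous_intros\<close>)
qed

text \<open>Needed for cut-offs of a test function; \<open>s 0 = 0\<close> keeps the support
  bounded.\<close>

lemma test_fun_compose:
  assumes "test_fun \<phi> D" and s: "\<And>t. (s has_real_derivative s' t) (at t)" and s': "continuous_on UNIV s'" and "s 0 = 0"
  shows "test_fun (\<lambda>x. s (\<phi> x)) (\<lambda>x. s' (\<phi> x) *\<^sub>R D x)"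
proof -
  have d: "(\<phi> has_derivative (\<lambda>h. D x \<bullet> h)) (at x)" for x using assms by (auto simp: test_fun_def)
  have c: "continuous_on UNIV \<phi>" using d by (auto intro!: continuous_at_imp_continuous_on has_derivative_continuous)
  have cD: "continuous_on UNIV D" using assms by (auto simp: test_fun_def)
  obtain R where R: "\<And>x. norm x > R \<Longrightarrow> \<phi> x = 0" using assms by (auto simp: test_fun_def)
  show ?thesis unfolding test_fun_def
  proof (intro conjI allI exI[of _ R] impI)
    fix x
    have "(s has_derivative (\<lambda>h. s' (\<phi> x) * h)) (at (\<phi> x))" using s by (simp add: has_field_derivative_def)
    from has_derivative_compose[OF d this]
    show "((\<lambda>x. s (\<phi> x)) has_derivative (\<lambda>h. (s' (\<phi> x) *\<^sub>R D x) \<bullet> h)) (at x)" by simp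
  next
    show "continuous_on UNIV (\<lambda>x. s' (\<phi> x) *\<^sub>R D x)"
      by (intro continuous_on_scaleR cD continuous_on_compose2[OF s' c]) auto
  qed (use R assms in auto)
qed

lemma test_fun_translate:
  fixes \<phi> :: "real^'n::finite \<Rightarrow> real"
  assumes "test_fun \<phi> D"
  shows "test_fun (\<lambda>x. \<phi> (x + c)) (\<lambda>x. D (x + c))"
proof -
  have d: "(\<phi> has_derivative (\<lambda>h. D x \<bullet> h)) (at x)" for x using assms by (auto simp: test_fun_def)
  have cD: "continuous_on UNIV D" using assms by (auto simp: test_fun_def)
  obtain R where R: "\<And>x. norm x > R \<Longrightarrow> \<phi> x = 0" using assms by (auto simp: test_fun_def)
  show ?thesis unfolding test_fun_def
  proof (intro conjI allI exI[of _ "R + norm c"] impI)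
    fix x :: "real^'n"
    have "((\<lambda>x. x + c) has_derivative (\<lambda>h. h)) (at x)" by (auto intro!: derivative_eq_intros)
    from has_derivative_compose[OF this d[of "x + c"]]
    show "((\<lambda>x. \<phi> (x + c)) has_derivative (\<lambda>h. D (x + c) \<bullet> h)) (at x)" .
  next
    show "continuous_on UNIV (\<lambda>x. D (x + c))" by (rule continuous_on_compose2[OF cD]) (auto intro!: continuous_intros)
  next
    fix x :: "real^'n" assume "R + norm c < norm x"
    moreover have "norm x - norm c \<le> norm (x + c)" by (rule norm_diff_ineq)
    ultimately show "\<phi> (x + c) = 0" by (intro R) auto
  qed
qed

lemma has_derivative_positive_part_square:
  "((\<lambda>t. (max 0 t)\<^sup>2) has_real_derivative 2 * max 0 t) (at t)" for t :: real
proof -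
  consider "t < 0" | "t > 0" | "t = 0" by linarith
  then show ?thesis
  proof cases
    case 1
    have "((\<lambda>t. 0) has_real_derivative 2 * max 0 t) (at t)" using 1 by simp
    then show ?thesis by (rule has_field_derivative_transform_within_open[where S="{..<0}"]) (use 1 in auto)
  next
    case 2
    have "((\<lambda>t. t\<^sup>2) has_real_derivative 2 * max 0 t) (at t)" using 2 by (auto intro!: derivative_eq_intros)
    then show ?thesis by (rule has_field_derivative_transform_within_open[where S="{0<..}"]) (use 2 in auto)
  next
    case 3
    have "((\<lambda>h::real. (max 0 h)\<^sup>2 / h) \<longlongrightarrow> 0) (at 0)"
    proof (rule Lim_null_comparison)
      show "\<forall>\<^sub>F h in at 0. norm ((max 0 h)\<^sup>2 / h) \<le> \<bar>h :: real\<bar>"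
        by (rule always_eventually) (auto simp: max_def power2_eq_square)
      show "((\<lambda>h::real. \<bar>h\<bar>) \<longlongrightarrow> 0) (at 0)" by (rule tendsto_eq_intros | simp)+
    qed
    then show ?thesis unfolding 3 DERIV_def by simp
  qed
qed

text \<open>Test functions are only required to be continuously differentiable, so the squared
  positive part of a quadratic polynomial is regular enough; the square removes the kink of the
  positive part at the sphere.\<close>

lemma test_fun_ball:
  fixes c :: "real^'n::finite"
  assumes r: "r > 0"
  obtains h D where "test_fun h D" "{x. h x \<noteq> 0} = ball c r"
proof -
  define w where "w x = r\<^sup>2 - (x - c) \<bullet> (x - c)" for x
  define h where "h x = (max 0 (w x))\<^sup>2" for x
  define D where "D x = (2 * max 0 (w x)) *\<^sub>R ((-2) *\<^sub>R (x - c))" for x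
  have wd: "(w has_derivative (\<lambda>h. ((-2) *\<^sub>R (x - c)) \<bullet> h)) (at x)" for x
    unfolding w_def by (auto intro!: derivative_eq_intros simp: inner_commute)
  have wpos: "(0 < w x) = (x \<in> ball c r)" for x
  proof -
    have "(0 < w x) = ((norm (x - c))\<^sup>2 < r\<^sup>2)" by (simp add: w_def power2_norm_eq_inner)
    also have "\<dots> = (norm (x - c) < r)" using r power2_less_imp_less[of "norm (x - c)" r] power_strict_mono[of "norm (x - c)" r 2] by auto
    finally show ?thesis by (simp add: dist_norm norm_minus_commute)
  qed
  have "test_fun h D" unfolding test_fun_def
  proof (intro conjI allI exI[of _ "norm c + r"] impI)
    fix x
    have "((\<lambda>t. (max 0 t)\<^sup>2) has_derivative (\<lambda>h. (2 * max 0 (w x)) * h)) (at (w x))"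
      using has_derivative_positive_part_square[of "w x"] by (simp add: has_field_derivative_def)
    from has_derivative_compose[OF wd this]
    show "(h has_derivative (\<lambda>h. D x \<bullet> h)) (at x)" by (simp add: h_def[abs_def] D_def mult.assoc)
  next
    show "continuous_on UNIV D" unfolding D_def w_def by (intro continuous_intros)
  next
    fix x :: "real^'n" assume "norm c + r < norm x"
    then have "x \<notin> ball c r" using norm_triangle_sub[of x c] by (auto simp: dist_norm norm_minus_commute)
    then show "h x = 0" using wpos[of x] by (simp add: h_def max_def)
  qed
  moreover have "{x. h x \<noteq> 0} = ball c r"
  proof -
    have "(h x \<noteq> 0) = (0 < w x)" for x by (auto simp: h_def max_def)
    then show ?thesis using wpos by blast
  qed
  ultimately show ?thesis by (rule that)
qed

lemma ball_in_test_fun_supports: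
  assumes r: "r > 0"
  shows "ball (c::real^'n::finite) r \<in> {{x. h x \<noteq> 0} |h. \<exists>D. test_fun h D}"
proof -
  obtain h D where "test_fun h D" "{x. h x \<noteq> 0} = ball c r"
    by (rule test_fun_ball[OF r, of c]) (rule that)
  then show ?thesis by (intro CollectI exI[of _ h] conjI exI[of _ D]) auto
qed

text \<open>By Lindelof's theorem open sets are countable unions of balls, and each ball is the set
  where some test function does not vanish. Products of test functions make these sets closed under
  intersection, which qualifies them as a generator for the uniqueness of measures.\<close>

lemma sigma_sets_test_fun_supports:
  "sets (borel :: (real^'n::finite) measure) = sigma_sets UNIV {{x. h x \<noteq> 0} |h. \<exists>D. test_fun h D}"
  (is "_ = sigma_sets UNIV ?E")
proof
  note ball = ball_in_test_fun_supports[where 'n='n]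
  have op: "S \<in> sigma_sets UNIV ?E" if S: "open S" for S :: "(real^'n) set"
  proof -
    define B where "B = {ball c r |c r. r > 0 \<and> ball c r \<subseteq> S}"
    have US: "\<Union>B = S"
    proof
      show "S \<subseteq> \<Union>B"
      proof
        fix x assume "x \<in> S"
        then obtain r where "r > 0" "ball x r \<subseteq> S" using S open_contains_ball by blast
        then show "x \<in> \<Union>B" unfolding B_def by (intro UnionI[of "ball x r"]) auto
      qed
    qed (auto simp: B_def)
    obtain B' where B': "B' \<subseteq> B" "countable B'" "\<Union>B' = \<Union>B"
      using Lindelof[of B] unfolding B_def by blast
    have "\<Union>B' \<in> sigma_sets UNIV ?E"
    proof (rule sigma_sets_UNION[OF B'(2)])
      fix b assume "b \<in> B'"
      then have "b \<in> ?E" using B'(1) ball unfolding B_def by blast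
      then show "b \<in> sigma_sets UNIV ?E" by (rule sigma_sets.Basic)
    qed
    then show ?thesis using B'(3) US by simp
  qed
  show "sets borel \<subseteq> sigma_sets UNIV ?E"
    unfolding borel_def by (auto intro!: sigma_sets_mono op)
  show "sigma_sets UNIV ?E \<subseteq> sets (borel :: (real^'n) measure)"
  proof (rule sets.sigma_sets_subset[of _ borel, simplified])
    show "?E \<subseteq> sets borel"
    proof
      fix X :: "(real^'n) set" assume "X \<in> ?E"
      then obtain h D where h: "X = {x. h x \<noteq> 0}" "test_fun h D" by blast
      have "continuous_on UNIV h" by (rule test_funE[OF h(2)])
      then have "open X" unfolding h(1) by (intro open_Collect_neq continuous_on_const)
      then show "X \<in> sets borel" by simp
    qed
  qed
qed

text \<open>Testing is transferred from functions to sets: approximating indicators shows that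
  \<open>f\<close> has integral zero over every set \<open>{x. h x \<noteq> 0}\<close>. Hence the
  measures whose densities are the positive and the negative part of \<open>f\<close> agree on a
  generator, so they are equal.\<close>

lemma fundamental_lemma_calculus_of_variations:
  fixes f :: "real^'n::finite \<Rightarrow> real"
  assumes f: "loc_integrable f" and 0: "\<And>\<phi> D. test_fun \<phi> D \<Longrightarrow> (\<integral>x. f x * \<phi> x \<partial>lborel) = 0"
  shows "AE x in lborel. f x = 0"
proof -
  have fm[measurable]: "f \<in> borel_measurable borel" using f by (rule loc_integrableD)
  let ?E = "{{x. h x \<noteq> 0} |h. \<exists>D. test_fun h D} :: (real^'n) set set"
  have key: "integrable lborel (\<lambda>x. f x * indicator X x) \<and> (\<integral>x. f x * indicator X x \<partial>lborel) = 0" if XE: "X \<in> ?E" for X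
  proof -
    obtain h D where h: "X = {x. h x \<noteq> 0}" "test_fun h D" using XE by blast
    obtain R C where R: "\<And>x. R < norm x \<Longrightarrow> h x = 0" and [measurable]: "h \<in> borel_measurable borel"
      by (rule test_funE[OF h(2)]) (rule that)
    have Xm[measurable]: "X \<in> sets borel" unfolding h(1) by measurable
    \<comment> \<open>\<open>s m\<close> is continuously differentiable, vanishes at 0 and increases
      to 1 elsewhere, so the functions \<open>s m (h x)\<close> are test functions tending to the
      indicator of \<open>X\<close>.\<close>
    define s where "s m t = real m * t\<^sup>2 / (1 + real m * t\<^sup>2)" for m t
    have pos: "1 + real m * t\<^sup>2 > 0" for m t by (simp add: add_pos_nonneg)
    have sb: "0 \<le> s m t" "s m t \<le> 1" for m t using pos[of m t] by (auto simp: s_def divide_le_eq)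
    have sd: "(s m has_real_derivative (2 * real m * t) / (1 + real m * t\<^sup>2)\<^sup>2) (at t)" for m t
      unfolding s_def using pos[of m t]
      by (auto intro!: derivative_eq_intros simp: field_simps power2_eq_square)
    have tf: "test_fun (\<lambda>x. s m (h x)) (\<lambda>x. ((2 * real m * h x) / (1 + real m * (h x)\<^sup>2)\<^sup>2) *\<^sub>R D x)" for m
    proof (rule test_fun_compose[OF h(2) sd])
      show "continuous_on UNIV (\<lambda>t. (2 * real m * t) / (1 + real m * t\<^sup>2)\<^sup>2)"
      proof (rule continuous_on_divide)
        show "\<forall>t\<in>UNIV. (1 + real m * t\<^sup>2)\<^sup>2 \<noteq> 0" using pos by (metis less_irrefl power_eq_0_iff)
      qed (intro continuous_intros)+
    qed (simp add: s_def)
    have i: "integrable lborel (\<lambda>x. f x * indicator X x)"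
      by (rule integrable_loc_mult[OF f, of _ 1 R]) (auto simp: h(1) indicator_def R)
    have "(\<lambda>m. \<integral>x. f x * s m (h x) \<partial>lborel) \<longlonglongrightarrow> (\<integral>x. f x * indicator X x \<partial>lborel)"
    proof (rule integral_dominated_convergence[where w="\<lambda>x. norm (f x * indicator X x)"])
      show "integrable lborel (\<lambda>x. norm (f x * indicator X x))" using i by (rule integrable_norm)
      show "AE x in lborel. (\<lambda>m. f x * s m (h x)) \<longlonglongrightarrow> f x * indicator X x"
      proof (rule AE_I2)
        fix x
        show "(\<lambda>m. f x * s m (h x)) \<longlonglongrightarrow> f x * indicator X x"
        proof (cases "h x = 0")
          case True then show ?thesis by (simp add: h(1) s_def)
        next
          case False
          define a where "a = (h x)\<^sup>2"
          have a: "a > 0" using False by (simp add: a_def)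
          have lim: "(\<lambda>m. 1 - 1 / (1 + a * real m)) \<longlonglongrightarrow> 1 - 0"
          proof (intro tendsto_diff tendsto_const)
            have "filterlim (\<lambda>m. 1 + a * real m) at_top sequentially"
              by (intro filterlim_tendsto_add_at_top[OF tendsto_const] filterlim_tendsto_pos_mult_at_top[OF tendsto_const a] filterlim_real_sequentially)
            then show "(\<lambda>m. 1 / (1 + a * real m)) \<longlonglongrightarrow> 0"
              by (intro real_tendsto_divide_at_top[OF tendsto_const])
          qed
          have "s m (h x) = 1 - 1 / (1 + a * real m)" for m
            using pos[of m "h x"] by (simp add: s_def a_def field_simps)
          then have "(\<lambda>m. f x * s m (h x)) \<longlonglongrightarrow> f x * 1" using lim by (intro tendsto_mult tendsto_const) simp
          then show ?thesis using False by (simp add: h(1))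
        qed
      qed
      show "AE x in lborel. norm (f x * s m (h x)) \<le> norm (f x * indicator X x)" for m
      proof (rule AE_I2)
        fix x
        show "norm (f x * s m (h x)) \<le> norm (f x * indicator X x)"
          using sb[of m "h x"] by (cases "h x = 0") (auto simp: h(1) s_def[of _ 0] abs_mult intro!: mult_left_le)
      qed
      show "(\<lambda>x. f x * s m (h x)) \<in> borel_measurable lborel" for m unfolding s_def by measurable
      show "(\<lambda>x. f x * indicator X x) \<in> borel_measurable lborel" by measurable
    qed
    then show ?thesis using 0[OF tf] i by (simp add: LIMSEQ_const_iff)
  qed
  \<comment> \<open>\<open>ennreal\<close> cuts off negative values, so these densities are the
    positive and the negative part of \<open>f\<close>.\<close>
  define M where "M = density lborel (\<lambda>x. ennreal (f x))"
  define N where "N = density lborel (\<lambda>x. ennreal (- f x))"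
  have Eb: "X \<in> sets borel" if "X \<in> ?E" for X
    using that sigma_sets.Basic[of X ?E UNIV] sigma_sets_test_fun_supports[where 'n='n] by blast
  have MN: "emeasure M X = emeasure N X \<and> emeasure M X \<noteq> \<infinity>" if X: "X \<in> ?E" for X
  proof -
    note [measurable] = Eb[OF X]
    let ?g = "\<lambda>x. f x * indicator X x"
    have g: "integrable lborel ?g" "(\<integral>x. ?g x \<partial>lborel) = 0" using key[OF X] by auto
    have eq: "emeasure M X = (\<integral>\<^sup>+x. ennreal (?g x) \<partial>lborel)" "emeasure N X = (\<integral>\<^sup>+x. ennreal (- ?g x) \<partial>lborel)"
      unfolding M_def N_def by (auto simp: emeasure_density intro!: nn_integral_cong split: split_indicator)
    have fin: "(\<integral>\<^sup>+x. ennreal (?g x) \<partial>lborel) < \<infinity>" "(\<integral>\<^sup>+x. ennreal (- ?g x) \<partial>lborel) < \<infinity>"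
      using g(1) by (auto simp: real_integrable_def less_top)
    have "enn2real (\<integral>\<^sup>+x. ennreal (?g x) \<partial>lborel) = enn2real (\<integral>\<^sup>+x. ennreal (- ?g x) \<partial>lborel)"
      using real_lebesgue_integral_def[OF g(1)] g(2) by simp
    then have "(\<integral>\<^sup>+x. ennreal (?g x) \<partial>lborel) = (\<integral>\<^sup>+x. ennreal (- ?g x) \<partial>lborel)"
      using fin by (metis ennreal_enn2real infinity_ennreal_def)
    then show ?thesis unfolding eq using fin by simp
  qed
  have "M = N"
  proof (rule measure_eqI_generator_eq[where E="?E" and \<Omega>=UNIV and A="\<lambda>n. ball 0 (real (Suc n))"])
    show "Int_stable ?E"
    proof (rule Int_stableI)
      fix X Y assume "X \<in> ?E" "Y \<in> ?E"
      then obtain h1 D1 h2 D2 where "X = {x. h1 x \<noteq> 0}" "test_fun h1 D1" "Y = {x. h2 x \<noteq> 0}" "test_fun h2 D2" by blast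
      then show "X \<inter> Y \<in> ?E" using test_fun_mult[of h1 D1 h2 D2]
        by (auto intro!: exI[of _ "\<lambda>x. h1 x * h2 x"])
    qed
    show rng: "range (\<lambda>n. ball 0 (real (Suc n))) \<subseteq> ?E"
    proof
      fix X assume "X \<in> range (\<lambda>n. ball (0::real^'n) (real (Suc n)))"
      then obtain n where X: "X = ball 0 (real (Suc n))" by blast
      show "X \<in> ?E" unfolding X by (rule ball_in_test_fun_supports) simp
    qed
    show "(\<Union>n. ball 0 (real (Suc n))) = (UNIV :: (real^'n) set)"
    proof safe
      fix x :: "real^'n"
      obtain n :: nat where "norm x < real n" using reals_Archimedean2 by blast
      then have "x \<in> ball 0 (real (Suc n))" by simp
      then show "x \<in> (\<Union>n. ball 0 (real (Suc n)))" by blast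
    qed auto
    show "emeasure M (ball 0 (real (Suc n))) \<noteq> \<infinity>" for n
    proof -
      have "real (Suc n) > 0" by simp
      from MN[OF ball_in_test_fun_supports[OF this]] show ?thesis ..
    qed
    show "emeasure M X = emeasure N X" if "X \<in> ?E" for X using MN[OF that] ..
    show "sets M = sigma_sets UNIV ?E" "sets N = sigma_sets UNIV ?E"
      unfolding M_def N_def sets_density sets_lborel by (rule sigma_sets_test_fun_supports)+
  qed simp
  then have "AE x in lborel. ennreal (f x) = ennreal (- f x)"
    unfolding M_def N_def by (subst (asm) sigma_finite_measure.density_unique_iff[OF sigma_finite_lborel]) auto
  then show ?thesis
  proof eventually_elim
    fix x assume "ennreal (f x) = ennreal (- f x)"
    then show "f x = 0" by (cases "f x \<ge> 0") (auto simp: ennreal_neg ennreal_eq_0_iff)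
  qed
qed

section \<open>Weak derivatives as integrals over segments\<close>

lemma integrable_pair_bound:
  fixes K :: "'a::euclidean_space \<times> 'b::euclidean_space \<Rightarrow> real"
  assumes a: "integrable lborel a" and b: "integrable lborel b" and [measurable]: "K \<in> borel_measurable (lborel \<Otimes>\<^sub>M lborel)"
    and le: "\<And>x s. \<bar>K (x, s)\<bar> \<le> \<bar>a x\<bar> * \<bar>b s\<bar>"
  shows "integrable (lborel \<Otimes>\<^sub>M lborel) K"
proof (rule integrableI_bounded)
  have [measurable]: "a \<in> borel_measurable borel" "b \<in> borel_measurable borel" using a b by auto
  have "(\<integral>\<^sup>+z. ennreal (norm (K z)) \<partial>(lborel \<Otimes>\<^sub>M lborel)) = (\<integral>\<^sup>+x. (\<integral>\<^sup>+s. ennreal (norm (K (x, s))) \<partial>lborel) \<partial>lborel)"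
    by (rule lborel.nn_integral_fst[symmetric]) measurable
  also have "\<dots> \<le> (\<integral>\<^sup>+x. (\<integral>\<^sup>+s. ennreal \<bar>a x\<bar> * ennreal \<bar>b s\<bar> \<partial>lborel) \<partial>lborel)"
    using le by (intro nn_integral_mono) (simp add: ennreal_mult[symmetric] ennreal_leI)
  also have "\<dots> = (\<integral>\<^sup>+x. ennreal \<bar>a x\<bar> * (\<integral>\<^sup>+s. ennreal \<bar>b s\<bar> \<partial>lborel) \<partial>lborel)"
    by (intro nn_integral_cong nn_integral_cmult) measurable
  also have "\<dots> = (\<integral>\<^sup>+x. ennreal \<bar>a x\<bar> \<partial>lborel) * (\<integral>\<^sup>+s. ennreal \<bar>b s\<bar> \<partial>lborel)"
    by (rule nn_integral_multc) measurable
  also have "\<dots> < \<infinity>" using a b by (simp add: integrable_iff_bounded ennreal_mult_less_top)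
  finally show "(\<integral>\<^sup>+z. ennreal (norm (K z)) \<partial>(lborel \<Otimes>\<^sub>M lborel)) < \<infinity>" .
qed measurable

text \<open>Integrating in \<open>x\<close> first undoes the shear by translation; for
  \<open>s\<close> between 0 and 1 the support is displaced by at most
  \<open>norm y\<close>.\<close>

lemma integrable_shear:
  fixes f \<psi> :: "'a::euclidean_space \<Rightarrow> real"
  assumes f: "loc_integrable f" and [measurable]: "\<psi> \<in> borel_measurable borel"
    and \<psi>: "\<And>x. \<bar>\<psi> x\<bar> \<le> C" "\<And>x. R < norm x \<Longrightarrow> \<psi> x = 0"
  shows "integrable (lborel \<Otimes>\<^sub>M lborel) (\<lambda>(x, s). \<psi> x * (indicator {0..1::real} s * f (x + s *\<^sub>R y)))"
proof (rule integrableI_bounded)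
  have fm[measurable]: "f \<in> borel_measurable borel" using f by (rule loc_integrableD)
  have C0: "0 \<le> C" using \<psi>(1)[of 0] abs_ge_zero order_trans by blast
  let ?K = "\<lambda>(x, s). \<psi> x * (indicator {0..1::real} s * f (x + s *\<^sub>R y))"
  let ?b = "\<lambda>x. indicator (cball 0 (R + norm y)) x * f x"
  have cb[measurable]: "cball 0 (R + norm y) \<in> sets (borel :: 'a measure)" by simp
  have "(\<integral>\<^sup>+z. ennreal (norm (?K z)) \<partial>(lborel \<Otimes>\<^sub>M lborel)) =
      (\<integral>\<^sup>+s. (\<integral>\<^sup>+x. ennreal (norm (?K (x, s))) \<partial>lborel) \<partial>lborel)"
    by (rule lborel_pair.nn_integral_snd[symmetric]) measurable
  also have "\<dots> \<le> (\<integral>\<^sup>+s. ennreal C * (\<integral>\<^sup>+x. ennreal \<bar>?b x\<bar> \<partial>lborel) * indicator {0..1::real} s \<partial>lborel)"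
  proof (rule nn_integral_mono)
    fix s :: real
    show "(\<integral>\<^sup>+x. ennreal (norm (?K (x, s))) \<partial>lborel) \<le> ennreal C * (\<integral>\<^sup>+x. ennreal \<bar>?b x\<bar> \<partial>lborel) * indicator {0..1} s"
    proof (cases "s \<in> {0..1}")
      case True
      have "(\<integral>\<^sup>+x. ennreal (norm (?K (x, s))) \<partial>lborel) \<le> (\<integral>\<^sup>+x. ennreal C * ennreal \<bar>?b (x + s *\<^sub>R y)\<bar> \<partial>lborel)"
      proof (rule nn_integral_mono)
        fix x
        have "norm (?K (x, s)) \<le> C * \<bar>?b (x + s *\<^sub>R y)\<bar>"
        proof (cases "norm x \<le> R")
          case nx: True
          have "norm (x + s *\<^sub>R y) \<le> norm x + norm (s *\<^sub>R y)" by (rule norm_triangle_ineq)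
          also have "norm (s *\<^sub>R y) \<le> norm y" using True by (simp add: mult_left_le_one_le)
          finally have "x + s *\<^sub>R y \<in> cball 0 (R + norm y)" using nx by simp
          moreover have "\<bar>\<psi> x\<bar> * \<bar>f (x + s *\<^sub>R y)\<bar> \<le> C * \<bar>f (x + s *\<^sub>R y)\<bar>" by (intro mult_right_mono \<psi>) auto
          ultimately show ?thesis using True by (simp add: abs_mult)
        next
          case False
          then show ?thesis using \<psi>(2) C0 by simp
        qed
        then show "ennreal (norm (?K (x, s))) \<le> ennreal C * ennreal \<bar>?b (x + s *\<^sub>R y)\<bar>"
          using C0 by (simp add: ennreal_mult[symmetric] ennreal_leI)
      qed
      also have "\<dots> = ennreal C * (\<integral>\<^sup>+x. ennreal \<bar>?b (x + s *\<^sub>R y)\<bar> \<partial>lborel)" by (rule nn_integral_cmult) measurable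
      also have "(\<integral>\<^sup>+x. ennreal \<bar>?b (x + s *\<^sub>R y)\<bar> \<partial>lborel) = (\<integral>\<^sup>+x. ennreal \<bar>?b x\<bar> \<partial>lborel)"
        by (rule nn_integral_lborel_translate[of "\<lambda>x. ennreal \<bar>?b x\<bar>"]) measurable
      finally show ?thesis using True by simp
    qed simp
  qed
  also have "\<dots> = ennreal C * (\<integral>\<^sup>+x. ennreal \<bar>?b x\<bar> \<partial>lborel)"
    by (subst nn_integral_cmult_indicator) auto
  also have "\<dots> < \<infinity>" using loc_integrableD(2)[OF f, of "R + norm y"] by (simp add: integrable_iff_bounded ennreal_mult_less_top)
  finally show "(\<integral>\<^sup>+z. ennreal (norm (?K z)) \<partial>(lborel \<Otimes>\<^sub>M lborel)) < \<infinity>" .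
next
  have fm[measurable]: "f \<in> borel_measurable borel" using f by (rule loc_integrableD)
  show "(\<lambda>(x, s). \<psi> x * (indicator {0..1::real} s * f (x + s *\<^sub>R y))) \<in> borel_measurable (lborel \<Otimes>\<^sub>M lborel)" by measurable
qed

text \<open>For test functions the claim is the fundamental theorem of calculus. Duality carries it
  over: the translation is moved onto the test function, and Fubini's theorem exchanges the integral
  over the segment with testing. The exceptional null set may depend on \<open>y\<close>.\<close>

lemma weak_derivative_translation:
  fixes f h :: "real^'n::finite \<Rightarrow> real"
  assumes f: "loc_integrable f" and h: "loc_integrable h"
    and weak: "\<And>\<phi> D. test_fun \<phi> D \<Longrightarrow> (\<integral>x. f x * (D x \<bullet> y) \<partial>lborel) = - (\<integral>x. h x * \<phi> x \<partial>lborel)"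
  shows "AE x in lborel. f (x + y) - f x = (\<integral>s. indicator {0..1::real} s * h (x + s *\<^sub>R y) \<partial>lborel)"
proof -
  define T where "T x = (\<integral>s. indicator {0..1::real} s * h (x + s *\<^sub>R y) \<partial>lborel)" for x
  have [measurable]: "f \<in> borel_measurable borel" "h \<in> borel_measurable borel" using f h by (auto dest: loc_integrableD)
  have Tint: "integrable lborel (\<lambda>x. \<psi> x * T x)"
    if "\<psi> \<in> borel_measurable borel" "\<And>x. \<bar>\<psi> x\<bar> \<le> C" "\<And>x. R < norm x \<Longrightarrow> \<psi> x = 0" for \<psi> C R
    using lborel_pair.integrable_fst'[OF integrable_shear[OF h that, where y=y]] by (simp add: T_def)
  have [measurable]: "T \<in> borel_measurable borel" unfolding T_def by measurable
  have T: "loc_integrable T" unfolding loc_integrable_def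
  proof (intro conjI allI)
    fix R show "integrable lborel (\<lambda>x. indicator (cball 0 R) x * T x)"
      by (rule Tint[where C=1 and R=R]) (auto simp: indicator_def)
  qed simp
  have "AE x in lborel. f (x + y) - f x - T x = 0"
  proof (rule fundamental_lemma_calculus_of_variations)
    show "loc_integrable (\<lambda>x. f (x + y) - f x - T x)"
      by (intro loc_integrable_diff loc_integrable_translate f T)
    fix \<phi> D assume tf: "test_fun \<phi> (D :: real^'n \<Rightarrow> real^'n)"
    obtain R C where C: "0 \<le> C" and R: "\<And>x. R < norm x \<Longrightarrow> \<phi> x = 0" "\<And>x. R < norm x \<Longrightarrow> D x = 0"
      and bC: "\<And>x. \<bar>\<phi> x\<bar> \<le> C" "\<And>x. norm (D x) \<le> C" and cD: "continuous_on UNIV D"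
      and [measurable]: "\<phi> \<in> borel_measurable borel" "D \<in> borel_measurable borel" using test_funE[OF tf] by metis
    have supp: "R < norm (x - s *\<^sub>R y)" if "R + norm y < norm x" "s \<in> {0..1}" for x s
    proof -
      have "norm x \<le> norm (x - s *\<^sub>R y) + norm (s *\<^sub>R y)" using norm_triangle_ineq[of "x - s *\<^sub>R y" "s *\<^sub>R y"] by simp
      moreover have "norm (s *\<^sub>R y) \<le> norm y" using that by (simp add: mult_left_le_one_le)
      ultimately show ?thesis using that by linarith
    qed
    have i1: "integrable lborel (\<lambda>x. f (x + y) * \<phi> x)" 
      by (rule integrable_loc_mult[OF loc_integrable_translate[OF f] _ bC(1) R(1)]) auto
    have i2: "integrable lborel (\<lambda>x. f x * \<phi> x)" by (rule integrable_loc_mult[OF f _ bC(1) R(1)]) auto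
    have i3: "integrable lborel (\<lambda>x. T x * \<phi> x)" by (rule integrable_loc_mult[OF T _ bC(1) R(1)]) auto
    have i4: "integrable lborel (\<lambda>x. f x * \<phi> (x - y))"
      by (rule integrable_loc_mult[where g="\<lambda>x. \<phi> (x - y)" and C=C and R="R + norm y", OF f]) (use supp[of _ 1] R bC in auto)
    have ftc: "(\<integral>s. indicator {0..1::real} s * (D (x - s *\<^sub>R y) \<bullet> y) \<partial>lborel) = \<phi> x - \<phi> (x - y)" for x
    proof -
      have "(\<integral>s. indicator {0..1::real} s *\<^sub>R (D (x - s *\<^sub>R y) \<bullet> y) \<partial>lborel) = - \<phi> (x - 1 *\<^sub>R y) - - \<phi> (x - 0 *\<^sub>R y)"
      proof (rule integral_FTC_Icc)
        fix s :: real
        have "(\<phi> has_derivative (\<lambda>h. D (x - s *\<^sub>R y) \<bullet> h)) (at (x - s *\<^sub>R y))" using tf by (simp add: test_fun_def)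
        then have "((\<lambda>s. \<phi> (x - s *\<^sub>R y)) has_derivative (\<lambda>r. D (x - s *\<^sub>R y) \<bullet> (- (r *\<^sub>R y)))) (at s within {0..1})"
          by (rule has_derivative_compose[rotated]) (auto intro!: derivative_eq_intros)
        from has_derivative_minus[OF this]
        show "((\<lambda>s. - \<phi> (x - s *\<^sub>R y)) has_vector_derivative D (x - s *\<^sub>R y) \<bullet> y) (at s within {0..1})"
          by (simp add: has_vector_derivative_def)
      next
        show "continuous_on {0..1} (\<lambda>s. D (x - s *\<^sub>R y) \<bullet> y)"
          by (intro continuous_on_inner continuous_on_compose2[OF cD]) (auto intro!: continuous_intros)
      qed simp
      then show ?thesis by simp
    qed
    have KI: "integrable (lborel \<Otimes>\<^sub>M lborel) (\<lambda>(x, s). f x * (indicator {0..1::real} s * (D (x - s *\<^sub>R y) \<bullet> y)))"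
    proof (rule integrable_pair_bound)
      show "integrable lborel (\<lambda>x. indicator (cball 0 (R + norm y)) x * f x)" using f by (rule loc_integrableD)
      show "integrable lborel (\<lambda>s. indicator {0..1::real} s * (C * norm y))" by (intro integrable_mult_left) simp
      fix x s
      show "\<bar>case (x, s) of (x, s) \<Rightarrow> f x * (indicator {0..1} s * (D (x - s *\<^sub>R y) \<bullet> y))\<bar>
           \<le> \<bar>indicator (cball 0 (R + norm y)) x * f x\<bar> * \<bar>indicator {0..1} s * (C * norm y)\<bar>"
      proof (cases "s \<in> {0..1} \<and> norm x \<le> R + norm y")
        case True
        have "\<bar>D (x - s *\<^sub>R y) \<bullet> y\<bar> \<le> C * norm y"
          using Cauchy_Schwarz_ineq2[of "D (x - s *\<^sub>R y)" y] mult_right_mono[OF bC(2)[of "x - s *\<^sub>R y"], of "norm y"] by simp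
        then show ?thesis using True C by (simp add: abs_mult mult_left_mono)
      next
        case False
        then show ?thesis using supp[of x s] R(2)[of "x - s *\<^sub>R y"] by (cases "s \<in> {0..1}") auto
      qed
    qed measurable
    have "(\<integral>x. f (x + y) * \<phi> x \<partial>lborel) = (\<integral>x. f x * \<phi> (x - y) \<partial>lborel)"
      using integral_lborel_translate[of "\<lambda>x. f x * \<phi> (x - y)" y] by simp
    then have "(\<integral>x. f (x + y) * \<phi> x \<partial>lborel) - (\<integral>x. f x * \<phi> x \<partial>lborel) = (\<integral>x. f x * \<phi> (x - y) - f x * \<phi> x \<partial>lborel)"
      using i2 i4 by simp
    also have "\<dots> = - (\<integral>x. (\<integral>s. f x * (indicator {0..1::real} s * (D (x - s *\<^sub>R y) \<bullet> y)) \<partial>lborel) \<partial>lborel)"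
      by (simp add: ftc algebra_simps flip: Bochner_Integration.integral_minus)
    also have "\<dots> = - (\<integral>s. (\<integral>x. f x * (indicator {0..1::real} s * (D (x - s *\<^sub>R y) \<bullet> y)) \<partial>lborel) \<partial>lborel)"
      using lborel_pair.Fubini_integral[of "\<lambda>x s. f x * (indicator {0..1::real} s * (D (x - s *\<^sub>R y) \<bullet> y))"] KI by simp
    also have "\<dots> = (\<integral>s. - (\<integral>x. f x * (indicator {0..1::real} s * (D (x - s *\<^sub>R y) \<bullet> y)) \<partial>lborel) \<partial>lborel)"
      by (rule Bochner_Integration.integral_minus[symmetric])
    also have "\<dots> = (\<integral>s. (\<integral>x. \<phi> x * (indicator {0..1::real} s * h (x + s *\<^sub>R y)) \<partial>lborel) \<partial>lborel)"
    proof (rule Bochner_Integration.integral_cong[OF refl])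
      fix s :: real
      \<comment> \<open>For fixed \<open>s\<close> the weak derivative is applied to the test
        function translated along the segment.\<close>
      have "(\<integral>x. f x * (D (x - s *\<^sub>R y) \<bullet> y) \<partial>lborel) = - (\<integral>x. h x * \<phi> (x - s *\<^sub>R y) \<partial>lborel)"
        using weak[OF test_fun_translate[OF tf, of "- s *\<^sub>R y"]] by simp
      also have "(\<integral>x. h x * \<phi> (x - s *\<^sub>R y) \<partial>lborel) = (\<integral>x. h (x + s *\<^sub>R y) * \<phi> x \<partial>lborel)"
        using integral_lborel_translate[of "\<lambda>x. h x * \<phi> (x - s *\<^sub>R y)" "s *\<^sub>R y"] by simp
      finally have "- (\<integral>x. f x * (D (x - s *\<^sub>R y) \<bullet> y) \<partial>lborel) = (\<integral>x. h (x + s *\<^sub>R y) * \<phi> x \<partial>lborel)" by simp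
      then show "- (\<integral>x. f x * (indicator {0..1} s * (D (x - s *\<^sub>R y) \<bullet> y)) \<partial>lborel) =
          (\<integral>x. \<phi> x * (indicator {0..1::real} s * h (x + s *\<^sub>R y)) \<partial>lborel)"
        by (cases "s \<in> {0..1}") (simp_all add: mult.commute)
    qed
    also have "\<dots> = (\<integral>x. (\<integral>s. \<phi> x * (indicator {0..1::real} s * h (x + s *\<^sub>R y)) \<partial>lborel) \<partial>lborel)"
      using lborel_pair.Fubini_integral[of "\<lambda>x s. \<phi> x * (indicator {0..1::real} s * h (x + s *\<^sub>R y))"]
        integrable_shear[OF h _ bC(1) R(1), where y=y] by simp
    also have "\<dots> = (\<integral>x. T x * \<phi> x \<partial>lborel)" by (simp add: T_def mult.commute)
    finally show "(\<integral>x. (f (x + y) - f x - T x) * \<phi> x \<partial>lborel) = 0" using i1 i2 i3 by (simp add: left_diff_distrib)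
  qed
  then show ?thesis by (simp add: T_def)
qed

text \<open>Every translate of a null set is null, and Fubini's theorem exchanges the quantifiers
  over \<open>s\<close> and \<open>x\<close>. A Borel null set containing the exceptional points
  replaces \<open>P\<close>, which need not be measurable.\<close>

lemma AE_line:
  fixes P :: "'a::euclidean_space \<Rightarrow> bool" and e :: 'a
  assumes "AE x in lborel. P x"
  shows "AE x in lborel. AE s in lborel. P (x + s *\<^sub>R e)"
proof -
  obtain N where N: "N \<in> null_sets lborel" "{x. \<not> P x} \<subseteq> N" using assms by (auto simp: eventually_ae_filter)
  then have [measurable]: "N \<in> sets borel" by auto
  have "AE s in lborel. AE x in lborel. x + s *\<^sub>R e \<notin> N"
    using AE_lborel_translate[OF AE_not_in[OF N(1)]] by simp
  moreover have "{z \<in> space (lborel \<Otimes>\<^sub>M lborel). fst z + snd z *\<^sub>R e \<notin> N} \<in> sets (lborel \<Otimes>\<^sub>M lborel)"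
    by measurable
  ultimately have "AE x in lborel. AE s in lborel. x + s *\<^sub>R e \<notin> N"
    using lborel_pair.AE_commute[of "\<lambda>x s. x + s *\<^sub>R e \<notin> N"] by simp
  then show ?thesis by eventually_elim (use N in \<open>auto elim!: eventually_mono\<close>)
qed

section \<open>Borel representatives\<close>

lemma lebesgue_borel_representative:
  fixes f :: "'a::euclidean_space \<Rightarrow> 'b::euclidean_space"
  assumes "f \<in> borel_measurable lebesgue"
  obtains f' where "f' \<in> borel_measurable borel" "AE x in lborel. f x = f' x"
proof -
  have "\<exists>g. g \<in> borel_measurable lborel \<and> (AE x in lborel. f x \<bullet> b = g x)" for b
    using completion_ex_borel_measurable_real[of "\<lambda>x. f x \<bullet> b" lborel] assms by auto
  then obtain g where g: "\<And>b. g b \<in> borel_measurable lborel" "\<And>b. AE x in lborel. f x \<bullet> b = g b x" by metis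
  define f' where "f' x = (\<Sum>b\<in>Basis. g b x *\<^sub>R b)" for x
  have [measurable]: "g b \<in> borel_measurable borel" for b using g by simp
  have m: "f' \<in> borel_measurable borel" unfolding f'_def by measurable
  have "AE x in lborel. \<forall>b\<in>Basis. f x \<bullet> b = g b x" using g(2) by (simp add: AE_ball_countable countable_finite)
  then have "AE x in lborel. f x = f' x"
  proof eventually_elim
    case (elim x)
    have "f x = (\<Sum>b\<in>Basis. (f x \<bullet> b) *\<^sub>R b)" by (simp add: euclidean_representation)
    then show ?case using elim by (simp add: f'_def)
  qed
  with m show ?thesis by (rule that)
qed

text \<open>On balls, \<open>t \<le> 1 + t^2\<close> suffices. The function \<open>p\<close> covers
  components of vectors and entries of matrices alike.\<close>

lemma loc_integrable_L2_loc:
  fixes f :: "real^'n::finite \<Rightarrow> 'b::euclidean_space"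
  assumes L: "L2_loc f" and [measurable]: "f' \<in> borel_measurable borel" and ff': "AE x in lborel. f x = f' x"
    and [measurable]: "p \<in> borel_measurable borel" and p: "\<And>z. \<bar>p z\<bar> \<le> norm (z :: 'b)"
  shows "loc_integrable (\<lambda>x. p (f' x))"
  unfolding loc_integrable_def
proof (intro conjI allI)
  fix R
  have [measurable]: "cball 0 R \<in> sets (borel :: (real^'n) measure)" by simp
  show "integrable lborel (\<lambda>x. indicator (cball 0 R) x * p (f' x))"
  proof (rule integrableI_bounded)
    have fin: "(\<integral>\<^sup>+x\<in>cball 0 R. ennreal ((norm (f x))\<^sup>2) \<partial>lborel) < \<infinity>"
      using L unfolding L2_loc_def nn_integral_completion by auto
    have "(\<integral>\<^sup>+x. ennreal (norm (indicator (cball 0 R) x * p (f' x))) \<partial>lborel) \<le>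
      (\<integral>\<^sup>+x. indicator (cball 0 R) x + ennreal ((norm (f' x))\<^sup>2) * indicator (cball 0 R) x \<partial>lborel)"
    proof (rule nn_integral_mono)
      fix x
      have "2 * norm (f' x) \<le> 1 + (norm (f' x))\<^sup>2" using sum_squares_bound[of 1 "norm (f' x)"] by simp
      then have "\<bar>p (f' x)\<bar> \<le> 1 + (norm (f' x))\<^sup>2" using p[of "f' x"] norm_ge_zero[of "f' x"] by linarith
      then have "ennreal \<bar>p (f' x)\<bar> \<le> 1 + ennreal ((norm (f' x))\<^sup>2)"
        by (metis ennreal_1 ennreal_leI ennreal_plus zero_le_one zero_le_power2)
      then show "ennreal (norm (indicator (cball 0 R) x * p (f' x))) \<le> indicator (cball 0 R) x + ennreal ((norm (f' x))\<^sup>2) * indicator (cball 0 R) x"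
        by (auto simp: indicator_def)
    qed
    also have "\<dots> = emeasure lborel (cball 0 R :: (real^'n) set) + (\<integral>\<^sup>+x\<in>cball 0 R. ennreal ((norm (f' x))\<^sup>2) \<partial>lborel)"
      by (subst nn_integral_add) auto
    also have "(\<integral>\<^sup>+x\<in>cball 0 R. ennreal ((norm (f' x))\<^sup>2) \<partial>lborel) = (\<integral>\<^sup>+x\<in>cball 0 R. ennreal ((norm (f x))\<^sup>2) \<partial>lborel)"
      by (rule nn_integral_cong_AE) (use ff' in \<open>eventually_elim, auto\<close>)
    also have "emeasure lborel (cball 0 R :: (real^'n) set) + \<dots> < \<infinity>" using fin emeasure_bounded_finite[of "cball 0 R :: (real^'n) set"]
      by (simp add: less_top)
    finally show "(\<integral>\<^sup>+x. ennreal (norm (indicator (cball 0 R) x * p (f' x))) \<partial>lborel) < \<infinity>" .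
  qed measurable
qed measurable

section \<open>Lower bound on lines\<close>

lemma integrable_indicator_square:
  fixes g :: "'a::euclidean_space \<Rightarrow> 'b::euclidean_space"
  assumes [measurable]: "g \<in> borel_measurable borel" "A \<in> sets borel" and A: "emeasure lborel A < \<infinity>"
    and g: "(\<integral>\<^sup>+x\<in>A. ennreal ((norm (g x))\<^sup>2) \<partial>lborel) < \<infinity>"
  shows "integrable lborel (\<lambda>x. indicator A x *\<^sub>R g x)"
proof (rule integrableI_bounded)
  have "(\<integral>\<^sup>+x. ennreal (norm (indicator A x *\<^sub>R g x)) \<partial>lborel) \<le>
    (\<integral>\<^sup>+x. indicator A x + ennreal ((norm (g x))\<^sup>2) * indicator A x \<partial>lborel)"
  proof (rule nn_integral_mono)
    fix x
    have "2 * norm (g x) \<le> 1 + (norm (g x))\<^sup>2" using sum_squares_bound[of 1 "norm (g x)"] by simp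
    then have "norm (g x) \<le> 1 + (norm (g x))\<^sup>2" using norm_ge_zero[of "g x"] by linarith
    then have "ennreal (norm (g x)) \<le> 1 + ennreal ((norm (g x))\<^sup>2)"
      by (metis ennreal_1 ennreal_leI ennreal_plus zero_le_one zero_le_power2)
    then show "ennreal (norm (indicator A x *\<^sub>R g x)) \<le> indicator A x + ennreal ((norm (g x))\<^sup>2) * indicator A x"
      by (auto simp: indicator_def)
  qed
  also have "\<dots> = emeasure lborel A + (\<integral>\<^sup>+x\<in>A. ennreal ((norm (g x))\<^sup>2) \<partial>lborel)"
    by (subst nn_integral_add) auto
  also have "\<dots> < \<infinity>" using A g by (simp add: less_top)
  finally show "(\<integral>\<^sup>+x. ennreal (norm (indicator A x *\<^sub>R g x)) \<partial>lborel) < \<infinity>" .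
qed measurable

lemma continuous_on_primitive:
  fixes g :: "real \<Rightarrow> 'a::euclidean_space"
  assumes g: "integrable lborel g"
  shows "continuous_on UNIV (\<lambda>t. \<integral>r. indicator {..t} r *\<^sub>R g r \<partial>lborel)"
proof (rule continuous_at_imp_continuous_on, intro ballI)
  fix t
  have [measurable]: "g \<in> borel_measurable borel" using g by auto
  show "isCont (\<lambda>t. \<integral>r. indicator {..t} r *\<^sub>R g r \<partial>lborel) t"
    unfolding continuous_at_sequentially o_def
  proof (intro allI impI)
    fix X assume X: "X \<longlonglongrightarrow> t"
    show "(\<lambda>n. \<integral>r. indicator {..X n} r *\<^sub>R g r \<partial>lborel) \<longlonglongrightarrow> (\<integral>r. indicator {..t} r *\<^sub>R g r \<partial>lborel)"
    proof (rule integral_dominated_convergence[where w="\<lambda>r. norm (g r)"])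
      show "AE r in lborel. (\<lambda>n. indicator {..X n} r *\<^sub>R g r) \<longlonglongrightarrow> indicator {..t} r *\<^sub>R g r"
        using AE_lborel_singleton[of t]
      proof eventually_elim
        fix r assume r: "r \<noteq> t"
        have "eventually (\<lambda>n. indicator {..X n} r = (indicator {..t} r :: real)) sequentially"
        proof (cases "r < t")
          case True
          from order_tendstoD(1)[OF X True] show ?thesis by eventually_elim (use True in auto)
        next
          case False
          then have "t < r" using r by simp
          from order_tendstoD(2)[OF X this] show ?thesis by eventually_elim (use \<open>t < r\<close> in auto)
        qed
        then have "eventually (\<lambda>n. indicator {..X n} r *\<^sub>R g r = indicator {..t} r *\<^sub>R g r) sequentially"
          by eventually_elim simp
        then show "(\<lambda>n. indicator {..X n} r *\<^sub>R g r) \<longlonglongrightarrow> indicator {..t} r *\<^sub>R g r"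
          by (rule tendsto_eventually)
      qed
    qed (use g in \<open>auto simp: indicator_def\<close>)
  qed
qed

text \<open>Chebyshev's inequality: the set where \<open>w\<close> and \<open>b\<close> differ by at
  least \<epsilon> has finite measure, so it cannot exhaust \<open>A\<close>, even after removal of
  null sets.\<close>

lemma ex_close_arbitrarily_far:
  fixes w b :: "real \<Rightarrow> 'a::euclidean_space"
  assumes [measurable]: "w \<in> borel_measurable borel" "b \<in> borel_measurable borel" "A \<in> sets borel"
    and fin: "(\<integral>\<^sup>+s. ennreal ((norm (w s - b s))\<^sup>2) \<partial>lborel) < \<infinity>" and inf: "emeasure lborel A = \<infinity>"
    and P: "AE s in lborel. P s" and b: "AE s in lborel. s \<in> A \<longrightarrow> dist (b s) l < \<epsilon>" and e: "\<epsilon> > 0"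
  obtains s where "s \<in> A" "P s" "dist (w s) l < 2 * \<epsilon>"
proof -
  define B where "B = {s. \<epsilon> \<le> norm (w s - b s)}"
  have [measurable]: "B \<in> sets borel" unfolding B_def by measurable
  have "ennreal (\<epsilon>\<^sup>2) * emeasure lborel B = (\<integral>\<^sup>+s. ennreal (\<epsilon>\<^sup>2) * indicator B s \<partial>lborel)"
    by (rule nn_integral_cmult_indicator[symmetric]) simp
  also have "\<dots> \<le> (\<integral>\<^sup>+s. ennreal ((norm (w s - b s))\<^sup>2) \<partial>lborel)"
    using e by (intro nn_integral_mono) (auto simp: B_def indicator_def intro!: ennreal_leI power_mono)
  also have "\<dots> < \<infinity>" by (rule fin)
  finally have Bfin: "emeasure lborel B < \<infinity>" using e by (auto simp: ennreal_mult_less_top)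
  have "\<exists>s. s \<in> A \<and> s \<notin> B \<and> P s \<and> dist (b s) l < \<epsilon>"
  proof (rule ccontr)
    assume no: "\<not> ?thesis"
    have "AE s in lborel. s \<in> A \<longrightarrow> s \<in> B" using P b by eventually_elim (use no in auto)
    then have "emeasure lborel A \<le> emeasure lborel B" by (intro emeasure_mono_AE) auto
    then show False using Bfin inf by simp
  qed
  then obtain s where s: "s \<in> A" "s \<notin> B" "P s" "dist (b s) l < \<epsilon>" by blast
  have "dist (w s) l \<le> dist (w s) (b s) + dist (b s) l" by (rule dist_triangle)
  also have "\<dots> < 2 * \<epsilon>" using s by (simp add: B_def dist_norm)
  finally show ?thesis using that s by blast
qed

lemma emeasure_lborel_half_lines: "emeasure lborel {c<..} = \<infinity>" "emeasure lborel {..<c} = \<infinity>" for c :: real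
proof -
  have "ennreal (real n) \<le> emeasure lborel {c<..}" for n
  proof -
    have "ennreal (real n) = emeasure lborel {c<..<c + real n}" by simp
    also have "\<dots> \<le> emeasure lborel {c<..}" by (rule emeasure_mono) auto
    finally show ?thesis .
  qed
  then show "emeasure lborel {c<..} = \<infinity>"
    by (metis ennreal_Ex_less_of_nat ennreal_of_nat_eq_real_of_nat infinity_ennreal_def leD less_top)
  have "ennreal (real n) \<le> emeasure lborel {..<c}" for n
  proof -
    have "ennreal (real n) = emeasure lborel {c - real n<..<c}" by simp
    also have "\<dots> \<le> emeasure lborel {..<c}" by (rule emeasure_mono) auto
    finally show ?thesis .
  qed
  then show "emeasure lborel {..<c} = \<infinity>"
    by (metis ennreal_Ex_less_of_nat ennreal_of_nat_eq_real_of_nat infinity_ennreal_def leD less_top)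
qed

text \<open>A curve need not converge at infinity for its energy to bound the geodesic distance: it suffices
  that it comes arbitrarily close to the end points, where short segments are cheap since \<open>W\<close> is locally bounded.\<close>

lemma geodW_le_line_energy:
  fixes W :: "real^'n::finite \<Rightarrow> real" and w b g :: "real \<Rightarrow> real^'n"
  assumes W: "continuous_on UNIV W" "\<And>z. 0 \<le> W z"
    and [measurable]: "w \<in> borel_measurable borel" "b \<in> borel_measurable borel" "g \<in> borel_measurable borel"
    and wg: "AE p in lborel. AE h in lborel. h > 0 \<longrightarrow> w (p + h) - w p = (\<integral>r. indicator {p..p+h} r *\<^sub>R g r \<partial>lborel)"
    and gfin: "(\<integral>\<^sup>+r. ennreal ((norm (g r))\<^sup>2) \<partial>lborel) < \<infinity>"
    and wb: "(\<integral>\<^sup>+s. ennreal ((norm (w s - b s))\<^sup>2) \<partial>lborel) < \<infinity>"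
    and lim: "ess_lim_bot b um" "ess_lim_top b up"
  shows "geodW W um up \<le> (\<integral>\<^sup>+s. ennreal ((norm (g s))\<^sup>2 / 2 + W (w s)) \<partial>lborel)"
proof (rule ennreal_le_epsilon)
  fix e :: real assume e: "e > 0"
  have [measurable]: "W \<in> borel_measurable borel" using W(1) by (rule borel_measurable_continuous_onI)
  let ?E = "\<integral>\<^sup>+s. ennreal ((norm (g s))\<^sup>2 / 2 + W (w s)) \<partial>lborel"
  define q where "q z = sqrt (2 * W z)" for z
  have q: "continuous_on UNIV q" unfolding q_def by (intro continuous_intros W)
  have q0: "0 \<le> q z" for z using W(2) by (simp add: q_def)
  have "\<exists>M. \<forall>z\<in>cball um 1 \<union> cball up 1. q z \<le> M"
  proof -
    have "compact (q ` (cball um 1 \<union> cball up 1))"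
      by (intro compact_continuous_image continuous_on_subset[OF q] compact_Un) auto
    then show ?thesis using bounded_imp_bdd_above compact_imp_bounded unfolding bdd_above_def by (metis imageI)
  qed
  then obtain M where M: "\<And>z. z \<in> cball um 1 \<union> cball up 1 \<Longrightarrow> q z \<le> M" by blast
  have M0: "0 \<le> M" using M[of um] q0[of um] by auto
  \<comment> \<open>The cap \<open>1/2\<close> keeps the end segments inside the unit balls where
    \<open>M\<close> bounds \<open>q\<close>; the other term makes each of them cost at most
    \<open>e / 4\<close>. A third quarter goes to \<delta> below.\<close>
  define \<epsilon> where "\<epsilon> = min (1/2) (e / (8 * (M + 1)))"
  have \<epsilon>: "\<epsilon> > 0" "2 * \<epsilon> \<le> 1" using e M0 by (auto simp: \<epsilon>_def)
  have Me: "M * (2 * \<epsilon>) \<le> e / 4"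
  proof -
    have "M * (2 * \<epsilon>) \<le> (M + 1) * (2 * \<epsilon>)" using \<epsilon> by (intro mult_right_mono) auto
    also have "\<dots> \<le> (M + 1) * (2 * (e / (8 * (M + 1))))" using M0 by (intro mult_left_mono) (auto simp: \<epsilon>_def)
    also have "\<dots> = e / 4" using M0 by (simp add: field_simps)
    finally show ?thesis .
  qed
  obtain R1 where R1: "AE t in lborel. t \<le> R1 \<longrightarrow> dist (b t) um < \<epsilon>" using lim(1) \<epsilon> unfolding ess_lim_bot_def by blast
  obtain R2 where R2: "AE t in lborel. t \<ge> R2 \<longrightarrow> dist (b t) up < \<epsilon>" using lim(2) \<epsilon> unfolding ess_lim_top_def by blast
  have "AE t in lborel. t \<in> {..<R1} \<longrightarrow> dist (b t) um < \<epsilon>" using R1 by eventually_elim auto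
  \<comment> \<open>The starting point must be good in two respects: close to \<open>um\<close>, and
    outside the null set where the integral formula for increments fails.\<close>
  then obtain p where p: "p \<in> {..<R1}" "AE h in lborel. h > 0 \<longrightarrow> w (p + h) - w p = (\<integral>r. indicator {p..p+h} r *\<^sub>R g r \<partial>lborel)"
      "dist (w p) um < 2 * \<epsilon>"
    using ex_close_arbitrarily_far[of w b "{..<R1}", OF _ _ _ wb _ wg _ \<epsilon>(1)] emeasure_lborel_half_lines by auto
  have wg': "AE t in lborel. t > p \<longrightarrow> w t - w p = (\<integral>r. indicator {p..t} r *\<^sub>R g r \<partial>lborel)"
    using AE_lborel_translate[OF p(2), of "- p"] by simp
  have "AE t in lborel. t \<in> {max p R2<..} \<longrightarrow> dist (b t) up < \<epsilon>" using R2 by eventually_elim auto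
  then obtain t where t: "t \<in> {max p R2<..}" "t > p \<longrightarrow> w t - w p = (\<integral>r. indicator {p..t} r *\<^sub>R g r \<partial>lborel)"
      "dist (w t) up < 2 * \<epsilon>"
    using ex_close_arbitrarily_far[of w b "{max p R2<..}", OF _ _ _ wb _ wg' _ \<epsilon>(1)] emeasure_lborel_half_lines by auto
  have pt: "p < t" using t by auto
  \<comment> \<open>Square integrability yields integrability only on sets of finite measure, hence
    the cut-off.\<close>
  define g1 where "g1 r = indicator {p..t} r *\<^sub>R g r" for r
  have [measurable]: "g1 \<in> borel_measurable borel" unfolding g1_def by measurable
  define I where "I = (\<integral>\<^sup>+r. ennreal (norm (g1 r)) \<partial>lborel)"
  have g1i: "integrable lborel g1" unfolding g1_def
  proof (rule integrable_indicator_square)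
    have "(\<integral>\<^sup>+r\<in>{p..t}. ennreal ((norm (g r))\<^sup>2) \<partial>lborel) \<le> (\<integral>\<^sup>+r. ennreal ((norm (g r))\<^sup>2) \<partial>lborel)"
      by (rule nn_integral_mono) (auto simp: indicator_def)
    then show "(\<integral>\<^sup>+r\<in>{p..t}. ennreal ((norm (g r))\<^sup>2) \<partial>lborel) < \<infinity>" using gfin by (rule order_le_less_trans)
  qed (use pt in auto)
  then have Ifin: "I < \<infinity>" by (simp add: I_def integrable_iff_bounded)
  \<comment> \<open>\<open>v\<close> is the continuous representative of \<open>w\<close> between
    \<open>p\<close> and \<open>t\<close>; it agrees with \<open>w\<close> at both end points and
    almost everywhere between them.\<close>
  define v where "v s = w p + (\<integral>r. indicator {..s} r *\<^sub>R g1 r \<partial>lborel)" for s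
  have vc: "continuous_on UNIV v" unfolding v_def by (intro continuous_intros continuous_on_primitive g1i)
  have [measurable]: "v \<in> borel_measurable borel" using vc by (rule borel_measurable_continuous_onI)
  have ig1: "indicator {..s} r *\<^sub>R g1 r = indicator {p..s} r *\<^sub>R g r" if "s \<le> t" for s r
    using that by (auto simp: g1_def indicator_def)
  have vp: "v p = w p"
  proof -
    have "(\<integral>r. indicator {..p} r *\<^sub>R g1 r \<partial>lborel) = (\<integral>r. (0 :: real^'n) \<partial>(lborel :: real measure))"
    proof (rule Bochner_Integration.integral_cong_AE)
      show "AE r in lborel. indicator {..p} r *\<^sub>R g1 r = 0"
        using AE_lborel_singleton[of p] by eventually_elim (auto simp: g1_def indicator_def)
    qed measurable
    then show ?thesis by (simp add: v_def)
  qed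
  have vt: "v t = w t" using t(2) pt by (simp add: v_def ig1 algebra_simps)
  have vw: "AE s in lborel. s \<in> {p..t} \<longrightarrow> v s = w s"
    using wg' AE_lborel_singleton[of p]
    by eventually_elim (auto simp: v_def ig1 algebra_simps)
  have vd: "ennreal (dist (v c) (v d)) \<le> (\<integral>\<^sup>+r\<in>{c..d}. ennreal (norm (g1 r)) \<partial>lborel)" if "c \<le> d" for c d
  proof -
    have i: "integrable lborel (\<lambda>r. indicator A r *\<^sub>R g1 r)" if "A \<in> sets borel" for A
      using integrable_mult_indicator[OF _ g1i, of A] that by simp
    have "v d - v c = (\<integral>r. indicator {..d} r *\<^sub>R g1 r - indicator {..c} r *\<^sub>R g1 r \<partial>lborel)"
      unfolding v_def by (subst Bochner_Integration.integral_diff) (auto intro!: i)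
    also have "\<dots> = (\<integral>r. indicator {c<..d} r *\<^sub>R g1 r \<partial>lborel)"
      by (rule Bochner_Integration.integral_cong) (use that in \<open>auto simp: indicator_def\<close>)
    finally have "dist (v c) (v d) = norm (\<integral>r. indicator {c<..d} r *\<^sub>R g1 r \<partial>lborel)" by (metis dist_commute dist_norm)
    also have "ennreal \<dots> \<le> (\<integral>\<^sup>+r. ennreal (norm (indicator {c<..d} r *\<^sub>R g1 r)) \<partial>lborel)"
      by (rule integral_norm_bound_ennreal) (rule i, simp)
    also have "\<dots> \<le> (\<integral>\<^sup>+r\<in>{c..d}. ennreal (norm (g1 r)) \<partial>lborel)"
      by (rule nn_integral_mono) (auto simp: indicator_def)
    finally show ?thesis .
  qed
  have seg: "q z \<le> M" if "z \<in> closed_segment um (w p) \<or> z \<in> closed_segment (w t) up" for z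
  proof -
    have "closed_segment um (w p) \<subseteq> cball um 1" "closed_segment (w t) up \<subseteq> cball up 1"
      by (rule closed_segment_subset; use p(3) t(3) \<epsilon> in \<open>simp add: dist_commute\<close>)+
    then show ?thesis using that M by blast
  qed
  obtain I' where I': "I = ennreal I'" "I' \<ge> 0" using Ifin by (cases I) auto
  define \<delta> where "\<delta> = e / (4 * (I' + 1))"
  have \<delta>: "\<delta> > 0" "\<delta> * I' \<le> e / 4" using e I' by (auto simp: \<delta>_def field_simps)
  have "polygonal_cost W UNIV um um 0" by (rule polygonal_cost.start) simp
  then have pc0: "polygonal_cost W UNIV um (v p) (0 + M * dist um (w p))"
    unfolding vp by (rule polygonal_cost.extend) (use M0 seg in \<open>auto simp: q_def\<close>)
  obtain c where c: "polygonal_cost W UNIV um (v t) c"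
    "ennreal c \<le> ennreal (0 + M * dist um (w p)) + (\<integral>\<^sup>+r\<in>{p..t}. ennreal ((sqrt (2 * W (v r)) + \<delta>) * norm (g1 r)) \<partial>lborel)"
    using polygonal_cost_along_curve[OF W vc _ _ _ _ _ pc0 \<delta>(1), where t=t and g="\<lambda>r. norm (g1 r)"] vd pt by auto
  have "(\<integral>\<^sup>+r\<in>{p..t}. ennreal ((sqrt (2 * W (v r)) + \<delta>) * norm (g1 r)) \<partial>lborel) \<le>
      (\<integral>\<^sup>+r. ennreal ((norm (g r))\<^sup>2 / 2 + W (w r)) + ennreal \<delta> * ennreal (norm (g1 r)) \<partial>lborel)"
  proof (rule nn_integral_mono_AE)
    show "AE r in lborel. ennreal ((sqrt (2 * W (v r)) + \<delta>) * norm (g1 r)) * indicator {p..t} r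
        \<le> ennreal ((norm (g r))\<^sup>2 / 2 + W (w r)) + ennreal \<delta> * ennreal (norm (g1 r))"
      using vw
    proof eventually_elim
      fix r assume vr: "r \<in> {p..t} \<longrightarrow> v r = w r"
      show "ennreal ((sqrt (2 * W (v r)) + \<delta>) * norm (g1 r)) * indicator {p..t} r
        \<le> ennreal ((norm (g r))\<^sup>2 / 2 + W (w r)) + ennreal \<delta> * ennreal (norm (g1 r))"
      proof (cases "r \<in> {p..t}")
        case True
        have "(sqrt (2 * W (v r)) + \<delta>) * norm (g1 r) \<le> ((norm (g r))\<^sup>2 / 2 + W (w r)) + \<delta> * norm (g1 r)"
          using sqrt_mult_le_energy[OF W(2)[of "w r"], of "norm (g r)"] vr True by (simp add: g1_def algebra_simps)
        then show ?thesis using True \<delta> W(2)[of "w r"] by (simp add: ennreal_leI flip: ennreal_plus ennreal_mult)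
      qed simp
    qed
  qed
  also have "\<dots> = ?E + ennreal \<delta> * I" unfolding I_def
    by (subst nn_integral_add) (auto simp: nn_integral_cmult)
  also have "ennreal \<delta> * I = ennreal (\<delta> * I')" using \<delta> I' by (simp add: ennreal_mult)
  also have "?E + ennreal (\<delta> * I') \<le> ?E + ennreal (e / 4)" using \<delta> by (intro add_left_mono ennreal_leI)
  finally have B1: "(\<integral>\<^sup>+r\<in>{p..t}. ennreal ((sqrt (2 * W (v r)) + \<delta>) * norm (g1 r)) \<partial>lborel) \<le> ?E + ennreal (e / 4)" .
  have "M * dist um (w p) \<le> M * (2 * \<epsilon>)" using p M0 by (intro mult_left_mono) (auto simp: dist_commute)
  then have B0: "ennreal (0 + M * dist um (w p)) \<le> ennreal (e / 4)" using Me by (intro ennreal_leI) auto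
  have B2: "M * dist (w t) up \<le> e / 4"
  proof -
    have "M * dist (w t) up \<le> M * (2 * \<epsilon>)" using t M0 by (intro mult_left_mono) auto
    then show ?thesis using Me by simp
  qed
  have pc: "polygonal_cost W UNIV um up (c + M * dist (w t) up)"
    using c(1) unfolding vt by (rule polygonal_cost.extend) (use M0 seg in \<open>auto simp: q_def\<close>)
  have "geodW W um up \<le> ennreal (c + M * dist (w t) up)" by (rule geodW_le_polygonal_cost[OF pc W])
  also have "\<dots> \<le> ennreal (c + e / 4)" using B2 by (intro ennreal_leI) auto
  also have "\<dots> = ennreal c + ennreal (e / 4)" using polygonal_cost_nonneg[OF c(1)] e by (intro ennreal_plus) auto
  also have "ennreal c \<le> ennreal (e / 4) + (?E + ennreal (e / 4))" by (rule order_trans[OF c(2) add_mono[OF B0 B1]])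
  also have "ennreal (e / 4) + (?E + ennreal (e / 4)) + ennreal (e / 4) = ?E + (ennreal (e / 4) + ennreal (e / 4) + ennreal (e / 4))"
    by (simp add: ac_simps)
  also have "ennreal (e / 4) + ennreal (e / 4) + ennreal (e / 4) = ennreal (3 * e / 4)"
    using e by (simp flip: ennreal_plus)
  also have "?E + ennreal (3 * e / 4) \<le> ?E + ennreal e" using e by (intro add_left_mono ennreal_leI) auto
  finally show "geodW W um up \<le> ?E + ennreal e" by simp
qed

section \<open>Poincare inequality on the strip\<close>

text \<open>Cauchy-Schwarz on a set of measure one, where subtracting \<open>c\<close> commutes with
  averaging. If the right-hand side is infinite, nothing is to be shown; otherwise its finiteness
  yields the integrability that the averages need.\<close>

lemma jensen_square:
  fixes f :: "'a::euclidean_space \<Rightarrow> 'b::euclidean_space"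
  assumes [measurable]: "f \<in> borel_measurable borel" "Q \<in> sets borel" and Q: "emeasure lborel Q = 1"
  shows "ennreal ((norm ((\<integral>y. indicator Q y *\<^sub>R f y \<partial>lborel) - c))\<^sup>2) \<le> (\<integral>\<^sup>+y\<in>Q. ennreal ((norm (f y - c))\<^sup>2) \<partial>lborel)"
proof (cases "(\<integral>\<^sup>+y\<in>Q. ennreal ((norm (f y - c))\<^sup>2) \<partial>lborel) < \<infinity>")
  case True
  have mQ: "measure lborel Q = 1" using Q by (simp add: measure_def)
  have int: "integrable lborel (\<lambda>y. indicator Q y *\<^sub>R (f y - c))"
    by (rule integrable_indicator_square) (use True Q in auto)
  have intc: "integrable lborel (\<lambda>y. indicator Q y *\<^sub>R c)"
    using Q by (intro integrable_scaleR_left integrable_real_indicator) auto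
  have "(\<integral>y. indicator Q y *\<^sub>R f y \<partial>lborel) = (\<integral>y. indicator Q y *\<^sub>R (f y - c) + indicator Q y *\<^sub>R c \<partial>lborel)"
    by (rule Bochner_Integration.integral_cong) (auto simp: algebra_simps)
  also have "\<dots> = (\<integral>y. indicator Q y *\<^sub>R (f y - c) \<partial>lborel) + c"
  proof -
    have "(\<integral>y. indicator Q y *\<^sub>R c \<partial>lborel) = (\<integral>y. indicator Q y \<partial>lborel) *\<^sub>R c"
      using Q by (intro integral_scaleR_left integrable_real_indicator) auto
    then have "(\<integral>y. indicator Q y *\<^sub>R c \<partial>lborel) = c" by (simp add: mQ)
    then show ?thesis by (subst Bochner_Integration.integral_add[OF int intc]) simp
  qed
  finally have "norm ((\<integral>y. indicator Q y *\<^sub>R f y \<partial>lborel) - c) = norm (\<integral>y. indicator Q y *\<^sub>R (f y - c) \<partial>lborel)" by simp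
  also have "ennreal \<dots> \<le> (\<integral>\<^sup>+y. ennreal (norm (indicator Q y *\<^sub>R (f y - c))) \<partial>lborel)"
    by (rule integral_norm_bound_ennreal[OF int])
  also have "\<dots> = (\<integral>\<^sup>+y. indicator Q y * (ennreal (norm (f y - c)) * indicator Q y) \<partial>lborel)"
    by (rule nn_integral_cong) (auto simp: indicator_def)
  finally have "(ennreal (norm ((\<integral>y. indicator Q y *\<^sub>R f y \<partial>lborel) - c)))\<^sup>2 \<le> (\<integral>\<^sup>+y. indicator Q y * (ennreal (norm (f y - c)) * indicator Q y) \<partial>lborel)\<^sup>2"
    by (rule power_mono) simp
  also have "\<dots> \<le> (\<integral>\<^sup>+y. (indicator Q y)\<^sup>2 \<partial>lborel) * (\<integral>\<^sup>+y. (ennreal (norm (f y - c)) * indicator Q y)\<^sup>2 \<partial>lborel)"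
    by (rule Cauchy_Schwarz_nn_integral) measurable
  also have "(\<integral>\<^sup>+y. (indicator Q y)\<^sup>2 \<partial>lborel) = (\<integral>\<^sup>+y. indicator Q y \<partial>lborel)"
    by (rule nn_integral_cong) (auto simp: indicator_def)
  also have "(\<integral>\<^sup>+y. (ennreal (norm (f y - c)) * indicator Q y)\<^sup>2 \<partial>lborel) = (\<integral>\<^sup>+y\<in>Q. ennreal ((norm (f y - c))\<^sup>2) \<partial>lborel)"
    by (rule nn_integral_cong) (auto simp: indicator_def ennreal_power)
  finally show ?thesis using Q by (simp add: ennreal_power)
next
  case False
  then have "(\<integral>\<^sup>+y\<in>Q. ennreal ((norm (f y - c))\<^sup>2) \<partial>lborel) = top"
    by (metis infinity_ennreal_def top.not_eq_extremum)
  then show ?thesis by simp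
qed

section \<open>Differences transversal to the distinguished direction\<close>

definition off :: "'n::finite \<Rightarrow> real^'n \<Rightarrow> real^'n" where
  "off k z = (\<chi> i. if i = k then 0 else z $ i)"

lemma off_nth: "off k z $ i = (if i = k then 0 else z $ i)" by (simp add: off_def)

lemma norm_off_le: "norm (off k z) \<le> norm z"
  by (rule norm_le_componentwise_cart) (simp add: off_nth)

lemma off_borel [measurable]: "off (k :: 'n::finite) \<in> borel_measurable borel"
proof (rule borel_measurable_continuous_onI)
  show "continuous_on UNIV (off k)" unfolding off_def
  proof (rule continuous_on_vec_lambda)
    fix i show "continuous_on UNIV (\<lambda>z :: real^'n. if i = k then 0 else z $ i)"
      by (cases "i = k") (simp_all add: continuous_on_component)
  qed
qed

text \<open>The second index of the gradient is the direction of differentiation, so omitting column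
  \<open>k\<close> leaves exactly the squares of the transversal derivatives.\<close>

definition grad_off :: "'n::finite \<Rightarrow> real^'n^'m::finite \<Rightarrow> real" where
  "grad_off k A = (\<Sum>i\<in>UNIV. \<Sum>j\<in>-{k}. (A $ i $ j)\<^sup>2)"

lemma grad_off_nonneg: "0 \<le> grad_off k A" by (simp add: grad_off_def sum_nonneg)

lemma grad_off_borel [measurable]: "grad_off k \<in> borel_measurable borel"
  unfolding grad_off_def by measurable

lemma norm_matrix_split: "(norm A)\<^sup>2 = (norm (A *v axis k 1))\<^sup>2 + grad_off k A" for A :: "real^'n::finite^'n"
proof -
  have "(A *v axis k 1) $ i = A $ i $ k" for i by (simp add: matrix_vector_mult_basis column_def)
  then have "(norm (A *v axis k 1))\<^sup>2 = (\<Sum>i\<in>UNIV. (A $ i $ k)\<^sup>2)"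
    by (simp add: norm_vec_def L2_set_def sum_nonneg)
  moreover have "(\<Sum>j\<in>UNIV. (A $ i $ j)\<^sup>2) = (A $ i $ k)\<^sup>2 + (\<Sum>j\<in>-{k}. (A $ i $ j)\<^sup>2)" for i
    by (simp add: sum.remove[of UNIV k] Compl_eq_Diff_UNIV)
  ultimately show ?thesis by (simp add: norm_matrix_power2 grad_off_def sum.distrib)
qed

lemma norm_matrix_vector_off_le:
  fixes A :: "real^'n::finite^'n"
  assumes "z $ k = 0"
  shows "(norm (A *v z))\<^sup>2 \<le> (norm z)\<^sup>2 * grad_off k A"
proof -
  have "((A *v z) $ i)\<^sup>2 \<le> (norm z)\<^sup>2 * (\<Sum>j\<in>-{k}. (A $ i $ j)\<^sup>2)" for i
  proof -
    have "(A *v z) $ i = (\<Sum>j\<in>-{k}. A $ i $ j * z $ j)"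
      unfolding matrix_vector_mult_def using assms by (simp add: sum.remove[of UNIV k] Compl_eq_Diff_UNIV)
    then have "((A *v z) $ i)\<^sup>2 \<le> (\<Sum>j\<in>-{k}. (A $ i $ j)\<^sup>2) * (\<Sum>j\<in>-{k}. (z $ j)\<^sup>2)"
      by (simp add: Cauchy_Schwarz_ineq_sum)
    also have "\<dots> \<le> (\<Sum>j\<in>-{k}. (A $ i $ j)\<^sup>2) * (norm z)\<^sup>2"
    proof (rule mult_left_mono)
      have "(\<Sum>j\<in>-{k}. (z $ j)\<^sup>2) \<le> (\<Sum>j\<in>UNIV. (z $ j)\<^sup>2)" by (rule sum_mono2) auto
      then show "(\<Sum>j\<in>-{k}. (z $ j)\<^sup>2) \<le> (norm z)\<^sup>2" by (simp add: norm_vec_def L2_set_def sum_nonneg)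
    qed (simp add: sum_nonneg)
    finally show ?thesis by (simp add: mult.commute)
  qed
  then have "(\<Sum>i\<in>UNIV. ((A *v z) $ i)\<^sup>2) \<le> (\<Sum>i\<in>UNIV. (norm z)\<^sup>2 * (\<Sum>j\<in>-{k}. (A $ i $ j)\<^sup>2))"
    by (intro sum_mono) auto
  moreover have "(norm (A *v z))\<^sup>2 = (\<Sum>i\<in>UNIV. ((A *v z) $ i)\<^sup>2)" by (simp add: norm_vec_def L2_set_def sum_nonneg)
  ultimately show ?thesis by (simp add: grad_off_def sum_distrib_left)
qed

text \<open>Later arguments use the weak gradient only in this form. The quantifier over
  \<open>y\<close> stands outside the almost-everywhere statement because the null set may depend on
  \<open>y\<close>; both functions are Borel so that Fubini's theorem can restrict them to
  lines.\<close>

definition line_integral_formula :: "(real^'n::finite \<Rightarrow> real^'n) \<Rightarrow> (real^'n \<Rightarrow> real^'n^'n) \<Rightarrow> bool" where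
  "line_integral_formula v H \<longleftrightarrow> v \<in> borel_measurable borel \<and> H \<in> borel_measurable borel \<and>
    (\<forall>y i. AE x in lborel. v (x + y) $ i - v x $ i = (\<integral>s. indicator {0..1::real} s * (H (x + s *\<^sub>R y) *v y) $ i \<partial>lborel))"

lemma matrix_vector_mult_borel:
  fixes y :: "real^'n::finite"
  shows "(\<lambda>A :: real^'n^'m::finite. A *v y) \<in> borel_measurable borel"
  unfolding matrix_vector_mult_def
  by (intro borel_measurable_continuous_onI continuous_on_vec_lambda) (intro continuous_intros)

text \<open>Jensen's inequality along the segment; with \<open>z $ k = 0\<close> only columns other
  than \<open>k\<close> of the gradient contribute.\<close>

lemma difference_square_le:
  fixes v :: "real^'n::finite \<Rightarrow> real^'n"
  assumes F: "line_integral_formula v H" and z: "z $ k = 0"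
  shows "AE x in lborel. ennreal ((norm (v (x + z) - v x))\<^sup>2) \<le>
    (\<integral>\<^sup>+s\<in>{0..1::real}. ennreal ((norm z)\<^sup>2) * ennreal (grad_off k (H (x + s *\<^sub>R z))) \<partial>lborel)"
proof -
  have [measurable]: "v \<in> borel_measurable borel" "H \<in> borel_measurable borel" 
    "(\<lambda>A :: real^'n^'n. A *v z) \<in> borel_measurable borel"
    using F by (auto simp: line_integral_formula_def matrix_vector_mult_borel)
  have "AE x in lborel. \<forall>i. v (x + z) $ i - v x $ i = (\<integral>s. indicator {0..1::real} s * (H (x + s *\<^sub>R z) *v z) $ i \<partial>lborel)"
    using F unfolding line_integral_formula_def by (simp add: AE_all_countable)
  then show ?thesis
  proof eventually_elim
    case (elim x)
    let ?q = "\<lambda>s. H (x + s *\<^sub>R z) *v z"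
    have [measurable]: "?q \<in> borel_measurable borel" by measurable
    have "ennreal ((norm (v (x + z) - v x))\<^sup>2) = (\<Sum>i\<in>UNIV. ennreal ((v (x + z) $ i - v x $ i)\<^sup>2))"
      by (simp add: norm_vec_def L2_set_def sum_nonneg sum_ennreal)
    also have "\<dots> \<le> (\<Sum>i\<in>UNIV. \<integral>\<^sup>+s. ennreal ((?q s $ i)\<^sup>2) * indicator {0..1} s \<partial>lborel)"
    proof (rule sum_mono)
      fix i
      show "ennreal ((v (x + z) $ i - v x $ i)\<^sup>2) \<le> (\<integral>\<^sup>+s\<in>{0..1}. ennreal ((?q s $ i)\<^sup>2) \<partial>lborel)"
        using jensen_square[of "\<lambda>s. ?q s $ i" "{0..1::real}" 0] elim by simp
    qed
    also have "\<dots> = (\<integral>\<^sup>+s. (\<Sum>i\<in>UNIV. ennreal ((?q s $ i)\<^sup>2) * indicator {0..1} s) \<partial>lborel)"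
      by (rule nn_integral_sum[symmetric]) measurable
    also have "\<dots> \<le> (\<integral>\<^sup>+s\<in>{0..1::real}. ennreal ((norm z)\<^sup>2) * ennreal (grad_off k (H (x + s *\<^sub>R z))) \<partial>lborel)"
    proof (rule nn_integral_mono)
      fix s
      have "(\<Sum>i\<in>UNIV. ennreal ((?q s $ i)\<^sup>2)) = ennreal ((norm (?q s))\<^sup>2)"
        by (simp add: norm_vec_def L2_set_def sum_nonneg sum_ennreal)
      also have "\<dots> \<le> ennreal ((norm z)\<^sup>2) * ennreal (grad_off k (H (x + s *\<^sub>R z)))"
        using norm_matrix_vector_off_le[OF z] by (simp add: ennreal_leI flip: ennreal_mult')
      finally show "(\<Sum>i\<in>UNIV. ennreal ((?q s $ i)\<^sup>2) * indicator {0..1} s) \<le>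
          ennreal ((norm z)\<^sup>2) * ennreal (grad_off k (H (x + s *\<^sub>R z))) * indicator {0..1} s"
        by (simp add: sum_distrib_right[symmetric] mult_right_mono)
    qed
    finally show ?case .
  qed
qed

lemma strip_difference_le:
  fixes v :: "real^'n::finite \<Rightarrow> real^'n"
  assumes F: "line_integral_formula v H" and z: "z $ k = 0"
  shows "(\<integral>\<^sup>+x\<in>strip k. (indicator (strip k) (x + z) * ennreal ((norm (v (x + z) - v x))\<^sup>2)) \<partial>lborel) \<le>
    ennreal ((norm z)\<^sup>2) * (\<integral>\<^sup>+x\<in>strip k. ennreal (grad_off k (H x)) \<partial>lborel)"
proof -
  have [measurable]: "H \<in> borel_measurable borel" using F by (auto simp: line_integral_formula_def)
  let ?D = "\<lambda>x. ennreal (grad_off k (H x))"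
  have "(\<integral>\<^sup>+x\<in>strip k. (indicator (strip k) (x + z) * ennreal ((norm (v (x + z) - v x))\<^sup>2)) \<partial>lborel) \<le>
    (\<integral>\<^sup>+x. (\<integral>\<^sup>+s. ennreal ((norm z)\<^sup>2) * indicator {0..1::real} s * (?D (x + s *\<^sub>R z) * indicator (strip k) (x + s *\<^sub>R z)) \<partial>lborel) \<partial>lborel)"
  proof (rule nn_integral_mono_AE)
    show "AE x in lborel. indicator (strip k) (x + z) * ennreal ((norm (v (x + z) - v x))\<^sup>2) * indicator (strip k) x \<le>
      (\<integral>\<^sup>+s. ennreal ((norm z)\<^sup>2) * indicator {0..1::real} s * (?D (x + s *\<^sub>R z) * indicator (strip k) (x + s *\<^sub>R z)) \<partial>lborel)"
      using difference_square_le[OF F z]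
    proof eventually_elim
      case (elim x)
      show ?case
      proof (cases "x \<in> strip k \<and> x + z \<in> strip k")
        case True
        \<comment> \<open>The strip is convex, so the whole segment stays inside and the indicator
          may be inserted under the integral.\<close>
        have cs: "x + s *\<^sub>R z \<in> strip k" if "s \<in> {0..1}" for s
          unfolding strip_def
        proof (intro CollectI allI impI)
          fix i assume "i \<noteq> k"
          then have *: "0 \<le> x $ i" "x $ i \<le> 1" "0 \<le> x $ i + z $ i" "x $ i + z $ i \<le> 1" using True by (auto simp: strip_def)
          have e: "(x + s *\<^sub>R z) $ i = (1 - s) * x $ i + s * (x $ i + z $ i)" by (simp add: algebra_simps)
          show "0 \<le> (x + s *\<^sub>R z) $ i \<and> (x + s *\<^sub>R z) $ i \<le> 1"
            unfolding e using * that convex_bound_le[of "x $ i" 1 "x $ i + z $ i" "1 - s" s] by auto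
        qed
        have "(\<integral>\<^sup>+s\<in>{0..1::real}. ennreal ((norm z)\<^sup>2) * ?D (x + s *\<^sub>R z) \<partial>lborel) =
          (\<integral>\<^sup>+s. ennreal ((norm z)\<^sup>2) * indicator {0..1::real} s * (?D (x + s *\<^sub>R z) * indicator (strip k) (x + s *\<^sub>R z)) \<partial>lborel)"
          by (rule nn_integral_cong) (auto simp: indicator_def cs)
        then show ?thesis using elim True by simp
      qed auto
    qed
  qed
  also have "\<dots> = (\<integral>\<^sup>+s. (\<integral>\<^sup>+x. ennreal ((norm z)\<^sup>2) * indicator {0..1::real} s * (?D (x + s *\<^sub>R z) * indicator (strip k) (x + s *\<^sub>R z)) \<partial>lborel) \<partial>lborel)"
    by (rule lborel_pair.Fubini') measurable
  also have "\<dots> = (\<integral>\<^sup>+s. ennreal ((norm z)\<^sup>2) * (\<integral>\<^sup>+x\<in>strip k. ?D x \<partial>lborel) * indicator {0..1::real} s \<partial>lborel)"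
  proof (rule nn_integral_cong)
    fix s :: real
    have "(\<integral>\<^sup>+x. ennreal ((norm z)\<^sup>2) * indicator {0..1::real} s * (?D (x + s *\<^sub>R z) * indicator (strip k) (x + s *\<^sub>R z)) \<partial>lborel)
      = ennreal ((norm z)\<^sup>2) * indicator {0..1::real} s * (\<integral>\<^sup>+x. ?D (x + s *\<^sub>R z) * indicator (strip k) (x + s *\<^sub>R z) \<partial>lborel)"
      by (rule nn_integral_cmult) measurable
    also have "(\<integral>\<^sup>+x. ?D (x + s *\<^sub>R z) * indicator (strip k) (x + s *\<^sub>R z) \<partial>lborel) = (\<integral>\<^sup>+x\<in>strip k. ?D x \<partial>lborel)"
      by (rule nn_integral_lborel_translate[of "\<lambda>x. ?D x * indicator (strip k) x"]) measurable
    finally show "(\<integral>\<^sup>+x. ennreal ((norm z)\<^sup>2) * indicator {0..1::real} s * (?D (x + s *\<^sub>R z) * indicator (strip k) (x + s *\<^sub>R z)) \<partial>lborel)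
      = ennreal ((norm z)\<^sup>2) * (\<integral>\<^sup>+x\<in>strip k. ?D x \<partial>lborel) * indicator {0..1::real} s" by (simp add: ac_simps)
  qed
  also have "\<dots> = ennreal ((norm z)\<^sup>2) * (\<integral>\<^sup>+x\<in>strip k. ?D x \<partial>lborel)"
    by (subst nn_integral_cmult_indicator) auto
  finally show ?thesis .
qed


text \<open>This is \<open>ubar\<close> for a Borel representative: the point at level
  \<open>t\<close> over \<open>y\<close> is written through \<open>off\<close>, which makes
  measurability in \<open>t\<close> evident.\<close>

definition slice_mean :: "'n::finite \<Rightarrow> (real^'n \<Rightarrow> real^'n) \<Rightarrow> real \<Rightarrow> real^'n" where
  "slice_mean k v t = (\<integral>y. indicator (cbox 0 1) y *\<^sub>R v (off k y + t *\<^sub>R axis k 1) \<partial>lborel)"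

lemma slice_mean_borel [measurable]:
  assumes [measurable]: "v \<in> borel_measurable borel"
  shows "slice_mean k v \<in> borel_measurable borel"
  unfolding slice_mean_def by measurable

text \<open>Segments between points of the strip on the same level stay in the strip, hence the gradient
  on the strip controls all differences.  The points \<open>z\<close> range over a cube that contains all
  differences of points of the unit cube, which recovers the average over the torus.\<close>

lemma strip_poincare:
  fixes k :: "'n::finite"
  obtains C :: real where "0 \<le> C"
    "\<And>v H. line_integral_formula v H \<Longrightarrow>
      (\<integral>\<^sup>+x\<in>strip k. ennreal ((norm (slice_mean k v (x $ k) - v x))\<^sup>2) \<partial>lborel)
      \<le> ennreal C * (\<integral>\<^sup>+x\<in>strip k. ennreal (grad_off k (H x)) \<partial>lborel)"
proof -
  let ?Z = "cbox (-1) (1 :: real^'n)"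
  obtain B where B: "\<And>z. z \<in> ?Z \<Longrightarrow> norm z \<le> B" using bounded_cbox[of "-1" "1 :: real^'n"] unfolding bounded_iff by blast
  define C where "C = B\<^sup>2 * measure lborel ?Z"
  have "0 \<le> C" by (simp add: C_def)
  moreover have "(\<integral>\<^sup>+x\<in>strip k. ennreal ((norm (slice_mean k v (x $ k) - v x))\<^sup>2) \<partial>lborel)
      \<le> ennreal C * (\<integral>\<^sup>+x\<in>strip k. ennreal (grad_off k (H x)) \<partial>lborel)"
    if F: "line_integral_formula v H" for v H
  proof -
    have [measurable]: "v \<in> borel_measurable borel" "H \<in> borel_measurable borel" using F by (auto simp: line_integral_formula_def)
    let ?K = "\<integral>\<^sup>+x\<in>strip k. ennreal (grad_off k (H x)) \<partial>lborel"
    let ?d = "\<lambda>x z. indicator (strip k) (x + off k z) * ennreal ((norm (v (x + off k z) - v x))\<^sup>2) * indicator (strip k) x * indicator ?Z z"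
    have inner: "ennreal ((norm (slice_mean k v (x $ k) - v x))\<^sup>2) * indicator (strip k) x
        \<le> (\<integral>\<^sup>+z. ?d x z \<partial>lborel)" for x
    proof (cases "x \<in> strip k")
      case True
      have x01: "0 \<le> x $ i" "x $ i \<le> 1" if "i \<noteq> k" for i using True that by (auto simp: strip_def)
      have "ennreal ((norm (slice_mean k v (x $ k) - v x))\<^sup>2)
        \<le> (\<integral>\<^sup>+y\<in>cbox 0 1. ennreal ((norm (v (off k y + x $ k *\<^sub>R axis k 1) - v x))\<^sup>2) \<partial>lborel)"
        unfolding slice_mean_def by (rule jensen_square) (auto simp: emeasure_unit_cbox)
      \<comment> \<open>Substitution \<open>z = y - off k x\<close>: then \<open>x + off k z\<close>
        is the point at level \<open>x $ k\<close> over \<open>y\<close>.\<close>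
      also have "\<dots> \<le> (\<integral>\<^sup>+y. ?d x (y + (- off k x)) \<partial>lborel)"
      proof (rule nn_integral_mono)
        fix y :: "real^'n"
        show "ennreal ((norm (v (off k y + x $ k *\<^sub>R axis k 1) - v x))\<^sup>2) * indicator (cbox 0 1) y \<le> ?d x (y + (- off k x))"
        proof (cases "y \<in> cbox 0 1")
          case y: True
          then have y01: "0 \<le> y $ i" "y $ i \<le> 1" for i by (auto simp: mem_box_cart)
          have 1: "x + off k (y + (- off k x)) = off k y + x $ k *\<^sub>R axis k 1"
            by (simp add: vec_eq_iff off_nth axis_def)
          have 2: "off k y + x $ k *\<^sub>R axis k 1 \<in> strip k" unfolding strip_def using y01 by (simp add: off_nth axis_def)
          have 3: "y + (- off k x) \<in> ?Z" unfolding mem_box_cart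
          proof
            fix i show "(-1 :: real^'n) $ i \<le> (y + - off k x) $ i \<and> (y + - off k x) $ i \<le> (1 :: real^'n) $ i"
              using y01[of i] x01[of i] by (cases "i = k") (auto simp: off_nth)
          qed
          show ?thesis using 2 3 True y by (simp add: 1 del: add_uminus_conv_diff)
        qed simp
      qed
      also have "\<dots> = (\<integral>\<^sup>+z. ?d x z \<partial>lborel)" by (rule nn_integral_lborel_translate) measurable
      finally show ?thesis using True by simp
    qed simp
    have "(\<integral>\<^sup>+x\<in>strip k. ennreal ((norm (slice_mean k v (x $ k) - v x))\<^sup>2) \<partial>lborel)
      \<le> (\<integral>\<^sup>+x. (\<integral>\<^sup>+z. ?d x z \<partial>lborel) \<partial>lborel)" using inner by (rule nn_integral_mono)
    also have "\<dots> = (\<integral>\<^sup>+z. (\<integral>\<^sup>+x. ?d x z \<partial>lborel) \<partial>lborel)" by (rule lborel_pair.Fubini') measurable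
    also have "\<dots> \<le> (\<integral>\<^sup>+z. ennreal (B\<^sup>2) * ?K * indicator ?Z z \<partial>lborel)"
    proof (rule nn_integral_mono)
      fix z :: "real^'n"
      show "(\<integral>\<^sup>+x. ?d x z \<partial>lborel) \<le> ennreal (B\<^sup>2) * ?K * indicator ?Z z"
      proof (cases "z \<in> ?Z")
        case True
        have "(\<integral>\<^sup>+x. ?d x z \<partial>lborel) \<le> ennreal ((norm (off k z))\<^sup>2) * ?K"
          using strip_difference_le[OF F, of "off k z" k] True by (simp add: off_nth)
        also have "\<dots> \<le> ennreal (B\<^sup>2) * ?K"
          using order_trans[OF norm_off_le B[OF True]] by (intro mult_right_mono ennreal_leI power_mono) auto
        finally show ?thesis using True by simp
      qed simp
    qed
    also have "\<dots> = ennreal (B\<^sup>2) * ?K * emeasure lborel ?Z" by (rule nn_integral_cmult_indicator) simp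
    also have "emeasure lborel ?Z = ennreal (measure lborel ?Z)" 
      by (rule emeasure_eq_ennreal_measure) (simp add: emeasure_lborel_cbox_eq)
    also have "ennreal (B\<^sup>2) * ?K * ennreal (measure lborel ?Z) = ennreal C * ?K"
      by (simp add: C_def ennreal_mult ac_simps)
    finally show ?thesis .
  qed
  ultimately show ?thesis by (rule that)
qed

section \<open>Lower bound on the strip\<close>

lemma integral_lebesgue_eq_lborel_AE:
  fixes f g :: "'a::euclidean_space \<Rightarrow> 'b::euclidean_space"
  assumes g: "g \<in> borel_measurable borel" and fg: "AE x in lborel. f x = g x"
  shows "(\<integral>x. f x \<partial>lebesgue) = (\<integral>x. g x \<partial>lborel)"
proof -
  have fg': "AE x in lebesgue. f x = g x" using fg by (rule AE_completion)
  have gm: "g \<in> borel_measurable lebesgue" using g by (simp add: measurable_completion)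
  have "AE x in lebesgue. g x = f x" using fg' by eventually_elim simp
  then have "f \<in> borel_measurable lebesgue" by (rule borel_measurable_AE[OF gm])
  then have "(\<integral>x. f x \<partial>lebesgue) = (\<integral>x. g x \<partial>lebesgue)" using gm fg' by (rule Bochner_Integration.integral_cong_AE)
  also have "\<dots> = (\<integral>x. g x \<partial>lborel)" using g by (intro integral_completion) simp
  finally show ?thesis .
qed

text \<open>The derivative of \<open>v $ i\<close> in direction \<open>y\<close> is the
  \<open>i\<close>-th component of \<open>H x *v y\<close>, a linear combination of the partial
  derivatives for which the weak identity holds. Borel representatives are taken because the given
  functions are only Lebesgue measurable.\<close>

lemma H1div_representative:
  fixes u :: "real^'n::finite \<Rightarrow> real^'n"
  assumes "H1div k u G"
  obtains v H where "line_integral_formula v H" "AE x in lborel. u x = v x" "AE x in lborel. G x = H x"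
proof -
  have u: "L2_loc u" "L2_loc G" "weak_grad u G" using assms by (auto simp: H1div_def)
  obtain v where v[measurable]: "v \<in> borel_measurable borel" and uv: "AE x in lborel. u x = v x"
    using lebesgue_borel_representative[of u] u by (auto simp: L2_loc_def)
  obtain H where H[measurable]: "H \<in> borel_measurable borel" and GH: "AE x in lborel. G x = H x"
    using lebesgue_borel_representative[of G] u by (auto simp: L2_loc_def)
  have lv: "loc_integrable (\<lambda>x. v x $ i)" for i
    by (rule loc_integrable_L2_loc[OF u(1) v uv]) (auto simp: component_le_norm_cart)
  have lH: "loc_integrable (\<lambda>x. H x $ i $ j)" for i j
  proof (rule loc_integrable_L2_loc[OF u(2) H GH, where p="\<lambda>A. A $ i $ j"])
    fix A :: "real^'n^'n"
    show "\<bar>A $ i $ j\<bar> \<le> norm A" by (rule order_trans[OF component_le_norm_cart Finite_Cartesian_Product.norm_nth_le])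
  qed measurable
  have "AE x in lborel. v (x + y) $ i - v x $ i = (\<integral>s. indicator {0..1::real} s * (H (x + s *\<^sub>R y) *v y) $ i \<partial>lborel)" for y i
  proof -
    have h: "(\<lambda>x. (H x *v y) $ i) = (\<lambda>x. \<Sum>j\<in>UNIV. H x $ i $ j * y $ j)" by (simp add: matrix_vector_mult_def)
    show ?thesis
    proof (rule weak_derivative_translation[where f="\<lambda>x. v x $ i" and h="\<lambda>x. (H x *v y) $ i", OF lv])
      show "loc_integrable (\<lambda>x. (H x *v y) $ i)" unfolding h
        by (intro loc_integrable_sum loc_integrable_mult_const lH)
      fix \<phi> D assume tf: "test_fun \<phi> (D :: real^'n \<Rightarrow> real^'n)"
      obtain R C where R: "\<And>x. R < norm x \<Longrightarrow> \<phi> x = 0" "\<And>x. R < norm x \<Longrightarrow> D x = 0"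
        and C: "\<And>x. \<bar>\<phi> x\<bar> \<le> C" "\<And>x. norm (D x) \<le> C"
        and m[measurable]: "\<phi> \<in> borel_measurable borel" "D \<in> borel_measurable borel" using test_funE[OF tf] by metis
      have Cj: "\<bar>D x $ j\<bar> \<le> C" for x j using order_trans[OF component_le_norm_cart C(2)] .
      have i1: "integrable lborel (\<lambda>x. v x $ i * D x $ j)" for j
        by (rule integrable_loc_mult[OF lv _ Cj, where R=R]) (use R in auto)
      have i2: "integrable lborel (\<lambda>x. H x $ i $ j * \<phi> x)" for j
        by (rule integrable_loc_mult[OF lH _ C(1) R(1)]) auto
      have w: "(\<integral>x. v x $ i * D x $ j \<partial>lborel) = - (\<integral>x. H x $ i $ j * \<phi> x \<partial>lborel)" for j
      proof -
        have "(\<integral>x. u x $ i * D x $ j \<partial>lebesgue) = - (\<integral>x. G x $ i $ j * \<phi> x \<partial>lebesgue)"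
          using u(3) tf unfolding weak_grad_def by blast
        moreover have "(\<integral>x. u x $ i * D x $ j \<partial>lebesgue) = (\<integral>x. v x $ i * D x $ j \<partial>lborel)"
          by (rule integral_lebesgue_eq_lborel_AE) (measurable, use uv in \<open>eventually_elim, simp\<close>)
        moreover have "(\<integral>x. G x $ i $ j * \<phi> x \<partial>lebesgue) = (\<integral>x. H x $ i $ j * \<phi> x \<partial>lborel)"
          by (rule integral_lebesgue_eq_lborel_AE) (measurable, use GH in \<open>eventually_elim, simp\<close>)
        ultimately show ?thesis by simp
      qed
      have "(\<integral>x. v x $ i * (D x \<bullet> y) \<partial>lborel) = (\<integral>x. (\<Sum>j\<in>UNIV. v x $ i * D x $ j * y $ j) \<partial>lborel)"
        by (simp add: inner_vec_def sum_distrib_left mult.assoc)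
      also have "\<dots> = (\<Sum>j\<in>UNIV. (\<integral>x. v x $ i * D x $ j \<partial>lborel) * y $ j)"
        using i1 by simp
      also have "\<dots> = - (\<Sum>j\<in>UNIV. (\<integral>x. H x $ i $ j * \<phi> x \<partial>lborel) * y $ j)"
        by (simp add: w sum_negf)
      also have "(\<Sum>j\<in>UNIV. (\<integral>x. H x $ i $ j * \<phi> x \<partial>lborel) * y $ j) = (\<integral>x. (\<Sum>j\<in>UNIV. H x $ i $ j * \<phi> x * y $ j) \<partial>lborel)"
        using i2 by simp
      also have "\<dots> = (\<integral>x. (H x *v y) $ i * \<phi> x \<partial>lborel)"
        by (simp add: matrix_vector_mult_def sum_distrib_left ac_simps)
      finally show "(\<integral>x. v x $ i * (D x \<bullet> y) \<partial>lborel) = - (\<integral>x. (H x *v y) $ i * \<phi> x \<partial>lborel)" .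
    qed
  qed
  then have "line_integral_formula v H" unfolding line_integral_formula_def by simp
  then show ?thesis using uv GH by (rule that)
qed

text \<open>The formula for \<open>y = h *\<^sub>R e\<close> holds for each \<open>h\<close> off a
  null set of \<open>x\<close>. Exchanging quantifiers gives it for almost all \<open>h\<close> at
  once, and \<open>AE_line\<close> then moves the base point along the line. This is absolute
  continuity on lines, phrased for almost all \<open>p\<close> and \<open>h\<close>.\<close>

lemma AE_primitive_along_lines:
  fixes v :: "real^'n::finite \<Rightarrow> real^'n" and e :: "real^'n"
  assumes F: "line_integral_formula v H"
  shows "AE x in lborel. AE p in lborel. AE h in lborel. h > 0 \<longrightarrow>
    (\<forall>i. v (x + (p + h) *\<^sub>R e) $ i - v (x + p *\<^sub>R e) $ i = (\<integral>r. indicator {p..p+h} r * (H (x + r *\<^sub>R e) *v e) $ i \<partial>lborel))"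
proof -
  have [measurable]: "v \<in> borel_measurable borel" "H \<in> borel_measurable borel"
    "(\<lambda>A :: real^'n^'n. A *v e) \<in> borel_measurable borel"
    using F by (auto simp: line_integral_formula_def matrix_vector_mult_borel)
  define P where "P x h \<longleftrightarrow> (h > 0 \<longrightarrow> (\<forall>i. v (x + h *\<^sub>R e) $ i - v x $ i = (\<integral>r. indicator {0..h} r * (H (x + r *\<^sub>R e) *v e) $ i \<partial>lborel)))" for x h
  have "AE x in lborel. P x h" for h
  proof (cases "h > 0")
    case True
    have "AE x in lborel. \<forall>i. v (x + h *\<^sub>R e) $ i - v x $ i = (\<integral>s. indicator {0..1::real} s * (H (x + s *\<^sub>R (h *\<^sub>R e)) *v (h *\<^sub>R e)) $ i \<partial>lborel)"
      using F unfolding line_integral_formula_def AE_all_countable by blast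
    moreover have "(\<integral>s. indicator {0..1::real} s * (H (x + s *\<^sub>R (h *\<^sub>R e)) *v (h *\<^sub>R e)) $ i \<partial>lborel) =
        (\<integral>r. indicator {0..h} r * (H (x + r *\<^sub>R e) *v e) $ i \<partial>lborel)" for x i
    proof -
      \<comment> \<open>Substitution \<open>r = h * s\<close>; the factor \<open>h\<close> is
        absorbed by linearity of the matrix product.\<close>
      have "(\<integral>r. indicator {0..h} r * (H (x + r *\<^sub>R e) *v e) $ i \<partial>lborel) =
          h * (\<integral>s. indicator {0..h} (h * s) * (H (x + (h * s) *\<^sub>R e) *v e) $ i \<partial>lborel)"
        using lborel_integral_real_affine[of h "\<lambda>r. indicator {0..h} r * (H (x + r *\<^sub>R e) *v e) $ i" 0] True by simp
      also have "\<dots> = (\<integral>s. h * (indicator {0..h} (h * s) * (H (x + (h * s) *\<^sub>R e) *v e) $ i) \<partial>lborel)" by simp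
      also have "\<dots> = (\<integral>s. indicator {0..1::real} s * (H (x + s *\<^sub>R (h *\<^sub>R e)) *v (h *\<^sub>R e)) $ i \<partial>lborel)"
      proof (rule Bochner_Integration.integral_cong[OF refl])
        fix s :: real
        have "(h * s \<in> {0..h}) = (s \<in> {0..1})" using True by (auto simp: zero_le_mult_iff)
        then have "indicator {0..h} (h * s) = (indicator {0..1} s :: real)" by (simp only: indicator_def)
        then show "h * (indicator {0..h} (h * s) * (H (x + (h * s) *\<^sub>R e) *v e) $ i) =
            indicator {0..1} s * (H (x + s *\<^sub>R (h *\<^sub>R e)) *v (h *\<^sub>R e)) $ i"
          by (simp add: matrix_vector_mult_scaleR mult.commute)
      qed
      finally show ?thesis by simp
    qed
    ultimately show ?thesis unfolding P_def by simp
  qed (simp add: P_def)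
  then have "AE h in lborel. AE x in lborel. P x h" by simp
  \<comment> \<open>Exchanging the two quantifiers needs measurability of \<open>P\<close> jointly
    in \<open>x\<close> and \<open>h\<close>.\<close>
  moreover have "{z \<in> space (lborel \<Otimes>\<^sub>M lborel). P (fst z) (snd z)} \<in> sets (lborel \<Otimes>\<^sub>M lborel)"
  proof -
    have ind: "indicator {0..h} r = (if 0 \<le> r \<and> r \<le> h then 1 else (0::real))" for h r :: real by (simp add: indicator_def)
    have [measurable]: "(\<lambda>z. \<integral>r. indicator {0..snd z} r * (H (fst z + r *\<^sub>R e) *v e) $ i \<partial>lborel) \<in> borel_measurable (borel \<Otimes>\<^sub>M borel)" for i
      unfolding ind by measurable
    show ?thesis unfolding P_def by measurable
  qed
  ultimately have "AE x in lborel. AE h in lborel. P x h" using lborel_pair.AE_commute[of P] by simp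
  from AE_line[OF this, of e] have "AE x in lborel. AE p in lborel. AE h in lborel. P (x + p *\<^sub>R e) h" .
  moreover have "P (x + p *\<^sub>R e) h \<longleftrightarrow> (h > 0 \<longrightarrow> (\<forall>i. v (x + (p + h) *\<^sub>R e) $ i - v (x + p *\<^sub>R e) $ i =
      (\<integral>r. indicator {p..p+h} r * (H (x + r *\<^sub>R e) *v e) $ i \<partial>lborel)))" for x p h
  proof -
    have "(\<integral>r. indicator {0..h} r * (H (x + p *\<^sub>R e + r *\<^sub>R e) *v e) $ i \<partial>lborel) =
        (\<integral>r. indicator {p..p+h} r * (H (x + r *\<^sub>R e) *v e) $ i \<partial>lborel)" for i
    proof -
      have "(\<integral>r. indicator {p..p+h} r * (H (x + r *\<^sub>R e) *v e) $ i \<partial>lborel) =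
          (\<integral>r. indicator {p..p+h} (r + p) * (H (x + (r + p) *\<^sub>R e) *v e) $ i \<partial>lborel)"
        by (rule integral_lborel_translate[symmetric]) measurable
      also have "\<dots> = (\<integral>r. indicator {0..h} r * (H (x + p *\<^sub>R e + r *\<^sub>R e) *v e) $ i \<partial>lborel)"
      proof (rule Bochner_Integration.integral_cong[OF refl])
        fix r
        have "x + (r + p) *\<^sub>R e = x + p *\<^sub>R e + r *\<^sub>R e" by (simp add: algebra_simps)
        moreover have "indicator {p..p+h} (r + p) = (indicator {0..h} r :: real)" by (auto simp: indicator_def)
        ultimately show "indicator {p..p+h} (r + p) * (H (x + (r + p) *\<^sub>R e) *v e) $ i = indicator {0..h} r * (H (x + p *\<^sub>R e + r *\<^sub>R e) *v e) $ i"
          by (simp only:)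
      qed
      finally show ?thesis by simp
    qed
    then show ?thesis unfolding P_def by (simp add: scaleR_left_distrib add.assoc)
  qed
  ultimately show ?thesis by simp
qed

lemma off_plus_axis: "off k y + t *\<^sub>R axis k 1 = y + (t - y $ k) *\<^sub>R axis k 1"
  by (simp add: vec_eq_iff off_nth axis_def)

text \<open>A single slice is a null set, so changing \<open>u\<close> on a null set may change
  \<open>ubar\<close> at some levels; by Fubini's theorem this happens only on a null set of
  levels.\<close>

lemma AE_ubar_eq_slice_mean:
  fixes u v :: "real^'n::finite \<Rightarrow> real^'n" and k :: 'n
  assumes [measurable]: "v \<in> borel_measurable borel" and uv: "AE x in lborel. u x = v x"
  shows "AE t in lborel. ubar k u t = slice_mean k v t"
proof -
  let ?e = "axis k (1::real) :: real^'n"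
  obtain N where N: "N \<in> null_sets lborel" "{x. u x \<noteq> v x} \<subseteq> N" using uv by (auto simp: eventually_ae_filter)
  then have [measurable]: "N \<in> sets borel" by auto
  have "AE y in lborel. AE s in lborel. y + s *\<^sub>R ?e \<notin> N" by (rule AE_line[OF AE_not_in[OF N(1)]])
  then have "AE y in lborel. AE t in lborel. off k y + t *\<^sub>R ?e \<notin> N"
  proof eventually_elim
    case (elim y)
    from AE_lborel_translate[OF this, of "- y $ k"] show ?case by (simp add: off_plus_axis)
  qed
  moreover have "{z \<in> space (lborel \<Otimes>\<^sub>M lborel). off k (fst z) + snd z *\<^sub>R ?e \<notin> N} \<in> sets (lborel \<Otimes>\<^sub>M lborel)"
    by measurable
  ultimately have "AE t in lborel. AE y in lborel. off k y + t *\<^sub>R ?e \<notin> N"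
    using lborel_pair.AE_commute[of "\<lambda>y t. off k y + t *\<^sub>R ?e \<notin> N"] by simp
  then show ?thesis
  proof eventually_elim
    case (elim t)
    have eq: "(\<chi> i. if i = k then t else y $ i) = off k y + t *\<^sub>R ?e" for y :: "real^'n"
      by (simp add: vec_eq_iff off_nth axis_def)
    have "ubar k u t = (\<integral>y. indicator (cbox 0 1) y *\<^sub>R u (off k y + t *\<^sub>R ?e) \<partial>lebesgue)"
      unfolding ubar_def eq by (rule integral_restrict_space) simp
    also have "\<dots> = slice_mean k v t" unfolding slice_mean_def
    proof (rule integral_lebesgue_eq_lborel_AE)
      show "AE y in lborel. indicator (cbox 0 1) y *\<^sub>R u (off k y + t *\<^sub>R ?e) = indicator (cbox 0 1) y *\<^sub>R v (off k y + t *\<^sub>R ?e)"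
        using elim by eventually_elim (use N in auto)
    qed measurable
    finally show ?case .
  qed
qed

section \<open>Passing between lines and the strip\<close>

lemma ess_lim_cong_AE:
  assumes "AE t in lborel. f t = g t"
  shows "ess_lim_top f l = ess_lim_top g l" "ess_lim_bot f l = ess_lim_bot g l"
proof -
  have "(AE t in lborel. t \<ge> R \<longrightarrow> dist (f t) l < e) = (AE t in lborel. t \<ge> R \<longrightarrow> dist (g t) l < e)" 
    "(AE t in lborel. t \<le> R \<longrightarrow> dist (f t) l < e) = (AE t in lborel. t \<le> R \<longrightarrow> dist (g t) l < e)" for R e
    by (rule eventually_cong[OF assms], simp)+
  then show "ess_lim_top f l = ess_lim_top g l" "ess_lim_bot f l = ess_lim_bot g l"
    unfolding ess_lim_top_def ess_lim_bot_def by simp_all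
qed

lemma ess_lim_translate:
  assumes "ess_lim_top f l" "ess_lim_bot f l'"
  shows "ess_lim_top (\<lambda>t. f (t + c)) l" "ess_lim_bot (\<lambda>t. f (t + c)) l'"
proof -
  show "ess_lim_top (\<lambda>t. f (t + c)) l" unfolding ess_lim_top_def
  proof (intro allI impI)
    fix e :: real assume "e > 0"
    then obtain R where "AE t in lborel. t \<ge> R \<longrightarrow> dist (f t) l < e" using assms(1) by (auto simp: ess_lim_top_def)
    from AE_lborel_translate[OF this, of c] have "AE t in lborel. t \<ge> R - c \<longrightarrow> dist (f (t + c)) l < e"
      by eventually_elim auto
    then show "\<exists>R. AE t in lborel. t \<ge> R \<longrightarrow> dist (f (t + c)) l < e" by blast
  qed
  show "ess_lim_bot (\<lambda>t. f (t + c)) l'" unfolding ess_lim_bot_def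
  proof (intro allI impI)
    fix e :: real assume "e > 0"
    then obtain R where "AE t in lborel. t \<le> R \<longrightarrow> dist (f t) l' < e" using assms(2) by (auto simp: ess_lim_bot_def)
    from AE_lborel_translate[OF this, of c] have "AE t in lborel. t \<le> R - c \<longrightarrow> dist (f (t + c)) l' < e"
      by eventually_elim auto
    then show "\<exists>R. AE t in lborel. t \<le> R \<longrightarrow> dist (f (t + c)) l' < e" by blast
  qed
qed

lemma line_in_strip: "x \<in> cbox 0 1 \<Longrightarrow> x + s *\<^sub>R axis k 1 \<in> strip k"
  by (auto simp: strip_def mem_box_cart axis_def)

lemma AE_lines_of_AE_strip:
  assumes "AE x in lborel. x \<in> strip k \<longrightarrow> P x"
  shows "AE x in lborel. x \<in> cbox 0 1 \<longrightarrow> (AE s in lborel. P (x + s *\<^sub>R axis k 1))"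
  using AE_line[OF assms, of "axis k 1"]
proof eventually_elim
  case (elim x)
  show ?case
  proof
    assume "x \<in> cbox 0 1"
    then show "AE s in lborel. P (x + s *\<^sub>R axis k 1)"
      using elim line_in_strip[of x] by (auto elim!: eventually_mono)
  qed
qed

text \<open>Tonelli's theorem for the indicator of the failure set, hence the measurability of
  \<open>P\<close>.\<close>

lemma AE_strip_of_AE_lines:
  fixes P :: "real^'n::finite \<Rightarrow> bool"
  assumes [measurable]: "Measurable.pred borel P"
    and AE: "AE x in lborel. x \<in> cbox 0 1 \<longrightarrow> (AE s in lborel. P (x + s *\<^sub>R axis k 1))"
  shows "AE x in lborel. x \<in> strip k \<longrightarrow> P x"
proof -
  let ?f = "\<lambda>x. indicator {x. \<not> P x} x :: ennreal"
  have fm[measurable]: "?f \<in> borel_measurable borel" by measurable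
  have "(\<integral>\<^sup>+x\<in>strip k. ?f x \<partial>lborel) = (\<integral>\<^sup>+x\<in>cbox 0 1. (\<integral>\<^sup>+s. ?f (x + s *\<^sub>R axis k 1) \<partial>lborel) \<partial>lborel)"
    by (rule nn_integral_strip[OF fm])
  also have "\<dots> = (\<integral>\<^sup>+x. (0::ennreal) \<partial>(lborel :: (real^'n) measure))"
  proof (rule nn_integral_cong_AE)
    show "AE x in lborel. (\<integral>\<^sup>+s. ?f (x + s *\<^sub>R axis k 1) \<partial>lborel) * indicator (cbox 0 1) x = 0"
      using AE
    proof eventually_elim
      case (elim x)
      show ?case
      proof (cases "x \<in> cbox 0 1")
        case True
        then have "AE s in lborel. ?f (x + s *\<^sub>R axis k 1) = 0" using elim by (auto elim!: eventually_mono)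
        then have "(\<integral>\<^sup>+s. ?f (x + s *\<^sub>R axis k 1) \<partial>lborel) = (\<integral>\<^sup>+s. 0 \<partial>(lborel :: real measure))" by (rule nn_integral_cong_AE)
        then show ?thesis by simp
      qed simp
    qed
  qed
  finally have "(\<integral>\<^sup>+x\<in>strip k. ?f x \<partial>lborel) = 0" by simp
  then have "AE x in lborel. ?f x * indicator (strip k) x = 0" by (subst (asm) nn_integral_0_iff_AE) auto
  then show ?thesis by eventually_elim (auto simp: indicator_def split: if_splits)
qed

lemma AE_line_integral_finite:
  fixes f :: "real^'n::finite \<Rightarrow> ennreal"
  assumes f[measurable]: "f \<in> borel_measurable borel" and fin: "(\<integral>\<^sup>+x\<in>strip k. f x \<partial>lborel) < \<infinity>"
  shows "AE x in lborel. x \<in> cbox 0 1 \<longrightarrow> (\<integral>\<^sup>+s. f (x + s *\<^sub>R axis k 1) \<partial>lborel) < \<infinity>"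
proof -
  have "AE x in lborel. (\<integral>\<^sup>+s. f (x + s *\<^sub>R axis k 1) \<partial>lborel) * indicator (cbox 0 1) x \<noteq> \<infinity>"
  proof (rule nn_integral_PInf_AE)
    show "(\<integral>\<^sup>+x. (\<integral>\<^sup>+s. f (x + s *\<^sub>R axis k 1) \<partial>lborel) * indicator (cbox 0 1) x \<partial>lborel) \<noteq> \<infinity>"
      using fin unfolding nn_integral_strip[OF f] by simp
  qed measurable
  then show ?thesis by eventually_elim (auto simp: less_top)
qed

lemma grad_off_le: "grad_off k A \<le> (norm A)\<^sup>2" for A :: "real^'n::finite^'n"
  using norm_matrix_split[of A k] by simp

lemma slice_mean_deviation_finite:
  assumes F: "line_integral_formula v H" and fin: "(\<integral>\<^sup>+x\<in>strip k. ennreal ((norm (H x))\<^sup>2) \<partial>lborel) < \<infinity>"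
  shows "(\<integral>\<^sup>+x\<in>strip k. ennreal ((norm (slice_mean k v (x $ k) - v x))\<^sup>2) \<partial>lborel) < \<infinity>"
proof -
  obtain C where C: "\<And>v H. line_integral_formula v H \<Longrightarrow>
      (\<integral>\<^sup>+x\<in>strip k. ennreal ((norm (slice_mean k v (x $ k) - v x))\<^sup>2) \<partial>lborel)
      \<le> ennreal C * (\<integral>\<^sup>+x\<in>strip k. ennreal (grad_off k (H x)) \<partial>lborel)"
    by (rule strip_poincare[of k]) blast
  have "(\<integral>\<^sup>+x\<in>strip k. ennreal ((norm (slice_mean k v (x $ k) - v x))\<^sup>2) \<partial>lborel)
      \<le> ennreal C * (\<integral>\<^sup>+x\<in>strip k. ennreal (grad_off k (H x)) \<partial>lborel)" by (rule C[OF F])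
  also have "\<dots> \<le> ennreal C * (\<integral>\<^sup>+x\<in>strip k. ennreal ((norm (H x))\<^sup>2) \<partial>lborel)"
    by (intro mult_left_mono nn_integral_mono mult_right_mono ennreal_leI grad_off_le) auto
  also have "\<dots> < \<infinity>" using fin by (simp add: ennreal_mult_less_top)
  finally show ?thesis .
qed

text \<open>By the Poincare inequality the deviation from the slice mean is square integrable on
  almost every line, so the line approaches the limits of the mean in the sense required for the
  bound by \<open>geodW\<close>. The unit cube has measure one, so integrating the constant
  \<open>geodW W um up\<close> over it returns this constant.\<close>

lemma geodW_le_strip_energy:
  fixes W :: "real^'n::finite \<Rightarrow> real" and k :: 'n
  assumes W: "continuous_on UNIV W" "\<And>z. 0 \<le> W z" and F: "line_integral_formula v H"
    and fin: "(\<integral>\<^sup>+x\<in>strip k. ennreal ((norm (H x))\<^sup>2) \<partial>lborel) < \<infinity>"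
    and lim: "ess_lim_bot (slice_mean k v) um" "ess_lim_top (slice_mean k v) up"
  shows "geodW W um up \<le> (\<integral>\<^sup>+x\<in>strip k. ennreal ((norm (H x *v axis k 1))\<^sup>2 / 2 + W (v x)) \<partial>lborel)"
proof -
  let ?e = "axis k (1::real) :: real^'n"
  let ?f = "\<lambda>x. ennreal ((norm (H x *v ?e))\<^sup>2 / 2 + W (v x))"
  have [measurable]: "v \<in> borel_measurable borel" "H \<in> borel_measurable borel"
    "(\<lambda>A :: real^'n^'n. A *v ?e) \<in> borel_measurable borel"
    using F by (auto simp: line_integral_formula_def matrix_vector_mult_borel)
  have [measurable]: "W \<in> borel_measurable borel" using W(1) by (rule borel_measurable_continuous_onI)
  have "(\<integral>\<^sup>+x\<in>strip k. ennreal ((norm (H x *v ?e))\<^sup>2) \<partial>lborel) \<le> (\<integral>\<^sup>+x\<in>strip k. ennreal ((norm (H x))\<^sup>2) \<partial>lborel)"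
    by (intro nn_integral_mono mult_right_mono ennreal_leI) (auto simp: norm_matrix_split[of _ k] grad_off_nonneg)
  then have fin1: "(\<integral>\<^sup>+x\<in>strip k. ennreal ((norm (H x *v ?e))\<^sup>2) \<partial>lborel) < \<infinity>" using fin by (rule order_le_less_trans)
  have "AE x in lborel. x \<in> cbox 0 1 \<longrightarrow> (\<integral>\<^sup>+s. ennreal ((norm (H (x + s *\<^sub>R ?e) *v ?e))\<^sup>2) \<partial>lborel) < \<infinity>"
    by (rule AE_line_integral_finite[OF _ fin1]) measurable
  moreover have "AE x in lborel. x \<in> cbox 0 1 \<longrightarrow> (\<integral>\<^sup>+s. ennreal ((norm (slice_mean k v ((x + s *\<^sub>R ?e) $ k) - v (x + s *\<^sub>R ?e)))\<^sup>2) \<partial>lborel) < \<infinity>"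
    by (rule AE_line_integral_finite[OF _ slice_mean_deviation_finite[OF F fin]]) measurable
  ultimately have main: "AE x in lborel. x \<in> cbox 0 1 \<longrightarrow> geodW W um up \<le> (\<integral>\<^sup>+s. ?f (x + s *\<^sub>R ?e) \<partial>lborel)"
    using AE_primitive_along_lines[OF F, of ?e]
  proof eventually_elim
    case (elim x)
    show ?case
    proof
      assume x: "x \<in> cbox 0 1"
      let ?g = "\<lambda>s. H (x + s *\<^sub>R ?e) *v ?e"
      have gm[measurable]: "?g \<in> borel_measurable borel" by measurable
      have gfin: "(\<integral>\<^sup>+s. ennreal ((norm (?g s))\<^sup>2) \<partial>lborel) < \<infinity>" using elim x by blast
      show "geodW W um up \<le> (\<integral>\<^sup>+s. ?f (x + s *\<^sub>R ?e) \<partial>lborel)"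
      \<comment> \<open>The parameter \<open>s\<close> on the line through \<open>x\<close>
        corresponds to level \<open>s + x $ k\<close>, whence the shift of the mean.\<close>
      proof (rule geodW_le_line_energy[OF W, where b="\<lambda>s. slice_mean k v (s + x $ k)"])
        have gi: "integrable lborel (\<lambda>r. indicator {p..q} r *\<^sub>R ?g r)" for p q
        proof (rule integrable_indicator_square)
          have "(\<integral>\<^sup>+s\<in>{p..q}. ennreal ((norm (?g s))\<^sup>2) \<partial>lborel) \<le> (\<integral>\<^sup>+s. ennreal ((norm (?g s))\<^sup>2) \<partial>lborel)"
            by (rule nn_integral_mono) (auto simp: indicator_def)
          then show "(\<integral>\<^sup>+s\<in>{p..q}. ennreal ((norm (?g s))\<^sup>2) \<partial>lborel) < \<infinity>" using gfin by (rule order_le_less_trans)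
        qed (auto simp: emeasure_lborel_Icc_eq)
        have comp: "(\<integral>r. indicator {p..q} r *\<^sub>R ?g r \<partial>lborel) $ i = (\<integral>r. indicator {p..q} r * ?g r $ i \<partial>lborel)" for p q i
          using integral_bounded_linear[OF bounded_linear_vec_nth[of i] gi[of p q]] by simp
        have "AE p in lborel. AE h in lborel. h > 0 \<longrightarrow>
          (\<forall>i. v (x + (p + h) *\<^sub>R ?e) $ i - v (x + p *\<^sub>R ?e) $ i = (\<integral>r. indicator {p..p+h} r * ?g r $ i \<partial>lborel))"
          using elim by blast
        then show "AE p in lborel. AE h in lborel. h > 0 \<longrightarrow>
          v (x + (p + h) *\<^sub>R ?e) - v (x + p *\<^sub>R ?e) = (\<integral>r. indicator {p..p+h} r *\<^sub>R ?g r \<partial>lborel)"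
          unfolding vec_eq_iff comp by simp
        have "(\<integral>\<^sup>+s. ennreal ((norm (slice_mean k v ((x + s *\<^sub>R ?e) $ k) - v (x + s *\<^sub>R ?e)))\<^sup>2) \<partial>lborel) < \<infinity>"
          using elim x by blast
        moreover have "(x + s *\<^sub>R ?e) $ k = s + x $ k" for s by (simp add: axis_def)
        ultimately show "(\<integral>\<^sup>+s. ennreal ((norm (v (x + s *\<^sub>R ?e) - slice_mean k v (s + x $ k)))\<^sup>2) \<partial>lborel) < \<infinity>"
          by (simp only: norm_minus_commute)
        show "ess_lim_bot (\<lambda>s. slice_mean k v (s + x $ k)) um" "ess_lim_top (\<lambda>s. slice_mean k v (s + x $ k)) up"
          using ess_lim_translate[OF lim(2,1), of "x $ k"] by auto
      qed (use gfin in \<open>measurable | assumption\<close>)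
    qed
  qed
  have "geodW W um up = (\<integral>\<^sup>+x. geodW W um up * indicator (cbox 0 1 :: (real^'n) set) x \<partial>lborel)"
    by (subst nn_integral_cmult_indicator) (auto simp: emeasure_unit_cbox)
  also have "\<dots> \<le> (\<integral>\<^sup>+x\<in>cbox 0 1. (\<integral>\<^sup>+s. ?f (x + s *\<^sub>R ?e) \<partial>lborel) \<partial>lborel)"
    by (rule nn_integral_mono_AE, use main in eventually_elim) (auto simp: indicator_def)
  also have "\<dots> = (\<integral>\<^sup>+x\<in>strip k. ?f x \<partial>lborel)"
    by (rule nn_integral_strip[symmetric]) measurable
  finally show ?thesis .
qed

section \<open>One-dimensionality\<close>

lemma periodic_off_lattice:
  fixes u :: "real^'n::finite \<Rightarrow> 'b" and m :: "'n \<Rightarrow> int"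
  assumes "periodic_off k u"
  shows "u (x + (\<chi> i. if i = k then 0 else real_of_int (m i))) = u x"
proof -
  have nat: "u (x + real n *\<^sub>R axis i 1) = u x" if "i \<noteq> k" for i n x
  proof (induction n)
    case (Suc n)
    have "x + real (Suc n) *\<^sub>R axis i 1 = (x + real n *\<^sub>R axis i 1) + axis i 1" by (simp add: algebra_simps)
    then show ?case using Suc assms that unfolding periodic_off_def by metis
  qed simp
  have int: "u (x + real_of_int z *\<^sub>R axis i 1) = u x" if "i \<noteq> k" for i z x
  proof (cases "z \<ge> 0")
    case True
    then show ?thesis using nat[OF that, of x "nat z"] by simp
  next
    case False
    then show ?thesis using nat[OF that, of "x + real_of_int z *\<^sub>R axis i 1" "nat (- z)"] by simp
  qed
  have lat: "u (x + (\<Sum>i\<in>S. real_of_int (m i) *\<^sub>R axis i 1)) = u x" if "finite S" "k \<notin> S" for S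
    using that
  proof (induction S)
    case (insert i S)
    have eq: "x + (\<Sum>i\<in>insert i S. real_of_int (m i) *\<^sub>R axis i 1) = (x + (\<Sum>i\<in>S. real_of_int (m i) *\<^sub>R axis i 1)) + real_of_int (m i) *\<^sub>R axis i 1"
      using insert by (simp add: ac_simps)
    have "i \<noteq> k" "k \<notin> S" using insert.prems by auto
    show ?case unfolding eq int[OF \<open>i \<noteq> k\<close>] by (rule insert.IH[OF \<open>k \<notin> S\<close>])
  qed simp
  have eq: "(\<Sum>i\<in>-{k}. real_of_int (m i) *\<^sub>R axis i 1) = (\<chi> i. if i = k then 0 else real_of_int (m i))"
    by (simp add: vec_eq_iff axis_def if_distrib cong: if_cong)
  show ?thesis using lat[of "-{k}"] unfolding eq by simp
qed

text \<open>Countably many lattice translates of the strip cover the space, and both sides are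
  invariant under these translations.\<close>

lemma AE_of_AE_strip_periodic:
  fixes u :: "real^'n::finite \<Rightarrow> 'b" and k :: 'n
  assumes per: "periodic_off k u" and AE: "AE x in lborel. x \<in> strip k \<longrightarrow> u x = g (x $ k)"
  shows "AE x in lborel. u x = g (x $ k)"
proof -
  let ?c = "\<lambda>m :: 'n \<Rightarrow> int. (\<chi> i. if i = k then 0 else real_of_int (m i)) :: real^'n"
  have "AE x in lborel. \<forall>m. x + ?c m \<in> strip k \<longrightarrow> u (x + ?c m) = g ((x + ?c m) $ k)"
    unfolding AE_all_countable using AE_lborel_translate[OF AE] by blast
  then show ?thesis
  proof eventually_elim
    case (elim x)
    let ?m = "\<lambda>i. - \<lfloor>x $ i\<rfloor>"
    have "x + ?c ?m \<in> strip k" unfolding strip_def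
    proof (intro CollectI allI impI)
      fix i assume "i \<noteq> k"
      moreover have "0 \<le> x $ i - of_int \<lfloor>x $ i\<rfloor>" "x $ i - of_int \<lfloor>x $ i\<rfloor> \<le> 1" by linarith+
      ultimately show "0 \<le> (x + ?c ?m) $ i \<and> (x + ?c ?m) $ i \<le> 1" by simp
    qed
    then have "u (x + ?c ?m) = g ((x + ?c ?m) $ k)" by (rule elim[THEN spec, THEN mp])
    then show ?case using periodic_off_lattice[OF per, of x ?m] by simp
  qed
qed

text \<open>Along almost every line the component is constant, since its derivative in direction
  \<open>k\<close> vanishes, and it coincides with that of the mean, which converges to
  \<open>l\<close>. Hence the constant is the limit.\<close>

lemma AE_component_eq_limit:
  fixes v :: "real^'n::finite \<Rightarrow> real^'n" and k i :: 'n
  assumes F: "line_integral_formula v H"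
    and mean: "AE x in lborel. x \<in> strip k \<longrightarrow> v x = slice_mean k v (x $ k)"
    and zero: "AE x in lborel. x \<in> strip k \<longrightarrow> H x $ i $ k = 0"
    and lim: "ess_lim_top (slice_mean k v) l"
  shows "AE x in lborel. x \<in> strip k \<longrightarrow> v x $ i = l $ i"
proof (rule AE_strip_of_AE_lines)
  let ?e = "axis k (1::real) :: real^'n"
  have [measurable]: "v \<in> borel_measurable borel" using F by (auto simp: line_integral_formula_def)
  show "Measurable.pred borel (\<lambda>x. v x $ i = l $ i)" by measurable
  have He: "(A *v ?e) $ i = A $ i $ k" for A :: "real^'n^'n" by (simp add: matrix_vector_mult_basis column_def)
  show "AE x in lborel. x \<in> cbox 0 1 \<longrightarrow> (AE s in lborel. v (x + s *\<^sub>R ?e) $ i = l $ i)"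
    using AE_lines_of_AE_strip[OF mean] AE_lines_of_AE_strip[OF zero] AE_primitive_along_lines[OF F, of ?e]
  proof eventually_elim
    case (elim x)
    show ?case
    proof
      assume x: "x \<in> cbox 0 1"
      have m: "AE s in lborel. v (x + s *\<^sub>R ?e) = slice_mean k v (s + x $ k)"
        using elim(1) x by (simp add: add.commute)
      have z: "AE s in lborel. H (x + s *\<^sub>R ?e) $ i $ k = 0" using elim(2) x by blast
      have int0: "(\<integral>r. indicator {p..q} r * (H (x + r *\<^sub>R ?e) *v ?e) $ i \<partial>lborel) = 0" for p q
        by (rule integral_eq_zero_AE, use z in eventually_elim) (simp add: He)
      from elim(3) show "AE s in lborel. v (x + s *\<^sub>R ?e) $ i = l $ i"
      proof eventually_elim
        case (elim p)
        have const: "AE h in lborel. h > 0 \<longrightarrow> v (x + (p + h) *\<^sub>R ?e) $ i = v (x + p *\<^sub>R ?e) $ i"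
          using elim by eventually_elim (auto dest: spec[of _ i] simp: int0)
        have m': "AE h in lborel. v (x + (p + h) *\<^sub>R ?e) = slice_mean k v (h + p + x $ k)"
          using AE_lborel_translate[OF m, of p] by (simp add: add.commute)
        have "\<bar>v (x + p *\<^sub>R ?e) $ i - l $ i\<bar> \<le> 0"
        proof (rule field_le_epsilon)
          fix \<epsilon> :: real assume "\<epsilon> > 0"
          then obtain R where "AE t in lborel. t \<ge> R \<longrightarrow> dist (slice_mean k v t) l < \<epsilon>" using lim by (auto simp: ess_lim_top_def)
          from AE_lborel_translate[OF this, of "p + x $ k"]
          have R: "AE h in lborel. h \<ge> R - (p + x $ k) \<longrightarrow> dist (slice_mean k v (h + p + x $ k)) l < \<epsilon>"
            by eventually_elim (auto simp: add.assoc)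
          have "\<exists>h. dist (v (x + (p + h) *\<^sub>R ?e)) l < \<epsilon> \<and> v (x + (p + h) *\<^sub>R ?e) $ i = v (x + p *\<^sub>R ?e) $ i"
          proof (rule ccontr)
            \<comment> \<open>Far out all three almost-everywhere statements apply together, and a
              half-line is not null.\<close>
            let ?A = "{max 0 (R - (p + x $ k))<..}"
            assume no: "\<not> ?thesis"
            have "AE h in lborel. h \<notin> ?A" using R const m'
            proof eventually_elim
              case (elim h)
              show ?case
              proof
                assume "h \<in> ?A"
                then have "dist (v (x + (p + h) *\<^sub>R ?e)) l < \<epsilon>" "v (x + (p + h) *\<^sub>R ?e) $ i = v (x + p *\<^sub>R ?e) $ i"
                  using elim by auto
                then show False using no by blast
              qed
            qed
            then have "emeasure lborel ?A \<le> emeasure lborel ({} :: real set)" by (intro emeasure_mono_AE) auto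
            then show False using emeasure_lborel_half_lines(1) by simp
          qed
          then obtain h where h: "dist (v (x + (p + h) *\<^sub>R ?e)) l < \<epsilon>" "v (x + (p + h) *\<^sub>R ?e) $ i = v (x + p *\<^sub>R ?e) $ i" by blast
          have "\<bar>v (x + p *\<^sub>R ?e) $ i - l $ i\<bar> = \<bar>(v (x + (p + h) *\<^sub>R ?e) - l) $ i\<bar>" using h(2) by simp
          also have "\<dots> \<le> norm (v (x + (p + h) *\<^sub>R ?e) - l)" by (rule component_le_norm_cart)
          also have "\<dots> \<le> \<epsilon>" using h(1) by (simp add: dist_norm)
          finally show "\<bar>v (x + p *\<^sub>R ?e) $ i - l $ i\<bar> \<le> 0 + \<epsilon>" by simp
        qed
        then show ?case by simp
      qed
    qed
  qed
qed

text \<open>Vanishing transversal derivatives reduce \<open>v\<close> to its slice mean by the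
  Poincare inequality, and reduce the divergence to the entry \<open>H x $ k $ k\<close>, which is
  therefore zero.\<close>

lemma one_dim_if_grad_off_zero:
  fixes u v :: "real^'n::finite \<Rightarrow> real^'n" and k :: 'n
  assumes F: "line_integral_formula v H" and per: "periodic_off k u" and uv: "AE x in lborel. u x = v x"
    and tr: "AE x in lborel. (\<Sum>i\<in>UNIV. H x $ i $ i) = 0"
    and zero: "(\<integral>\<^sup>+x\<in>strip k. ennreal (grad_off k (H x)) \<partial>lborel) = 0"
    and lim: "ess_lim_top (slice_mean k v) up"
  shows "\<exists>g. (\<forall>t. g t $ k = up $ k) \<and> (AE x in lborel. u x = g (x $ k))"
proof -
  have [measurable]: "v \<in> borel_measurable borel" "H \<in> borel_measurable borel" using F by (auto simp: line_integral_formula_def)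
  obtain C where C: "\<And>v H. line_integral_formula v H \<Longrightarrow>
      (\<integral>\<^sup>+x\<in>strip k. ennreal ((norm (slice_mean k v (x $ k) - v x))\<^sup>2) \<partial>lborel)
      \<le> ennreal C * (\<integral>\<^sup>+x\<in>strip k. ennreal (grad_off k (H x)) \<partial>lborel)"
    by (rule strip_poincare[of k]) blast
  have "(\<integral>\<^sup>+x\<in>strip k. ennreal ((norm (slice_mean k v (x $ k) - v x))\<^sup>2) \<partial>lborel) = 0"
    using C[OF F] zero by simp
  then have "AE x in lborel. ennreal ((norm (slice_mean k v (x $ k) - v x))\<^sup>2) * indicator (strip k) x = 0"
    by (subst (asm) nn_integral_0_iff_AE) auto
  then have mean: "AE x in lborel. x \<in> strip k \<longrightarrow> v x = slice_mean k v (x $ k)"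
    by eventually_elim (auto simp: indicator_def ennreal_eq_0_iff)
  have "AE x in lborel. ennreal (grad_off k (H x)) * indicator (strip k) x = 0"
    using zero by (subst (asm) nn_integral_0_iff_AE) auto
  then have Hkk: "AE x in lborel. x \<in> strip k \<longrightarrow> H x $ k $ k = 0"
    using tr
  proof eventually_elim
    case (elim x)
    show ?case
    proof
      assume "x \<in> strip k"
      then have "grad_off k (H x) = 0" using elim(1) grad_off_nonneg[of k "H x"] by (simp add: ennreal_eq_0_iff)
      then have off0: "H x $ i $ j = 0" if "j \<noteq> k" for i j
        using that unfolding grad_off_def by (auto simp: sum_nonneg_eq_0_iff sum_nonneg)
      have "(\<Sum>i\<in>UNIV. H x $ i $ i) = H x $ k $ k + (\<Sum>i\<in>-{k}. H x $ i $ i)"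
        by (simp add: sum.remove[of UNIV k] Compl_eq_Diff_UNIV)
      then show "H x $ k $ k = 0" using elim(2) off0 by simp
    qed
  qed
  \<comment> \<open>The \<open>k\<close>-th component of the mean is known only almost everywhere;
    overwriting it places \<open>g t\<close> in the hyperplane for every \<open>t\<close>.\<close>
  define g where "g t = (\<chi> i. if i = k then up $ k else slice_mean k v t $ i)" for t
  have "AE x in lborel. x \<in> strip k \<longrightarrow> u x = g (x $ k)"
    using AE_component_eq_limit[OF F mean Hkk lim] mean uv
    by eventually_elim (auto simp: g_def vec_eq_iff)
  from AE_of_AE_strip_periodic[OF per this] show ?thesis by (intro exI[of _ g]) (auto simp: g_def)
qed

section \<open>Comparison of the minimal energy with the geodesic distances\<close>

lemma minimizer_energy_le_geodW_a:
  fixes W :: "real^'n::finite \<Rightarrow> real"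
  assumes W: "continuous_on UNIV W" "\<And>z. 0 \<le> W z" "W um = 0" "W up = 0"
    and min: "\<And>v H. admissible k um up v H \<Longrightarrow> E \<le> energy k W v H"
  shows "E \<le> geodW_a k a W um up"
  unfolding geodW_a_def
proof (rule INF_greatest)
  fix \<gamma> :: "real \<Rightarrow> real^'n" assume "\<gamma> \<in> {\<gamma>. (\<exists>L. L-lipschitz_on {-1..1} \<gamma>) \<and> (\<forall>t\<in>{-1..1}. \<gamma> t $ k = a) \<and> \<gamma> (-1) = um \<and> \<gamma> 1 = up}"
  then obtain L where L: "L-lipschitz_on {-1..1} \<gamma>" and \<gamma>: "\<And>t. t \<in> {-1..1} \<Longrightarrow> \<gamma> t \<in> {z. z $ k = a}" "\<gamma> (-1) = um" "\<gamma> 1 = up" by auto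
  show "E \<le> wlength W \<gamma>"
  proof (rule ennreal_le_epsilon)
    fix e :: real assume "e > 0"
    then have e: "e / 2 > 0" by simp
    \<comment> \<open>Polygons inscribed in a curve of the hyperplane have their vertices in it, so
      the competitor they produce is divergence free. Each of the two approximations costs
      \<open>e / 2\<close>.\<close>
    obtain c where c: "polygonal_cost W {z. z $ k = a} um up c" "ennreal c \<le> wlength W \<gamma> + ennreal (e / 2)"
      using polygonal_cost_le_wlength[OF W(1,2) L \<gamma>(1) e] \<gamma>(2,3) by metis
    obtain v H where vH: "admissible k um up v H" "energy k W v H \<le> ennreal (c + e / 2)"
      using one_dim_competitor[OF c(1) W e] by blast
    have "E \<le> ennreal (c + e / 2)" using min[OF vH(1)] vH(2) by (rule order_trans)
    also have "\<dots> = ennreal c + ennreal (e / 2)" using polygonal_cost_nonneg[OF c(1)] e by (intro ennreal_plus) auto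
    also have "\<dots> \<le> wlength W \<gamma> + ennreal (e / 2) + ennreal (e / 2)" using c(2) by (rule add_right_mono)
    also have "\<dots> = wlength W \<gamma> + ennreal e" using e by (simp add: add.assoc flip: ennreal_plus)
    finally show "E \<le> wlength W \<gamma> + ennreal e" .
  qed
qed

text \<open>The straight segment from \<open>um\<close> to \<open>up\<close> lies in the hyperplane
  and \<open>W\<close> is bounded on it, which gives a competitor of finite energy. Finiteness is
  what permits cancellation in \<open>ennreal\<close>.\<close>

lemma minimizer_energy_finite:
  fixes W :: "real^'n::finite \<Rightarrow> real"
  assumes W: "continuous_on UNIV W" "\<And>z. 0 \<le> W z" "W um = 0" "W up = 0" and a: "um $ k = a" "up $ k = a"
    and min: "\<And>v H. admissible k um up v H \<Longrightarrow> E \<le> energy k W v H"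
  shows "E < \<infinity>"
proof -
  have "compact ((\<lambda>z. sqrt (2 * W z)) ` closed_segment um up)"
    by (intro compact_continuous_image continuous_intros continuous_on_subset[OF W(1)]) auto
  then obtain M where M: "\<And>z. z \<in> closed_segment um up \<Longrightarrow> sqrt (2 * W z) \<le> M"
    using bounded_imp_bdd_above compact_imp_bounded unfolding bdd_above_def by (metis imageI)
  have M0: "0 \<le> M" using M[of um] W by simp
  have "polygonal_cost W {z. z $ k = a} um um 0" by (rule polygonal_cost.start) (simp add: a)
  then have pc: "polygonal_cost W {z. z $ k = a} um up (0 + M * dist um up)"
    by (rule polygonal_cost.extend) (use M M0 a in auto)
  obtain v H where vH: "admissible k um up v H" "energy k W v H \<le> ennreal (0 + M * dist um up + 1)"
    using one_dim_competitor[OF pc W zero_less_one] by blast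
  have "E \<le> ennreal (0 + M * dist um up + 1)" using min[OF vH(1)] vH(2) by (rule order_trans)
  then show ?thesis using order_le_less_trans by fastforce
qed

theorem theorem4p26:
  fixes W :: "real^'n::finite \<Rightarrow> real" and k :: 'n and a :: real
    and um up :: "real^'n" and u :: "real^'n \<Rightarrow> real^'n"
  assumes "CARD('n) \<ge> 2"
    and "continuous_on UNIV W" and "\<forall>z. W z \<ge> 0" and "growth_G W"
    and "um $ k = a" and "up $ k = a" and "W um = 0" and "W up = 0"
    and "geodW_a k a W um up = geodW W um up"
    and "global_minimizer k W um up u"
  shows "\<exists>g :: real \<Rightarrow> real^'n. (\<forall>t. g t $ k = a) \<and> (AE x in lebesgue. u x = g (x $ k))"
proof -
  have W: "continuous_on UNIV W" "\<And>z. 0 \<le> W z" "W um = 0" "W up = 0" using assms by auto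
  have [measurable]: "W \<in> borel_measurable borel" using W(1) by (rule borel_measurable_continuous_onI)
  obtain G where adm: "admissible k um up u G"
    and min: "\<And>v H. admissible k um up v H \<Longrightarrow> energy k W u G \<le> energy k W v H"
    using assms(10) by (auto simp: global_minimizer_def)
  have H1: "H1div k u G" using adm by (simp add: admissible_def)
  obtain v H where F: "line_integral_formula v H" and uv: "AE x in lborel. u x = v x" and GH: "AE x in lborel. G x = H x"
    using H1div_representative[OF H1] by blast
  have [measurable]: "v \<in> borel_measurable borel" "H \<in> borel_measurable borel"
    "(\<lambda>A :: real^'n^'n. A *v axis k 1) \<in> borel_measurable borel"
    using F by (auto simp: line_integral_formula_def matrix_vector_mult_borel)
  have lim: "ess_lim_bot (slice_mean k v) um" "ess_lim_top (slice_mean k v) up"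
    using adm ess_lim_cong_AE[OF AE_ubar_eq_slice_mean[of v u k, OF _ uv]] by (auto simp: admissible_def)
  have "(\<integral>\<^sup>+x\<in>strip k. ennreal ((norm (H x))\<^sup>2) \<partial>lborel) = (\<integral>\<^sup>+x\<in>strip k. ennreal ((norm (G x))\<^sup>2) \<partial>lborel)"
    by (rule nn_integral_cong_AE, use GH in eventually_elim) simp
  then have fin: "(\<integral>\<^sup>+x\<in>strip k. ennreal ((norm (H x))\<^sup>2) \<partial>lborel) < \<infinity>"
    using H1 by (simp add: H1div_def nn_integral_completion)
  let ?A = "\<integral>\<^sup>+x\<in>strip k. ennreal ((norm (H x *v axis k 1))\<^sup>2 / 2 + W (v x)) \<partial>lborel"
  let ?B = "\<integral>\<^sup>+x\<in>strip k. ennreal (grad_off k (H x) / 2) \<partial>lborel"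
  \<comment> \<open>The energy splits into the part \<open>?A\<close> seen by lines in direction
    \<open>k\<close> and the transversal surplus \<open>?B\<close>.\<close>
  have "energy k W u G = (\<integral>\<^sup>+x\<in>strip k. ennreal ((norm (G x))\<^sup>2 / 2 + W (u x)) \<partial>lborel)"
    by (simp add: energy_def nn_integral_completion)
  also have "\<dots> = (\<integral>\<^sup>+x. ennreal ((norm (H x *v axis k 1))\<^sup>2 / 2 + W (v x)) * indicator (strip k) x + ennreal (grad_off k (H x) / 2) * indicator (strip k) x \<partial>lborel)"
  proof (rule nn_integral_cong_AE)
    show "AE x in lborel. ennreal ((norm (G x))\<^sup>2 / 2 + W (u x)) * indicator (strip k) x =
      ennreal ((norm (H x *v axis k 1))\<^sup>2 / 2 + W (v x)) * indicator (strip k) x + ennreal (grad_off k (H x) / 2) * indicator (strip k) x"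
      using uv GH
    proof eventually_elim
      case (elim x)
      have "(norm (G x))\<^sup>2 / 2 + W (u x) = ((norm (H x *v axis k 1))\<^sup>2 / 2 + W (v x)) + grad_off k (H x) / 2"
        using elim by (simp add: norm_matrix_split[of _ k] add_divide_distrib)
      then show ?case using W(2) grad_off_nonneg[of k "H x"] by (simp add: ennreal_plus distrib_right)
    qed
  qed
  also have "\<dots> = ?A + ?B" by (rule nn_integral_add) measurable
  finally have E: "energy k W u G = ?A + ?B" .
  \<comment> \<open>The only place where the two geodesic distances are identified: the upper bound
    comes from curves in the hyperplane, the lower bound from curves in the whole space.\<close>
  have "?A + ?B \<le> geodW W um up"
    using minimizer_energy_le_geodW_a[OF W min, of a] unfolding assms(9) E .
  also have "\<dots> \<le> ?A" by (rule geodW_le_strip_energy[OF W(1,2) F fin lim])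
  finally have "?A + ?B \<le> ?A" .
  then have "?A + ?B \<le> ?A + 0" by simp
  moreover have "?A \<noteq> \<infinity>" using minimizer_energy_finite[OF W assms(5,6) min] unfolding E by (auto simp: less_top)
  ultimately have "?B = 0" unfolding ennreal_add_left_cancel_le by simp
  then have "AE x in lborel. ennreal (grad_off k (H x) / 2) * indicator (strip k) x = 0"
    by (subst (asm) nn_integral_0_iff_AE) auto
  then have "AE x in lborel. ennreal (grad_off k (H x)) * indicator (strip k) x = 0"
    by eventually_elim (auto simp: indicator_def ennreal_eq_0_iff split: if_splits)
  then have zero: "(\<integral>\<^sup>+x\<in>strip k. ennreal (grad_off k (H x)) \<partial>lborel) = 0"
    by (subst nn_integral_0_iff_AE) auto
  have "AE x in lborel. (\<Sum>i\<in>UNIV. G x $ i $ i) = 0" using H1 by (simp add: H1div_def AE_completion_iff)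
  then have tr: "AE x in lborel. (\<Sum>i\<in>UNIV. H x $ i $ i) = 0" using GH by eventually_elim simp
  have "periodic_off k u" using H1 by (simp add: H1div_def)
  from one_dim_if_grad_off_zero[OF F this uv tr zero lim(2)] show ?thesis
    using assms(6) by (auto intro: AE_completion)
qed

end
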